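(* The following three properties hold. 1. Re-indexing the components of a link may result in a link that is not Crowell equivalent to the original: there are a classical link $L=K_1\cup\dots\cup K_\mu$ and a permutation $\sigma$ of $\{1,\dots,\mu\}$ such that the link obtained from $L$ by re-indexing its components according to $\sigma$ is not Crowell equivalent to $L$. 2. There are Crowell equivalent classical links $L=K_1\cup\dots\cup K_\mu$ and $L'=K'_1\cup\dots\cup K'_\mu$ and an $m \leq \mu$ such that the sublinks $K_1\cup\dots\cup K_m$ and $K'_1\cup\dots\cup K'_m$ are not Crowell equivalent. 3. There are classical links $L=K_1\cup\dots\cup K_\mu$ and $L'=K'_1\cup\dots\cup K'_\mu$ that are not Crowell equivalent, but whose reduced (one-variable) link module sequences are equivalent.
   Context: Links are classical: oriented, tame, in $\mathbb{S}^3$, with indexed components. $\Lambda_\mu=\mathbb{Z}[t_1^{\pm1},\dots,t_\mu^{\pm1}]$ is the Laurent polynomial ring and $I_\mu$ is its ideal generated by $t_1-1,\dots,t_\mu-1$. Alexander module. Let $D$ be a diagram of $L=K_1\cup\dots\cup K_\mu$, with set of arcs $A(D)$ and set of crossings $C(D)$; $\kappa_D(a)=i$ means the arc $a$ belongs to the image of $K_i$. At a crossing $c$ let $a_{\mathrm{over}}$ be the overpassing arc, and let $a_{\mathrm{left}}$, $a_{\mathrm{right}}$ be the underpassing arcs lying to the left and to the right of $a_{\mathrm{over}}$ with respect to the orientation of $a_{\mathrm{over}}$. Let $\rho_D:\Lambda_\mu^{C(D)}\to\Lambda_\mu^{A(D)}$ be the $\Lambda_\mu$-linear map of free modules with $\rho_D(c)=(1-t_{\kappa_D(a_{\mathrm{left}})})a_{\mathrm{over}}+t_{\kappa_D(a_{\mathrm{over}})}a_{\mathrm{right}}-a_{\mathrm{left}}$.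 The Alexander module is $M_A(L)=\mathrm{coker}\,\rho_D$, with quotient map $\gamma_D:\Lambda_\mu^{A(D)}\to M_A(L)$, and the Crowell map $\phi_L:M_A(L)\to I_\mu$ is the $\Lambda_\mu$-linear map with $\phi_L(\gamma_D(a))=t_{\kappa_D(a)}-1$ for all $a\in A(D)$. Up to isomorphism compatible with $\phi_L$ this does not depend on $D$. The link module sequence of $L$ is $0\to\ker\phi_L\to M_A(L)\xrightarrow{\phi_L}I_\mu\to0$. Two $\mu$-component links $L,L'$ are Crowell equivalent (their link module sequences are equivalent) if there is a $\Lambda_\mu$-linear isomorphism $g:M_A(L)\to M_A(L')$ with $\phi_L=\phi_{L'}g$. Reduced version. Let $\Lambda=\mathbb{Z}[t^{\pm1}]$. The reduced (one-variable) link module sequence is the analogous sequence obtained by using the infinite cyclic (total linking number) cover of $\mathbb{S}^3-L$ instead of the universal abelian cover; concretely, it is obtained by setting every $t_i$ equal to $t$ in the presentation above: the reduced Alexander module is the $\Lambda$-module with generators $A(D)$ and relations $(1-t)a_{\mathrm{over}}+t\,a_{\mathrm{right}}-a_{\mathrm{left}}=0$, one for each crossing, and the reduced Crowell map to $(t-1)\Lambda$ sends the class of every arc to $t-1$. Two reduced sequences are equivalent if there is a $\Lambda$-linear isomorphism of the reduced Alexander modules that is compatible with the reduced Crowell maps. *)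

theory Defs
  imports
    "HOL-Analysis.Analysis"
    "HOL-Algebra.AbelCoset"
    "HOL-Algebra.Module"
    "HOL-Combinatorics.Permutations"
    "HOL-Library.Poly_Mapping"
begin

section \<open>Oriented polygonal links with a regular projection\<close>

text \<open>
  Three-space (the complement of a point in the three-sphere) is \<open>\<complex> \<times> \<real>\<close>; links are projected
  along the last coordinate, the height, to the plane \<open>\<complex>\<close>. A tame knot is represented by the
  cyclic list of vertices of a closed polygon, oriented in the order of the list.
\<close>

type_synonym point = "complex \<times> real"
type_synonym polygon = "point list"

definition edges :: "polygon \<Rightarrow> (point \<times> point) set" where
  "edges K = set (zip K (rotate1 K))"

definition curve :: "polygon \<Rightarrow> point set" where
  "curve K = (\<Union>(p, q)\<in>edges K. closed_segment p q)"

definition simple_polygon :: "polygon \<Rightarrow> bool" where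
  "simple_polygon K \<longleftrightarrow> 3 \<le> length K \<and> distinct K \<and>
     (\<forall>(p, q)\<in>edges K. \<forall>(r, s)\<in>edges K.
        (p, q) \<noteq> (r, s) \<longrightarrow> closed_segment p q \<inter> closed_segment r s \<subseteq> {p, q} \<inter> {r, s})"

text \<open>The components are indexed by \<open>0, \<dots>, \<mu> - 1\<close>, where \<open>\<mu> = length L\<close>.\<close>

type_synonym plink = "polygon list"

definition polygonal_link :: "plink \<Rightarrow> bool" where
  "polygonal_link L \<longleftrightarrow> L \<noteq> [] \<and> (\<forall>K\<in>set L. simple_polygon K) \<and>
     (\<forall>i<length L. \<forall>j<length L. i \<noteq> j \<longrightarrow> curve (L ! i) \<inter> curve (L ! j) = {})"

definition link_edges :: "plink \<Rightarrow> (point \<times> point) set" where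
  "link_edges L = (\<Union>K\<in>set L. edges K)"

definition link_vertices :: "plink \<Rightarrow> point set" where
  "link_vertices L = (\<Union>K\<in>set L. set K)"

definition link_curve :: "plink \<Rightarrow> point set" where
  "link_curve L = (\<Union>K\<in>set L. curve K)"

text \<open>
  The second condition keeps vertices off the projections of the other edges. Hence multiple
  points of the projection are transverse intersections of interiors of edges; the third
  condition makes them double points.
\<close>

definition regular_projection :: "plink \<Rightarrow> bool" where
  "regular_projection L \<longleftrightarrow>
     (\<forall>(p, q)\<in>link_edges L. fst p \<noteq> fst q) \<and>
     (\<forall>v\<in>link_vertices L. \<forall>(p, q)\<in>link_edges L.
        v \<notin> {p, q} \<longrightarrow> fst v \<notin> closed_segment (fst p) (fst q)) \<and>
     (\<forall>x\<in>link_curve L. \<forall>y\<in>link_curve L. \<forall>z\<in>link_curve L.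
        fst x = fst y \<and> fst y = fst z \<longrightarrow> x = y \<or> y = z \<or> x = z)"

definition classical_link :: "plink \<Rightarrow> bool" where
  "classical_link L \<longleftrightarrow> polygonal_link L \<and> regular_projection L"

lemma classical_link_take:
  assumes "classical_link L" "1 \<le> m"
  shows "classical_link (take m L)"
proof -
  have s: "set (take m L) \<subseteq> set L" by (rule set_take_subset)
  have e: "link_edges (take m L) \<subseteq> link_edges L" "link_vertices (take m L) \<subseteq> link_vertices L"
      "link_curve (take m L) \<subseteq> link_curve L"
    using s by (auto simp: link_edges_def link_vertices_def link_curve_def)
  have "regular_projection (take m L)"
    using assms(1) e unfolding classical_link_def regular_projection_def
    by (smt (verit, best) subsetD case_prodE case_prodI2 case_prodD prod.collapse)
  moreover have "polygonal_link (take m L)"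
    using assms s unfolding classical_link_def polygonal_link_def by auto
  ultimately show ?thesis by (simp add: classical_link_def)
qed

lemma classical_link_permute:
  assumes "classical_link L" "\<sigma> permutes {..<length L}"
  shows "classical_link (permute_list \<sigma> L)"
proof -
  have s: "set (permute_list \<sigma> L) = set L" using assms(2) by simp
  have "regular_projection (permute_list \<sigma> L)"
    using assms(1) s unfolding classical_link_def regular_projection_def
    by (simp add: link_edges_def link_vertices_def link_curve_def)
  moreover have "permute_list \<sigma> L \<noteq> []"
    using assms(1) s unfolding classical_link_def polygonal_link_def by (metis set_empty)
  with assms s permutes_inj[OF assms(2)] permutes_in_image[OF assms(2)]
  have "polygonal_link (permute_list \<sigma> L)"
    unfolding classical_link_def polygonal_link_def by (auto simp: permute_list_nth inj_eq)
  ultimately show ?thesis by (simp add: classical_link_def)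
qed


section \<open>Crossings and arcs\<close>

text \<open>A crossing is recorded as the pair of its overcrossing and undercrossing point.\<close>

type_synonym crossing = "point \<times> point"

definition crossings :: "plink \<Rightarrow> crossing set" where
  "crossings L =
     {(x, y). x \<in> link_curve L \<and> y \<in> link_curve L \<and> fst x = fst y \<and> snd y < snd x}"

text \<open>
  An arc is paired with the index of the component containing it. A component without
  undercrossings is a single arc.
\<close>

type_synonym arc = "nat \<times> point set"

definition arcs :: "plink \<Rightarrow> arc set" where
  "arcs L = {(i, A). i < length L \<and> A \<in> components (curve (L ! i) - snd ` crossings L)}"

abbreviation arc_index :: "arc \<Rightarrow> nat" where
  "arc_index \<equiv> fst"

definition over_arc :: "plink \<Rightarrow> crossing \<Rightarrow> arc" where
  "over_arc L = (\<lambda>(x, y). THE a. a \<in> arcs L \<and> x \<in> snd a)"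

text \<open>
  The side of \<open>w\<close> with respect to the oriented edge through the overcrossing point \<open>x\<close>, seen from
  above: the value is positive if \<open>w\<close> projects to the left of that edge, and negative if it
  projects to the right. As \<open>x\<close> is not a vertex, the edge is unique.
\<close>

definition side :: "plink \<Rightarrow> point \<Rightarrow> point \<Rightarrow> real" where
  "side L x w = (case THE e. e \<in> link_edges L \<and> x \<in> closed_segment (fst e) (snd e) of
     (p, q) \<Rightarrow> Im (cnj (fst q - fst p) * (fst w - fst p)))"

text \<open>Near the undercrossing point \<open>y\<close> the link consists of the underpassing strand only.\<close>

definition left_arc :: "plink \<Rightarrow> crossing \<Rightarrow> arc" where
  "left_arc L = (\<lambda>(x, y). THE a. a \<in> arcs L \<and>
     (\<forall>\<^sub>F w in at y within link_curve L. 0 < side L x w \<longrightarrow> w \<in> snd a))"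

definition right_arc :: "plink \<Rightarrow> crossing \<Rightarrow> arc" where
  "right_arc L = (\<lambda>(x, y). THE a. a \<in> arcs L \<and>
     (\<forall>\<^sub>F w in at y within link_curve L. side L x w < 0 \<longrightarrow> w \<in> snd a))"


section \<open>Laurent polynomials and modules\<close>

text \<open>
  Integral Laurent polynomials in \<open>t\<^sub>0, t\<^sub>1, \<dots>\<close>, as the group ring of the group of exponent
  vectors; multiplication is convolution.
\<close>

type_synonym laurent = "(nat \<Rightarrow>\<^sub>0 int) \<Rightarrow>\<^sub>0 int"

definition tvar :: "nat \<Rightarrow> laurent" where
  "tvar i = Poly_Mapping.single (Poly_Mapping.single i 1) 1"

definition laurent_ring :: "nat \<Rightarrow> laurent ring" where
  "laurent_ring n =
     \<lparr>carrier = {f. \<forall>e\<in>Poly_Mapping.keys f. Poly_Mapping.keys e \<subseteq> {..<n}},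
      monoid.mult = (*), one = 1, ring.zero = 0, add = (+)\<rparr>"

text \<open>
  The fields \<open>mult\<close> and \<open>one\<close> of a module record are irrelevant. The free module is only used on
  finite sets \<open>X\<close>.
\<close>

definition free_module :: "laurent ring \<Rightarrow> 'x set \<Rightarrow> (laurent, 'x \<Rightarrow> laurent) module" where
  "free_module R X =
     \<lparr>carrier = {f. (\<forall>x\<in>X. f x \<in> carrier R) \<and> (\<forall>x. x \<notin> X \<longrightarrow> f x = 0)},
      monoid.mult = undefined, one = undefined,
      ring.zero = (\<lambda>x. 0), add = (\<lambda>f g x. f x + g x),
      smult = (\<lambda>r f x. r * f x)\<rparr>"

definition quotient_module :: "('r, 'a) module \<Rightarrow> 'a set \<Rightarrow> ('r, 'a set) module" where
  "quotient_module M N =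
     \<lparr>carrier = a_rcosets\<^bsub>M\<^esub> N,
      monoid.mult = undefined, one = undefined,
      ring.zero = N, add = set_add M,
      smult = (\<lambda>r X. \<Union>x\<in>X. N +>\<^bsub>M\<^esub> (r \<odot>\<^bsub>M\<^esub> x))\<rparr>"

definition linear_iso :: "'r ring \<Rightarrow> ('r, 'a) module \<Rightarrow> ('r, 'b) module \<Rightarrow> ('a \<Rightarrow> 'b) set" where
  "linear_iso R M N =
     {g \<in> iso (add_monoid M) (add_monoid N).
        \<forall>r\<in>carrier R. \<forall>x\<in>carrier M. g (r \<odot>\<^bsub>M\<^esub> x) = r \<odot>\<^bsub>N\<^esub> g x}"


section \<open>Alexander modules and Crowell maps\<close>

text \<open>
  The constructions are parametrised by the ground ring and by the ring element \<open>\<tau> i\<close> assigned to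
  component \<open>i\<close>: these are \<open>laurent_ring \<mu>\<close> and \<open>tvar i\<close> for the multivariate theory, and
  \<open>laurent_ring 1\<close> and \<open>tvar 0\<close> (for every \<open>i\<close>) for the reduced one.
\<close>

definition basis_elt :: "'x \<Rightarrow> 'x \<Rightarrow> laurent" where
  "basis_elt a = (\<lambda>b. if b = a then 1 else 0)"

definition relator :: "(nat \<Rightarrow> laurent) \<Rightarrow> plink \<Rightarrow> crossing \<Rightarrow> arc \<Rightarrow> laurent" where
  "relator \<tau> L c = (\<lambda>a.
       (1 - \<tau> (arc_index (left_arc L c))) * basis_elt (over_arc L c) a
     + \<tau> (arc_index (over_arc L c)) * basis_elt (right_arc L c) a
     - basis_elt (left_arc L c) a)"

definition relation_map ::
  "(nat \<Rightarrow> laurent) \<Rightarrow> plink \<Rightarrow> (crossing \<Rightarrow> laurent) \<Rightarrow> (arc \<Rightarrow> laurent)" where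
  "relation_map \<tau> L f = (\<lambda>a. \<Sum>c\<in>crossings L. f c * relator \<tau> L c a)"

definition coker_module ::
  "laurent ring \<Rightarrow> (nat \<Rightarrow> laurent) \<Rightarrow> plink \<Rightarrow> (laurent, (arc \<Rightarrow> laurent) set) module" where
  "coker_module R \<tau> L =
     quotient_module (free_module R (arcs L))
       (relation_map \<tau> L ` carrier (free_module R (crossings L)))"

text \<open>
  The linear map sending the class of each arc \<open>a\<close> to \<open>\<tau> (arc_index a) - 1\<close>. It is constant on
  cosets, since \<open>left_arc\<close> and \<open>right_arc\<close> lie on the same component.
\<close>

definition coker_map :: "(nat \<Rightarrow> laurent) \<Rightarrow> plink \<Rightarrow> (arc \<Rightarrow> laurent) set \<Rightarrow> laurent" where
  "coker_map \<tau> L X = the_elem ((\<lambda>x. \<Sum>a\<in>arcs L. x a * (\<tau> (arc_index a) - 1)) ` X)"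

definition alexander_module :: "plink \<Rightarrow> (laurent, (arc \<Rightarrow> laurent) set) module" where
  "alexander_module L = coker_module (laurent_ring (length L)) tvar L"

definition crowell_map :: "plink \<Rightarrow> (arc \<Rightarrow> laurent) set \<Rightarrow> laurent" where
  "crowell_map L = coker_map tvar L"

definition crowell_equivalent :: "plink \<Rightarrow> plink \<Rightarrow> bool" where
  "crowell_equivalent L L' \<longleftrightarrow> length L = length L' \<and>
     (\<exists>g\<in>linear_iso (laurent_ring (length L)) (alexander_module L) (alexander_module L').
        \<forall>x\<in>carrier (alexander_module L). crowell_map L x = crowell_map L' (g x))"

definition reduced_alexander_module :: "plink \<Rightarrow> (laurent, (arc \<Rightarrow> laurent) set) module" where
  "reduced_alexander_module L = coker_module (laurent_ring 1) (\<lambda>_. tvar 0) L"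

definition reduced_crowell_map :: "plink \<Rightarrow> (arc \<Rightarrow> laurent) set \<Rightarrow> laurent" where
  "reduced_crowell_map L = coker_map (\<lambda>_. tvar 0) L"

definition reduced_crowell_equivalent :: "plink \<Rightarrow> plink \<Rightarrow> bool" where
  "reduced_crowell_equivalent L L' \<longleftrightarrow>
     (\<exists>g\<in>linear_iso (laurent_ring 1) (reduced_alexander_module L) (reduced_alexander_module L').
        \<forall>x\<in>carrier (reduced_alexander_module L).
          reduced_crowell_map L x = reduced_crowell_map L' (g x))"

end

theory Submission
  imports Defs "HOL-Number_Theory.Cong"
begin

text \<open>
  \<^emph>\<open>Re-indexing.\<close> Let every \<open>t\<^sub>i\<close> act on the integers modulo three by a sign \<open>\<epsilon> i\<close>. A functional on
  the Alexander module that is linear for this action is a colouring of the arcs. One colouring always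
  exists, the one induced by the Crowell map: it gives \<open>\<epsilon> i - 1\<close> to the arcs of component \<open>i\<close>. A
  Crowell equivalence transports colourings and takes this one to its namesake, so it is an
  invariant whether every colouring is a multiple of it (\<open>rigid_invariant\<close>). In a chain of three
  unknots, put \<open>-1\<close> on component \<open>0\<close> and \<open>1\<close> on the two others. If component \<open>0\<close> is the
  middle one, its two clasps force the colours of the others to vanish and the chain is rigid. If
  it is at an end, the other end can be coloured arbitrarily. Hence exchanging the components
  \<open>0\<close> and \<open>1\<close> changes the class of the chain. The reduced module does not record to which
  component an arc belongs, so the same two links have equivalent reduced sequences.

  \<^emph>\<open>Sublinks.\<close> Let a circle run around two antiparallel strands next to a crossing of a knot. A full
  twist along the disc that it bounds is a homeomorphism of the link complement that changes
  this crossing. The knot has linking number zero with the circle, so the twist respects the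
  homology classes of the meridians, and the link module sequences of the two links are
  equivalent. For a standard trefoil diagram the crossing change produces an unknot. The trefoil
  has a colouring with three colours and the unknot has only constant ones, so the
  sublinks formed by the first components are not equivalent. The isomorphism induced by the twist
  is written down as a matrix of Laurent polynomials and verified by explicit certificates
  (\<open>circled_equivalent\<close>).

  \<^emph>\<open>Reading presentations off polygons.\<close> The link is drawn with integral vertices, grouped by the arcs
  to which they belong. Whether two projected edges are disjoint or cross, and which of them is
  the upper one, depends on the signs of finitely many integers, so a computation certifies such
  a drawing (\<open>valid_diagram_sound\<close>). The topological content is that the pieces between
  consecutive undercrossings are connected, disjoint and relatively closed, hence the components
  of the punctured curve (\<open>components_eq_pieces\<close>), and that near an undercrossing only the two
  adjacent pieces are met (\<open>strand_arc\<close>).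
\<close>

section \<open>Plane geometry of projected edges\<close>

text \<open>
  Positive if \<open>r\<close> projects to the left of the line from \<open>p\<close> to \<open>q\<close>; this is the quantity by which
  \<open>side\<close> is defined. Being affine in \<open>r\<close>, it decides how projected segments meet.
\<close>

definition turn :: "point \<Rightarrow> point \<Rightarrow> point \<Rightarrow> real" where
  "turn p q r = Im (cnj (fst q - fst p) * (fst r - fst p))"

lemma turn_eq:
  "turn p q r = (Re (fst q) - Re (fst p)) * (Im (fst r) - Im (fst p))
              - (Im (fst q) - Im (fst p)) * (Re (fst r) - Re (fst p))"
  by (simp add: turn_def algebra_simps)

lemma turn_affine:
  "turn p q ((1 - u) *\<^sub>R r + u *\<^sub>R s) = (1 - u) * turn p q r + u * turn p q s"
  by (simp add: turn_eq algebra_simps)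

lemma turn_endpoints [simp]: "turn p q p = 0" "turn p q q = 0"
  by (simp_all add: turn_eq)

lemma turn_fst_cong: "fst r = fst s \<Longrightarrow> turn p q r = turn p q s"
  by (simp add: turn_def)

lemma turn_on_segment:
  assumes "w \<in> closed_segment p q"
  shows "turn p q w = 0"
  using assms by (auto simp: in_segment turn_affine)

type_synonym edge = "point \<times> point"

abbreviation seg :: "edge \<Rightarrow> point set" where
  "seg e \<equiv> closed_segment (fst e) (snd e)"

text \<open>
  The line through one of the two projected edges has the other one strictly on one side. For disjoint
  segments without three collinear endpoints, one of the two lines does this.
\<close>

definition separated :: "edge \<Rightarrow> edge \<Rightarrow> bool" where
  "separated = (\<lambda>(p, q) (r, s).
     0 < turn p q r * turn p q s \<or> 0 < turn r s p * turn r s q)"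

definition successive :: "edge \<Rightarrow> edge \<Rightarrow> bool" where
  "successive = (\<lambda>(p, q) (r, s). q = r \<and> turn p q s \<noteq> 0)"

definition transverse :: "edge \<Rightarrow> edge \<Rightarrow> bool" where
  "transverse = (\<lambda>(p, q) (r, s).
     turn p q r * turn p q s < 0 \<and> turn r s p * turn r s q < 0)"

text \<open>
  The point of \<open>e\<close> above or below the line carrying \<open>f\<close>. The parameter \<open>t\<close> is the zero of the affine function
  \<open>turn r s\<close> along \<open>e\<close>.
\<close>

definition cut :: "edge \<Rightarrow> edge \<Rightarrow> point" where
  "cut = (\<lambda>(p, q) (r, s). let t = turn r s p / (turn r s p - turn r s q) in
     (1 - t) *\<^sub>R p + t *\<^sub>R q)"

definition passes_over :: "edge \<Rightarrow> edge \<Rightarrow> bool" where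
  "passes_over e f \<longleftrightarrow> transverse e f \<and> snd (cut f e) < snd (cut e f)"

lemma separated_disjoint:
  assumes "separated e f" "x \<in> seg e" "y \<in> seg f"
  shows "fst x \<noteq> fst y"
proof -
  have *: "turn p q y \<noteq> 0" if "0 < turn p q r * turn p q s" "y \<in> closed_segment r s" for p q r s y
  proof -
    obtain u where u: "0 \<le> u" "u \<le> 1" "y = (1 - u) *\<^sub>R r + u *\<^sub>R s"
      using \<open>y \<in> closed_segment r s\<close> by (auto simp: in_segment)
    have "0 < turn p q y * turn p q r"
    proof (cases "u = 1")
      case True
      then show ?thesis using that(1) u(3) by (simp add: mult.commute)
    next
      case False
      have "turn p q y * turn p q r
          = (1 - u) * (turn p q r)\<^sup>2 + u * (turn p q r * turn p q s)"
        unfolding u(3) turn_affine by (simp add: algebra_simps power2_eq_square)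
      moreover have "0 < (1 - u) * (turn p q r)\<^sup>2"
        using False u that(1) by (intro mult_pos_pos) (auto simp: zero_less_mult_iff)
      moreover have "0 \<le> u * (turn p q r * turn p q s)"
        using u that(1) by simp
      ultimately show ?thesis by linarith
    qed
    then show ?thesis by auto
  qed
  obtain p q r s where e: "e = (p, q)" "f = (r, s)" by (cases e, cases f)
  show ?thesis
  proof
    assume "fst x = fst y"
    then have "turn p q y = 0" "turn r s x = 0"
      using assms(2,3) turn_on_segment turn_fst_cong e by (metis fst_conv snd_conv)+
    moreover have "0 < turn p q r * turn p q s \<or> 0 < turn r s p * turn r s q"
      using assms(1) by (simp add: e separated_def)
    ultimately show False using *[of p q r s y] *[of r s p q x] assms(2,3) by (auto simp: e)
  qed
qed

lemma successive_meet:
  assumes "successive e f" "x \<in> seg e" "y \<in> seg f" "fst x = fst y"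
  shows "x = snd e" "y = snd e" "snd e = fst f"
proof -
  obtain p q s where e: "e = (p, q)" "f = (q, s)" "turn p q s \<noteq> 0"
    using assms(1) by (cases e, cases f) (auto simp: successive_def)
  obtain u where u: "x = (1 - u) *\<^sub>R p + u *\<^sub>R q" using assms(2) e by (auto simp: in_segment)
  obtain v where v: "y = (1 - v) *\<^sub>R q + v *\<^sub>R s" using assms(3) e by (auto simp: in_segment)
  have "turn p q y = 0" using turn_on_segment turn_fst_cong assms(2,4) e by (metis fst_conv snd_conv)
  then have "v = 0" using e(3) by (simp add: v turn_affine)
  have "turn q s x = 0" using turn_on_segment turn_fst_cong assms(3,4) e by (metis fst_conv snd_conv)
  moreover have "turn q s p = turn p q s" by (simp add: turn_eq algebra_simps)
  ultimately have "u = 1" using e(3) by (simp add: u turn_affine)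
  show "x = snd e" "y = snd e" "snd e = fst f"
    using \<open>u = 1\<close> \<open>v = 0\<close> u v e by auto
qed

lemma transverse_sym: "transverse e f \<Longrightarrow> transverse f e"
  by (cases e; cases f) (auto simp: transverse_def)

text \<open>
  Along \<open>e\<close> the affine function \<open>turn r s\<close> changes sign, so it has a single zero, and every point that
  shares its projection with a point of \<open>f\<close> is such a zero.
\<close>

lemma transverse_cut_unique:
  assumes "transverse e f" "x \<in> seg e" "y \<in> seg f" "fst x = fst y"
  shows "x = cut e f"
proof -
  obtain p q r s where e: "e = (p, q)" "f = (r, s)" by (cases e, cases f)
  have tr: "turn r s p * turn r s q < 0" using assms(1) e by (simp add: transverse_def)
  obtain u where u: "x = (1 - u) *\<^sub>R p + u *\<^sub>R q" using assms(2) e by (auto simp: in_segment)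
  have "turn r s x = 0" using turn_on_segment turn_fst_cong assms(3,4) e by (metis fst_conv snd_conv)
  then have *: "(1 - u) * turn r s p + u * turn r s q = 0" by (simp add: u turn_affine)
  have "turn r s p - turn r s q \<noteq> 0" using tr by (auto simp: mult_less_0_iff)
  moreover have "u * (turn r s p - turn r s q) = turn r s p" using * by (simp add: algebra_simps)
  ultimately have "u = turn r s p / (turn r s p - turn r s q)" by (simp add: field_simps)
  then show ?thesis by (simp add: e cut_def u Let_def)
qed

text \<open>
  The last part says that the zero of \<open>turn r s\<close> on \<open>e\<close> and the zero of \<open>turn p q\<close> on \<open>f\<close> lie over the same
  point of the plane. Both parameters have the same denominator up to sign, namely the
  determinant of the two directions, and after clearing it the claim is a polynomial identity.
\<close>

lemma transverse_cut:
  assumes "transverse e f"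
  shows "cut e f \<in> seg e" "cut e f \<noteq> fst e" "cut e f \<noteq> snd e" "fst (cut e f) = fst (cut f e)"
proof -
  obtain p q r s where e: "e = (p, q)" "f = (r, s)" by (cases e, cases f)
  define a b c d where abcd: "a = turn r s p" "b = turn r s q" "c = turn p q r" "d = turn p q s"
  have ab: "a * b < 0" and cd: "c * d < 0" using assms e by (simp_all add: transverse_def abcd)
  define t where "t = a / (a - b)"
  have t: "0 < t" "t < 1" using ab by (auto simp: t_def mult_less_0_iff divide_simps)
  have x: "cut e f = (1 - t) *\<^sub>R p + t *\<^sub>R q" by (simp add: e cut_def t_def abcd Let_def)
  have "(1 - t) *\<^sub>R p + t *\<^sub>R q \<in> closed_segment p q"
    unfolding in_segment using t by (intro exI[of _ t]) auto
  then show "cut e f \<in> seg e" using x by (simp add: e)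
  have "p \<noteq> q" using ab by (auto simp: abcd mult_less_0_iff)
  have "cut e f - p = t *\<^sub>R (q - p)" "cut e f - q = (1 - t) *\<^sub>R (p - q)"
    by (simp_all add: x algebra_simps)
  then show "cut e f \<noteq> fst e" "cut e f \<noteq> snd e" using t \<open>p \<noteq> q\<close> e by auto
  define u where "u = c / (c - d)"
  have y: "cut f e = (1 - u) *\<^sub>R r + u *\<^sub>R s" by (simp add: e cut_def u_def abcd Let_def)
  have ne: "a - b \<noteq> 0" "c - d \<noteq> 0" using ab cd by (auto simp: mult_less_0_iff)
  have sgn: "c - d = - (a - b)" by (simp add: abcd turn_eq algebra_simps)
  have u2: "u = - c / (a - b)" unfolding u_def sgn by (simp only: divide_minus_right divide_minus_left)
  have key: "(a - b) * Re (fst (cut e f) - fst (cut f e)) = 0"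
       "(a - b) * Im (fst (cut e f) - fst (cut f e)) = 0"
  proof -
    have 1: "(a - b) * t = a" "(a - b) * u = - c" using ne by (simp_all add: t_def u2)
    have "(a - b) * Re (fst (cut e f) - fst (cut f e))
      = (a - b) * (Re (fst p) - Re (fst r)) + ((a - b) * t) * (Re (fst q) - Re (fst p))
        - ((a - b) * u) * (Re (fst s) - Re (fst r))"
      by (simp add: x y algebra_simps)
    also have "\<dots> = 0" unfolding 1 by (simp add: abcd turn_eq algebra_simps)
    finally show "(a - b) * Re (fst (cut e f) - fst (cut f e)) = 0" .
    have "(a - b) * Im (fst (cut e f) - fst (cut f e))
      = (a - b) * (Im (fst p) - Im (fst r)) + ((a - b) * t) * (Im (fst q) - Im (fst p))
        - ((a - b) * u) * (Im (fst s) - Im (fst r))"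
      by (simp add: x y algebra_simps)
    also have "\<dots> = 0" unfolding 1 by (simp add: abcd turn_eq algebra_simps)
    finally show "(a - b) * Im (fst (cut e f) - fst (cut f e)) = 0" .
  qed
  show "fst (cut e f) = fst (cut f e)" using key ne by (simp add: complex_eq_iff)
qed

lemma transverse_turn:
  assumes "transverse e f"
  shows "turn (fst e) (snd e) (fst f) \<noteq> 0" "turn (fst e) (snd e) (snd f) \<noteq> 0"
    "turn (fst e) (snd e) (fst f) > 0 \<longleftrightarrow> turn (fst e) (snd e) (snd f) < 0"
  using assms by (cases e; cases f; auto simp: transverse_def mult_less_0_iff)+

section \<open>Edges of a concatenated polygon\<close>

definition steps :: "'a list \<Rightarrow> ('a \<times> 'a) set" where
  "steps xs = set (zip xs (tl xs))"

lemma steps_simps [simp]: "steps [] = {}" "steps [x] = {}" "steps (x # y # xs) = insert (x, y) (steps (y # xs))"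
  by (simp_all add: steps_def)

lemma steps_append:
  "xs \<noteq> [] \<Longrightarrow> ys \<noteq> [] \<Longrightarrow> steps (xs @ ys) = steps xs \<union> {(last xs, hd ys)} \<union> steps ys"
proof (induction xs rule: induct_list012)
  case (2 x)
  then show ?case by (cases ys) auto
qed auto

text \<open>
  A polymorphic version of \<open>edges\<close>; it is also applied to lists of blocks of vertices.
\<close>

definition cyclic_steps :: "'a list \<Rightarrow> ('a \<times> 'a) set" where
  "cyclic_steps xs = set (zip xs (rotate1 xs))"

lemma edges_eq: "edges K = cyclic_steps K"
  by (simp add: edges_def cyclic_steps_def)

lemma cyclic_steps_eq:
  assumes "xs \<noteq> []"
  shows "cyclic_steps xs = insert (last xs, hd xs) (steps xs)"
proof -
  obtain y ys where xs: "xs = y # ys" using assms by (cases xs) auto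
  have "zip (y # ys) (ys @ [y]) = zip (y # ys @ [y]) (ys @ [y])"
    using zip_append1[of "y # ys" "[y]" "ys @ [y]"] by simp
  then have "cyclic_steps xs = steps (xs @ [hd xs])"
    by (simp add: cyclic_steps_def steps_def xs)
  then show ?thesis using assms by (simp add: steps_append)
qed

lemma cyclic_steps_nth:
  "cyclic_steps xs = (\<lambda>k. (xs ! k, xs ! (Suc k mod length xs))) ` {..<length xs}"
  by (auto simp: cyclic_steps_def set_zip nth_rotate1 image_def)

lemma steps_concat:
  assumes "bs \<noteq> []" "\<And>b. b \<in> set bs \<Longrightarrow> b \<noteq> []"
  shows "steps (concat bs) = (\<Union>b\<in>set bs. steps b) \<union> (\<lambda>(b, c). (last b, hd c)) ` steps bs"
  using assms
proof (induction bs rule: induct_list012)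
  case (3 b c bs)
  have "concat (c # bs) \<noteq> []" "b \<noteq> []" using 3 by auto
  then have "steps (concat (b # c # bs)) = steps b \<union> {(last b, hd (concat (c # bs)))} \<union> steps (concat (c # bs))"
    using steps_append by (metis concat.simps(2))
  moreover have "hd (concat (c # bs)) = hd c" using 3 by simp
  ultimately show ?case using 3 by auto
qed auto

lemma cyclic_steps_concat:
  assumes "bs \<noteq> []" "\<And>b. b \<in> set bs \<Longrightarrow> b \<noteq> []"
  shows "cyclic_steps (concat bs)
    = (\<Union>b\<in>set bs. steps b) \<union> (\<lambda>(b, c). (last b, hd c)) ` cyclic_steps bs"
proof -
  have ne: "concat bs \<noteq> []" using assms by (cases bs) auto
  have hd: "hd (concat bs) = hd (hd bs)" using assms by (cases bs) auto
  have last: "last (concat bs) = last (last bs)" using assms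
    by (cases bs rule: rev_cases) auto
  show ?thesis
    using assms ne by (auto simp: cyclic_steps_eq steps_concat hd last)
qed

section \<open>Components of a union of separated pieces\<close>

text \<open>
  A connected subset of \<open>S\<close> that contains the piece \<open>A i\<close> is covered by the disjoint relatively closed sets
  \<open>A i\<close> and the union of the other pieces, hence does not leave \<open>A i\<close>. Finiteness makes the
  second set closed.
\<close>

lemma components_eq_pieces:
  fixes A :: "'i \<Rightarrow> 'a::topological_space set"
  assumes fin: "finite I" and S: "S = (\<Union>i\<in>I. A i)"
    and conn: "\<And>i. i \<in> I \<Longrightarrow> connected (A i)" and ne: "\<And>i. i \<in> I \<Longrightarrow> A i \<noteq> {}"
    and clo: "\<And>i. i \<in> I \<Longrightarrow> closed (C i) \<and> A i = S \<inter> C i"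
    and disj: "\<And>i j. i \<in> I \<Longrightarrow> j \<in> I \<Longrightarrow> i \<noteq> j \<Longrightarrow> A i \<inter> A j = {}"
  shows "components S = A ` I"
proof -
  have comp: "A i \<in> components S" if i: "i \<in> I" for i
    unfolding in_components_maximal
  proof (intro conjI allI impI)
    show "A i \<noteq> {}" "A i \<subseteq> S" "connected (A i)" using i ne S conn by auto
    fix T assume T: "T \<noteq> {} \<and> A i \<subseteq> T \<and> T \<subseteq> S \<and> connected T"
    let ?R = "\<Union>j\<in>I - {i}. C j"
    have "closed ?R" using fin clo by (intro closed_UN) auto
    moreover have "closed (C i)" using clo i by blast
    moreover have "C i \<inter> ?R \<inter> T = {}"
    proof -
      have False if x: "x \<in> C i" "x \<in> C j" "x \<in> T" "j \<in> I" "j \<noteq> i" for x j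
      proof -
        have "x \<in> S" using x T by blast
        then have "x \<in> A i" "x \<in> A j" using x clo[OF i] clo[OF \<open>j \<in> I\<close>] by simp_all
        then show False using disj[OF i \<open>j \<in> I\<close>] x by auto
      qed
      then show ?thesis by auto
    qed
    moreover have cover: "T \<subseteq> C i \<union> ?R"
    proof
      fix x assume "x \<in> T"
      then have "x \<in> S" using T by blast
      then obtain j where "j \<in> I" "x \<in> A j" using S by auto
      then have "x \<in> C j" using clo by simp
      then show "x \<in> C i \<union> ?R" using \<open>j \<in> I\<close> by auto
    qed
    ultimately have "C i \<inter> T = {} \<or> ?R \<inter> T = {}"
      using T connected_closedD[of T "C i" ?R] by auto
    moreover have "C i \<inter> T \<noteq> {}" using T ne[OF i] clo[OF i] by auto
    ultimately have "T \<subseteq> C i" using cover by blast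
    then have "T \<subseteq> A i" using T clo[OF i] by auto
    then show "T = A i" using T by auto
  qed
  show ?thesis
  proof
    show "A ` I \<subseteq> components S" using comp by blast
    show "components S \<subseteq> A ` I"
    proof
      fix c assume c: "c \<in> components S"
      then obtain x where "x \<in> c" "x \<in> S" 
        using in_components_nonempty[OF c] in_components_subset[OF c] by auto
      then obtain i where "i \<in> I" "x \<in> A i" using S by auto
      then have "c = A i" using components_eq[OF c comp[of i]] \<open>x \<in> c\<close> by auto
      then show "c \<in> A ` I" using \<open>i \<in> I\<close> by simp
    qed
  qed
qed

text \<open>An endpoint is an extreme point of the segment, so removing it preserves convexity.\<close>

lemma connected_segment_minus_end:
  fixes a b :: "'a::euclidean_space"
  shows "connected (closed_segment a b - {b})"
proof -
  have "convex (closed_segment a b - {b})"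
    using extreme_point_of_stillconvex[of "closed_segment a b" b] extreme_point_of_segment[of b a b] by simp
  then show ?thesis by (rule convex_connected)
qed

text \<open>The vertices are included separately because a single vertex has no edge.\<close>

definition polyline :: "point list \<Rightarrow> point set" where
  "polyline vs = set vs \<union> (\<Union>e\<in>steps vs. seg e)"

lemma steps_vertices: "(x, y) \<in> steps vs \<Longrightarrow> x \<in> set vs \<and> y \<in> set vs"
  by (induction vs rule: induct_list012) auto

lemma steps_not_last: "distinct vs \<Longrightarrow> (x, y) \<in> steps vs \<Longrightarrow> x \<noteq> last vs \<and> x \<noteq> y"
  by (induction vs rule: induct_list012) auto

lemma connected_polyline: "connected (polyline vs)"
proof (induction vs rule: induct_list012)
  case (3 x y vs)
  have "polyline (x # y # vs) = closed_segment x y \<union> polyline (y # vs)"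
    by (auto simp: polyline_def)
  moreover have "y \<in> closed_segment x y \<inter> polyline (y # vs)"
    by (simp add: polyline_def)
  ultimately show ?case using 3 connected_Un[OF connected_segment] by (metis empty_iff)
qed (simp_all add: polyline_def)

lemma closed_polyline: "closed (polyline vs)"
proof -
  have "finite (steps vs)" by (simp add: steps_def)
  then show ?thesis
    unfolding polyline_def by (intro closed_Un closed_UN finite_imp_closed) simp_all
qed

section \<open>Link diagrams cut into arcs\<close>

type_synonym slot = "nat \<times> nat"

text \<open>
  A diagram lists, for each component, the arcs in the order of the orientation, and for each arc its
  vertices. A slot is the position of an arc, and also of the undercrossing at its end.
\<close>

definition slots :: "'a list list list \<Rightarrow> (nat \<times> nat) set" where
  "slots D = {(i, k). i < length D \<and> k < length (D ! i)}"

definition next_slot :: "'a list list list \<Rightarrow> nat \<times> nat \<Rightarrow> nat \<times> nat" where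
  "next_slot D = (\<lambda>(i, k). (i, Suc k mod length (D ! i)))"

definition block :: "'a list list list \<Rightarrow> nat \<times> nat \<Rightarrow> 'a list" where
  "block D = (\<lambda>(i, k). D ! i ! k)"

text \<open>
  The edge from the last vertex of an arc to the first vertex of the next one; it carries the
  undercrossing that separates the two arcs.
\<close>

definition joint :: "'a list list list \<Rightarrow> nat \<times> nat \<Rightarrow> 'a \<times> 'a" where
  "joint D p = (last (block D p), hd (block D (next_slot D p)))"

lemma finite_slots: "finite (slots D)"
proof -
  have "slots D = (SIGMA i:{..<length D}. {..<length (D ! i)})" by (auto simp: slots_def)
  then show ?thesis by simp
qed

lemma next_slot_in: "p \<in> slots D \<Longrightarrow> next_slot D p \<in> slots D"
  by (auto simp: slots_def next_slot_def intro!: mod_less_divisor)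

lemma fst_next_slot [simp]: "fst (next_slot D p) = fst p"
  by (auto simp: next_slot_def split: prod.splits)

lemma edges_of_blocks:
  assumes "i < length D" "D ! i \<noteq> []" "[] \<notin> set (D ! i)"
  shows "edges (concat (D ! i)) = (\<Union>p\<in>{p\<in>slots D. fst p = i}. insert (joint D p) (steps (block D p)))"
proof -
  have c: "D ! i \<noteq> []" "\<And>b. b \<in> set (D ! i) \<Longrightarrow> b \<noteq> []" using assms(2,3) by auto
  have "{p\<in>slots D. fst p = i} = Pair i ` {..<length (D ! i)}" using assms by (auto simp: slots_def)
  moreover have "(\<Union>b\<in>set (D ! i). steps b) = (\<Union>k<length (D ! i). steps (block D (i, k)))"
  proof -
    have "set (D ! i) = (\<lambda>k. D ! i ! k) ` {..<length (D ! i)}"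
      by (auto simp: in_set_conv_nth)
    then show ?thesis by (simp add: block_def)
  qed
  moreover have "(\<lambda>(b, c). (last b, hd c)) ` cyclic_steps (D ! i) = (\<lambda>k. joint D (i, k)) ` {..<length (D ! i)}"
    unfolding cyclic_steps_nth image_image by (simp add: block_def joint_def next_slot_def)
  moreover have "edges (concat (D ! i)) = (\<Union>b\<in>set (D ! i). steps b)
      \<union> (\<lambda>(b, c). (last b, hd c)) ` cyclic_steps (D ! i)"
    unfolding edges_eq by (rule cyclic_steps_concat[OF c])
  ultimately show ?thesis by (simp only: image_image) blast
qed

lemma link_edges_of_blocks:
  assumes "\<And>K. K \<in> set D \<Longrightarrow> K \<noteq> [] \<and> [] \<notin> set K"
  shows "link_edges (map concat D) = (\<Union>p\<in>slots D. insert (joint D p) (steps (block D p)))"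
proof -
  have "set D = (\<lambda>i. D ! i) ` {..<length D}"
    by (auto simp: in_set_conv_nth)
  then have "link_edges (map concat D) = (\<Union>i\<in>{..<length D}. edges (concat (D ! i)))"
    by (simp add: link_edges_def)
  also have "\<dots> = (\<Union>i\<in>{..<length D}. \<Union>p\<in>{p\<in>slots D. fst p = i}. insert (joint D p) (steps (block D p)))"
    using edges_of_blocks assms by simp
  also have "\<dots> = (\<Union>p\<in>slots D. insert (joint D p) (steps (block D p)))"
  proof -
    have "\<forall>p\<in>slots D. fst p \<in> {..<length D}" by (auto simp: slots_def)
    then show ?thesis by blast
  qed
  finally show ?thesis .
qed

text \<open>
  An edge with an undercrossing has no other crossing. So an overcrossing point lies in the interior of an
  arc that is known in advance, without comparing positions of crossings along an edge.
\<close>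

locale arc_diagram =
  fixes D :: "point list list list"
    and over_slot :: "nat \<times> nat \<Rightarrow> nat \<times> nat" and over_edge :: "nat \<times> nat \<Rightarrow> edge"
  assumes nonempty: "D \<noteq> []"
    and component: "K \<in> set D \<Longrightarrow> K \<noteq> [] \<and> [] \<notin> set K \<and> 3 \<le> length (concat K)"
    and distinct_vertices: "distinct (concat (map concat D))"
    and not_vertical: "e \<in> link_edges (map concat D) \<Longrightarrow> fst (fst e) \<noteq> fst (snd e)"
    and generic: "e \<in> link_edges (map concat D) \<Longrightarrow> f \<in> link_edges (map concat D) \<Longrightarrow> e \<noteq> f \<Longrightarrow>
      successive e f \<or> successive f e \<or> separated e f \<or> passes_over e f \<or> passes_over f e"
    and undercrossing: "e \<in> link_edges (map concat D) \<Longrightarrow> f \<in> link_edges (map concat D) \<Longrightarrow>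
      passes_over e f \<Longrightarrow> \<exists>p\<in>slots D. f = joint D p \<and> e = over_edge p"
    and overcrossing: "p \<in> slots D \<Longrightarrow> passes_over (over_edge p) (joint D p) \<and>
      over_slot p \<in> slots D \<and> over_edge p \<in> steps (block D (over_slot p))"
begin

abbreviation L :: plink where "L \<equiv> map concat D"
abbreviation E :: "edge set" where "E \<equiv> link_edges L"
abbreviation S where "S \<equiv> slots D"
abbreviation nx where "nx \<equiv> next_slot D"
abbreviation blk where "blk \<equiv> block D"
abbreviation jt where "jt \<equiv> joint D"

definition under_point :: "nat \<times> nat \<Rightarrow> point" where
  "under_point p = cut (jt p) (over_edge p)"

definition over_point :: "nat \<times> nat \<Rightarrow> point" where
  "over_point p = cut (over_edge p) (jt p)"

lemma block_ne: "p \<in> S \<Longrightarrow> blk p \<noteq> []"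
  using component by (auto simp: slots_def block_def) (metis nth_mem)

lemma edges_component:
  assumes "i < length D"
  shows "edges (concat (D ! i)) = (\<Union>p\<in>{p\<in>S. fst p = i}. insert (jt p) (steps (blk p)))"
  using edges_of_blocks[OF assms] component[of "D ! i"] assms by simp

lemma E_eq: "E = (\<Union>p\<in>S. insert (jt p) (steps (blk p)))"
  using link_edges_of_blocks component by blast

lemma joint_E: "p \<in> S \<Longrightarrow> jt p \<in> E" and step_E: "p \<in> S \<Longrightarrow> e \<in> steps (blk p) \<Longrightarrow> e \<in> E"
  by (auto simp: E_eq)

lemma over_edge_E: "p \<in> S \<Longrightarrow> over_edge p \<in> E"
  using overcrossing step_E by blast

lemma finite_E: "finite E"
  by (auto simp: E_eq finite_slots steps_def)

lemma distinct_component: "i < length D \<Longrightarrow> distinct (concat (D ! i))"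
proof -
  assume "i < length D"
  then have "concat (D ! i) \<in> set L" by simp
  then show ?thesis using distinct_vertices distinct_concat_iff[of L] by blast
qed

lemma vertex_component:
  assumes "i < length D" "j < length D" "v \<in> set (concat (D ! i))" "v \<in> set (concat (D ! j))"
  shows "i = j"
proof (rule ccontr)
  assume "i \<noteq> j"
  have "[] \<notin> set L"
  proof
    assume "[] \<in> set L"
    then obtain K where K: "K \<in> set D" "concat K = []"
      unfolding set_map by (metis imageE)
    have "set K \<noteq> {}" using component[OF K(1)] by simp
    then obtain b where "b \<in> set K" by (metis ex_in_conv)
    then show False using K(2) component[OF K(1)] by (metis concat_eq_Nil_conv)
  qed
  then have "distinct L" using distinct_vertices by (simp add: distinct_concat_iff removeAll_id)
  then have "L ! i \<noteq> L ! j" using assms(1,2) \<open>i \<noteq> j\<close> nth_eq_iff_index_eq[of L i j] by simp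
  moreover have "L ! i \<in> set L" "L ! j \<in> set L" using assms(1,2) by (simp_all only: nth_mem length_map)
  ultimately have "set (L ! i) \<inter> set (L ! j) = {}"
    using distinct_vertices distinct_concat_iff[of L] by metis
  moreover have "v \<in> set (L ! i)" "v \<in> set (L ! j)" using assms by simp_all
  ultimately show False by blast
qed

lemma block_in: "p \<in> S \<Longrightarrow> fst p < length D \<and> blk p \<in> set (D ! fst p)"
  by (auto simp: slots_def block_def)

lemma block_subset: "p \<in> S \<Longrightarrow> set (blk p) \<subseteq> set (concat (D ! fst p))"
  using block_in by (metis UN_upper set_concat)

lemma vertex_slot:
  assumes "p \<in> S" "q \<in> S" "v \<in> set (blk p)" "v \<in> set (blk q)"
  shows "p = q"
proof (rule ccontr)
  assume "p \<noteq> q"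
  have pq: "fst p = fst q"
    using vertex_component block_in block_subset assms by (meson subsetD)
  let ?K = "D ! fst p"
  have K: "distinct (concat ?K)" using distinct_component block_in assms by blast
  have "[] \<notin> set ?K" using component[of ?K] block_in assms by simp
  then have "distinct ?K" using K by (simp add: distinct_concat_iff removeAll_id)
  moreover have "snd p < length ?K" "snd q < length ?K" "blk p = ?K ! snd p" "blk q = ?K ! snd q"
    using assms(1,2) pq by (auto simp: slots_def block_def)
  moreover have "snd p \<noteq> snd q" using \<open>p \<noteq> q\<close> pq by (simp add: prod_eq_iff)
  ultimately have "blk p \<noteq> blk q" by (simp add: nth_eq_iff_index_eq)
  moreover have "blk p \<in> set ?K" "blk q \<in> set ?K" using block_in assms pq by metis+
  ultimately have "set (blk p) \<inter> set (blk q) = {}"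
    using K distinct_concat_iff[of ?K] by metis
  then show False using assms by blast
qed

lemma distinct_block: "p \<in> S \<Longrightarrow> distinct (blk p)"
  using distinct_component[of "fst p"] block_in[of p] distinct_concat_iff[of "D ! fst p"] by blast

lemma joint_ends: "p \<in> S \<Longrightarrow> fst (jt p) \<in> set (blk p) \<and> snd (jt p) \<in> set (blk (nx p))"
  using block_ne[of p] block_ne[of "nx p"] next_slot_in[of p D] by (simp add: joint_def)

lemma joint_not_step: "p \<in> S \<Longrightarrow> q \<in> S \<Longrightarrow> jt p \<notin> steps (blk q)"
proof
  assume *: "p \<in> S" "q \<in> S" "jt p \<in> steps (blk q)"
  then have "fst (jt p) \<in> set (blk q)" using steps_vertices by (metis prod.collapse)
  then have "p = q" using vertex_slot joint_ends * by blast
  then show False using * steps_not_last[OF distinct_block[OF \<open>q \<in> S\<close>]]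
    by (metis fst_conv joint_def prod.collapse)
qed

lemma joint_inj: "p \<in> S \<Longrightarrow> q \<in> S \<Longrightarrow> jt p = jt q \<Longrightarrow> p = q"
  using joint_ends vertex_slot by metis

lemma step_inj: "p \<in> S \<Longrightarrow> q \<in> S \<Longrightarrow> e \<in> steps (blk p) \<Longrightarrow> e \<in> steps (blk q) \<Longrightarrow> p = q"
  using steps_vertices vertex_slot by (metis prod.collapse)

lemma meet:
  assumes "e \<in> E" "f \<in> E" "e \<noteq> f" "x \<in> seg e" "y \<in> seg f" "fst x = fst y"
  shows "x = y \<and> x \<in> {fst e, snd e} \<and> x \<in> {fst f, snd f}
    \<or> passes_over e f \<and> x = cut e f \<and> y = cut f e
    \<or> passes_over f e \<and> x = cut e f \<and> y = cut f e"
proof -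
  consider "successive e f" | "successive f e" | "separated e f" | "passes_over e f" | "passes_over f e"
    using generic assms by blast
  then show ?thesis
  proof cases
    case 1 then show ?thesis using successive_meet[OF 1 assms(4-6)] by simp
  next
    case 2 then show ?thesis using successive_meet[OF 2 assms(5,4) assms(6)[symmetric]] by simp
  next
    case 3 then show ?thesis using separated_disjoint[OF 3 assms(4,5)] assms(6) by auto
  next
    case 4 then show ?thesis
      using transverse_cut_unique assms transverse_sym by (metis passes_over_def)
  next
    case 5 then show ?thesis
      using transverse_cut_unique assms transverse_sym by (metis passes_over_def)
  qed
qed

lemma meet_point:
  assumes "e \<in> E" "f \<in> E" "e \<noteq> f" "x \<in> seg e" "x \<in> seg f"
  shows "x \<in> {fst e, snd e}" "x \<in> {fst f, snd f}"
  using meet[OF assms refl] by (auto simp: passes_over_def)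

lemma fst_inj_seg:
  assumes "e \<in> E" "x \<in> seg e" "y \<in> seg e" "fst x = fst y"
  shows "x = y"
proof -
  obtain u where u: "x = (1 - u) *\<^sub>R fst e + u *\<^sub>R snd e" using assms(2) by (auto simp: in_segment)
  obtain v where v: "y = (1 - v) *\<^sub>R fst e + v *\<^sub>R snd e" using assms(3) by (auto simp: in_segment)
  have "(u - v) *\<^sub>R (fst (snd e) - fst (fst e)) = 0" using assms(4) by (simp add: u v algebra_simps)
  then show ?thesis using not_vertical[OF assms(1)] u v by simp
qed

lemma curve_eq: "curve K = (\<Union>e\<in>edges K. seg e)"
  by (auto simp: curve_def)

lemma link_curve_eq: "link_curve L = (\<Union>e\<in>E. seg e)"
  by (auto simp: link_curve_def link_edges_def curve_eq)

lemma edge_ends: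
  assumes "e \<in> edges (concat (D ! i))" "i < length D"
  shows "fst e \<in> set (concat (D ! i))" "snd e \<in> set (concat (D ! i))"
proof -
  have "fst e \<in> set (concat (D ! i)) \<and> snd e \<in> set (concat (D ! i))"
  proof -
    have ne: "concat (D ! i) \<noteq> []"
    proof
      assume "concat (D ! i) = []"
      then have "length (concat (D ! i)) = 0" by (metis list.size(3))
      then show False using component[of "D ! i"] nth_mem[OF assms(2)] by linarith
    qed
    have "e = (last (concat (D ! i)), hd (concat (D ! i))) \<or> (fst e, snd e) \<in> steps (concat (D ! i))"
      using assms(1) unfolding edges_eq cyclic_steps_eq[OF ne] by simp
    then show ?thesis
      using steps_vertices last_in_set[OF ne] hd_in_set[OF ne] by (metis fst_conv snd_conv)
  qed
  then show "fst e \<in> set (concat (D ! i))" "snd e \<in> set (concat (D ! i))" by auto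
qed

lemma edge_E: "i < length D \<Longrightarrow> e \<in> edges (concat (D ! i)) \<Longrightarrow> e \<in> E"
  by (auto simp: link_edges_def)

lemma curves_disjoint:
  assumes "i < length D" "j < length D" "i \<noteq> j"
  shows "curve (L ! i) \<inter> curve (L ! j) = {}"
proof (rule ccontr)
  assume "\<not> ?thesis"
  then obtain e f x where *: "e \<in> edges (concat (D ! i))" "f \<in> edges (concat (D ! j))" "x \<in> seg e" "x \<in> seg f"
    using assms by (auto simp: curve_eq)
  note ends = edge_ends[OF *(1) assms(1)] edge_ends[OF *(2) assms(2)]
  note sep = vertex_component[OF assms(1,2)]
  have "e \<noteq> f" using ends sep assms(3) by metis
  then have "x \<in> {fst e, snd e}" "x \<in> {fst f, snd f}"
    using meet_point[OF edge_E[OF assms(1) *(1)] edge_E[OF assms(2) *(2)] _ *(3,4)] by simp_all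
  then show False using ends sep[of x] assms(3) by (metis empty_iff insert_iff)
qed

lemma polygonal: "polygonal_link L"
proof -
  have "simple_polygon K" if "K \<in> set L" for K
  proof -
    have "K \<in> concat ` set D" using that by simp
    then obtain C where "K = concat C" "C \<in> set D" by (rule imageE)
    then obtain i where i: "i < length D" "K = concat (D ! i)" by (metis in_set_conv_nth)
    have "3 \<le> length K" using component[of "D ! i"] i by simp
    moreover have "closed_segment p q \<inter> closed_segment r s \<subseteq> {p, q} \<inter> {r, s}"
      if "(p, q) \<in> edges K" "(r, s) \<in> edges K" "(p, q) \<noteq> (r, s)" for p q r s
    proof -
      have "(p, q) \<in> E" "(r, s) \<in> E" using that(1,2) edge_E i by metis+
      then have "x \<in> {p, q} \<inter> {r, s}" if "x \<in> closed_segment p q" "x \<in> closed_segment r s" for x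
        using meet_point[of "(p, q)" "(r, s)" x] \<open>(p, q) \<noteq> (r, s)\<close> that by simp
      then show ?thesis by (meson IntE subsetI)
    qed
    moreover have "distinct K" using distinct_component[OF i(1)] i(2) by (metis)
    ultimately show ?thesis
      unfolding simple_polygon_def by (intro conjI ballI case_prodI2 impI) metis+
  qed
  then show ?thesis using nonempty curves_disjoint by (simp add: polygonal_link_def)
qed

lemma vertex_edge:
  assumes "v \<in> link_vertices L"
  shows "\<exists>e\<in>E. v = fst e"
proof -
  obtain K where K: "K \<in> set L" "v \<in> set K" using assms unfolding link_vertices_def by blast
  then obtain n where n: "n < length K" "v = K ! n" by (auto simp: in_set_conv_nth)
  then have "(v, rotate1 K ! n) \<in> edges K" by (auto simp: edges_def set_zip)
  then show ?thesis using K by (auto simp: link_edges_def intro!: bexI)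
qed

text \<open>
  A triple point is impossible: its lowest strand would be an edge with two undercrossings.
\<close>

lemma regular: "regular_projection L"
  unfolding regular_projection_def
proof (intro conjI ballI)
  show "case e of (p, q) \<Rightarrow> fst p \<noteq> fst q" if "e \<in> E" for e
    using not_vertical[OF that] by (auto split: prod.splits)
next
  fix v f assume v: "v \<in> link_vertices L" and f: "f \<in> E"
  obtain g where g: "g \<in> E" "v = fst g" using vertex_edge v by blast
  have "v \<in> {fst f, snd f}" if y: "y \<in> seg f" "fst v = fst y" for y
  proof (cases "g = f")
    case False
    have "v \<in> seg g" using g by simp
    moreover have "cut g f \<noteq> v" if "passes_over g f \<or> passes_over f g"
      using that transverse_cut(2) transverse_sym g by (metis passes_over_def)
    ultimately show ?thesis using meet[OF g(1) f False _ y] by blast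
  qed (use g in auto)
  moreover have "\<exists>y\<in>seg f. fst v = fst y" if "fst v \<in> closed_segment (fst (fst f)) (fst (snd f))"
  proof -
    obtain u where u: "0 \<le> u" "u \<le> 1" "fst v = (1 - u) *\<^sub>R fst (fst f) + u *\<^sub>R fst (snd f)"
      using \<open>fst v \<in> closed_segment (fst (fst f)) (fst (snd f))\<close> by (auto simp: in_segment)
    show ?thesis
      unfolding in_segment using u by (intro bexI[of _ "(1 - u) *\<^sub>R fst f + u *\<^sub>R snd f"]) (auto simp: in_segment)
  qed
  ultimately show "case f of (p, q) \<Rightarrow> v \<notin> {p, q} \<longrightarrow> fst v \<notin> closed_segment (fst p) (fst q)"
    unfolding case_prod_beta by blast
next
  fix x y z assume "x \<in> link_curve L" "y \<in> link_curve L" "z \<in> link_curve L"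
  then obtain e f g where E: "e \<in> E" "f \<in> E" "g \<in> E" and s: "x \<in> seg e" "y \<in> seg f" "z \<in> seg g"
    by (auto simp: link_curve_eq)
  show "fst x = fst y \<and> fst y = fst z \<longrightarrow> x = y \<or> y = z \<or> x = z"
  proof (intro impI, rule ccontr)
    assume eq: "fst x = fst y \<and> fst y = fst z" and "\<not> (x = y \<or> y = z \<or> x = z)"
    then have ne: "x \<noteq> y" "y \<noteq> z" "x \<noteq> z" by auto
    have "e \<noteq> f" "f \<noteq> g" "e \<noteq> g" using fst_inj_seg s E eq ne by metis+
    have o: "passes_over e f \<and> snd y < snd x \<or> passes_over f e \<and> snd x < snd y"
        "passes_over f g \<and> snd z < snd y \<or> passes_over g f \<and> snd y < snd z"
        "passes_over e g \<and> snd z < snd x \<or> passes_over g e \<and> snd x < snd z"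
      using meet[OF E(1,2) \<open>e \<noteq> f\<close> s(1,2)] meet[OF E(2,3) \<open>f \<noteq> g\<close> s(2,3)] meet[OF E(1,3) \<open>e \<noteq> g\<close> s(1,3)]
        eq ne by (auto simp: passes_over_def)
    have u: "a = b" if "passes_over a c" "passes_over b c" "a \<in> E" "b \<in> E" "c \<in> E" for a b c
      using undercrossing[OF that(3,5,1)] undercrossing[OF that(4,5,2)] joint_inj by metis
    \<comment> \<open>The heights exclude the two cyclic patterns; every other pattern has an edge below two others.\<close>
    from o show False
      using u[OF _ _ E(1,2,3)] u[OF _ _ E(1,3,2)] u[OF _ _ E(2,3,1)]
        \<open>e \<noteq> f\<close> \<open>f \<noteq> g\<close> \<open>e \<noteq> g\<close> by (elim disjE conjE) (blast | linarith)+
  qed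
qed

lemma classical: "classical_link L"
  using polygonal regular by (simp add: classical_link_def)

section \<open>Crossings and arcs of a diagram\<close>

text \<open>
  An affine coordinate along the joint \<open>jt p\<close> that vanishes exactly at the undercrossing and has
  opposite signs at the two ends. It tells the two halves of the joint apart and computes \<open>side\<close>.
\<close>

definition level :: "nat \<times> nat \<Rightarrow> point \<Rightarrow> real" where
  "level p w = turn (fst (over_edge p)) (snd (over_edge p)) w"

text \<open>
  The closure of an arc. The predecessor \<open>q\<close> is unique, but quantifying over it avoids
  arithmetic with indices.
\<close>

definition piece :: "nat \<times> nat \<Rightarrow> point set" where
  "piece p = polyline (blk p) \<union> closed_segment (last (blk p)) (under_point p)
     \<union> (\<Union>q\<in>{q\<in>S. nx q = p}. closed_segment (hd (blk p)) (under_point q))"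

definition arc_set :: "nat \<times> nat \<Rightarrow> point set" where
  "arc_set p = piece p - under_point ` S"

lemma transverse_joint: "p \<in> S \<Longrightarrow> transverse (over_edge p) (jt p)"
  using overcrossing by (simp add: passes_over_def)

lemma under_point:
  assumes "p \<in> S"
  shows "under_point p \<in> seg (jt p)" "under_point p \<noteq> fst (jt p)" "under_point p \<noteq> snd (jt p)"
  using transverse_cut(1-3)[OF transverse_sym[OF transverse_joint[OF assms]]]
  by (simp_all add: under_point_def)

lemma over_point:
  assumes "p \<in> S"
  shows "over_point p \<in> seg (over_edge p)" "over_point p \<noteq> fst (over_edge p)"
    "over_point p \<noteq> snd (over_edge p)" "fst (over_point p) = fst (under_point p)"
    "snd (under_point p) < snd (over_point p)"
  using transverse_cut[OF transverse_joint[OF assms]] overcrossing[OF assms]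
  by (simp_all add: under_point_def over_point_def passes_over_def)

text \<open>
  A point in the interior of one edge that lies on another edge would be a common endpoint.
\<close>

lemma under_point_edge:
  assumes "p \<in> S" "e \<in> E" "under_point p \<in> seg e"
  shows "e = jt p"
  using meet_point(1)[OF joint_E[OF assms(1)] assms(2) _ under_point(1)[OF assms(1)] assms(3)]
    under_point(2,3)[OF assms(1)] by force

lemma over_point_edge:
  assumes "p \<in> S" "e \<in> E" "over_point p \<in> seg e"
  shows "e = over_edge p"
  using meet_point(1)[OF over_edge_E[OF assms(1)] assms(2) _ over_point(1)[OF assms(1)] assms(3)]
    over_point(2,3)[OF assms(1)] by force

lemma under_point_inj: "p \<in> S \<Longrightarrow> q \<in> S \<Longrightarrow> under_point p = under_point q \<Longrightarrow> p = q"
  using under_point_edge[of p "jt q"] under_point(1)[of q] joint_E joint_inj by metis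

lemma crossings_eq: "crossings L = (\<lambda>p. (over_point p, under_point p)) ` S"
proof
  show "(\<lambda>p. (over_point p, under_point p)) ` S \<subseteq> crossings L"
  proof
    fix c assume "c \<in> (\<lambda>p. (over_point p, under_point p)) ` S"
    then obtain p where p: "p \<in> S" "c = (over_point p, under_point p)" by blast
    have "over_point p \<in> link_curve L" "under_point p \<in> link_curve L"
      unfolding link_curve_eq using over_point(1) over_edge_E under_point(1) joint_E p(1) by blast+
    then show "c \<in> crossings L" using over_point(4,5)[OF p(1)] p(2) by (simp add: crossings_def)
  qed
  show "crossings L \<subseteq> (\<lambda>p. (over_point p, under_point p)) ` S"
  proof
    fix c assume c: "c \<in> crossings L"
    obtain x y where xy: "c = (x, y)" by (cases c)
    have "x \<in> link_curve L" "y \<in> link_curve L" and h: "fst x = fst y" "snd y < snd x"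
      using c xy by (auto simp: crossings_def)
    then obtain e f where ef: "e \<in> E" "f \<in> E" "x \<in> seg e" "y \<in> seg f"
      unfolding link_curve_eq by blast
    have "e \<noteq> f" using fst_inj_seg ef h by (metis less_irrefl)
    then have po: "passes_over e f" "x = cut e f" "y = cut f e"
      using meet[OF ef(1,2) _ ef(3,4) h(1)] h(2) by (auto simp: passes_over_def)
    then obtain p where "p \<in> S" "f = jt p" "e = over_edge p" using undercrossing ef by blast
    then show "c \<in> (\<lambda>p. (over_point p, under_point p)) ` S"
      using po xy by (auto simp: over_point_def under_point_def)
  qed
qed

lemma unders_eq: "snd ` crossings L = under_point ` S"
  by (simp add: crossings_eq image_image)

lemma level_under: "p \<in> S \<Longrightarrow> level p (under_point p) = 0"
  unfolding level_def using turn_on_segment[OF over_point(1)] turn_fst_cong[OF over_point(4)] by metis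

lemma level_ends:
  assumes "p \<in> S"
  shows "level p (fst (jt p)) * level p (snd (jt p)) < 0"
proof -
  note t = transverse_turn[OF transverse_joint[OF assms]]
  show ?thesis unfolding level_def mult_less_0_iff using t by linarith
qed

lemma level_unique:
  assumes "p \<in> S" "w \<in> seg (jt p)" "level p w = 0"
  shows "w = under_point p"
proof -
  let ?a = "fst (jt p)" and ?b = "snd (jt p)"
  obtain u where u: "w = (1 - u) *\<^sub>R ?a + u *\<^sub>R ?b" using assms(2) by (auto simp: in_segment)
  obtain v where v: "under_point p = (1 - v) *\<^sub>R ?a + v *\<^sub>R ?b"
    using under_point(1)[OF assms(1)] by (auto simp: in_segment)
  have "(1 - u) * level p ?a + u * level p ?b = 0" "(1 - v) * level p ?a + v * level p ?b = 0"
    using assms(3) level_under[OF assms(1)] by (simp_all add: level_def u v turn_affine)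
  then have "(u - v) * (level p ?b - level p ?a) = 0" by (simp add: algebra_simps)
  moreover have "level p ?b - level p ?a \<noteq> 0"
    using level_ends[OF assms(1)] by (auto simp: mult_less_0_iff)
  ultimately show ?thesis using u v by simp
qed

lemma level_half:
  assumes "p \<in> S" "w \<in> closed_segment v (under_point p)" "v \<in> {fst (jt p), snd (jt p)}"
  shows "w \<in> seg (jt p)" "w = under_point p \<or> 0 < level p w * level p v"
proof -
  show w: "w \<in> seg (jt p)"
  proof -
    have "v \<in> seg (jt p)" using assms(3) ends_in_segment by blast
    then have "closed_segment v (under_point p) \<subseteq> seg (jt p)"
      using under_point(1)[OF assms(1)] by (simp add: subset_closed_segment)
    then show ?thesis using assms(2) by (rule subsetD)
  qed
  obtain u where u: "0 \<le> u" "u \<le> 1" "w = (1 - u) *\<^sub>R v + u *\<^sub>R under_point p"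
    using assms(2) by (auto simp: in_segment)
  have "level p w = (1 - u) * level p v"
    using level_under[OF assms(1)] by (simp add: level_def u(3) turn_affine)
  then have "level p w * level p v = (1 - u) * (level p v)\<^sup>2" by (simp add: power2_eq_square)
  moreover have "level p v \<noteq> 0" using level_ends[OF assms(1)] assms(3) by auto
  ultimately show "w = under_point p \<or> 0 < level p w * level p v"
    using u level_unique[OF assms(1) w] by (cases "u = 1") auto
qed

lemma joint_halves:
  assumes "p \<in> S"
  shows "seg (jt p) = closed_segment (fst (jt p)) (under_point p) \<union> closed_segment (snd (jt p)) (under_point p)"
  using Un_closed_segment[OF under_point(1)[OF assms]] by (simp add: closed_segment_commute)

lemma piece_curve:
  assumes "i < length D"
  shows "curve (L ! i) = (\<Union>p\<in>{p\<in>S. fst p = i}. piece p)"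
proof
  have L: "L ! i = concat (D ! i)" using assms by simp
  show "curve (L ! i) \<subseteq> (\<Union>p\<in>{p\<in>S. fst p = i}. piece p)"
  proof
    fix w assume "w \<in> curve (L ! i)"
    then obtain p e where p: "p \<in> S" "fst p = i" "e = jt p \<or> e \<in> steps (blk p)" "w \<in> seg e"
      unfolding L curve_eq edges_component[OF assms] by blast
    from p(3) show "w \<in> (\<Union>p\<in>{p\<in>S. fst p = i}. piece p)"
    proof
      assume "e = jt p"
      then have "w \<in> closed_segment (last (blk p)) (under_point p)
          \<or> w \<in> closed_segment (hd (blk (nx p))) (under_point p)"
        using p(4) joint_halves[OF p(1)] by (simp add: joint_def)
      then have "w \<in> piece p \<or> w \<in> piece (nx p)" using p(1) unfolding piece_def by blast
      then show ?thesis using p(1,2) next_slot_in[OF p(1)] by fastforce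
    next
      assume "e \<in> steps (blk p)"
      then have "w \<in> piece p" using p(4) unfolding piece_def polyline_def by blast
      then show ?thesis using p by blast
    qed
  qed
  have vert: "set (blk p) \<subseteq> curve (L ! i)" if "p \<in> S" "fst p = i" for p
  proof
    fix v assume "v \<in> set (blk p)"
    then have "v \<in> set (L ! i)" using block_subset[OF that(1)] that(2) L by auto
    then obtain n where n: "n < length (L ! i)" "v = L ! i ! n" by (metis in_set_conv_nth)
    then have "(v, rotate1 (L ! i) ! n) \<in> edges (L ! i)" unfolding edges_def set_zip by auto
    then show "v \<in> curve (L ! i)" unfolding curve_eq by (rule UN_I) simp
  qed
  have edge: "seg e \<subseteq> curve (L ! i)" if "p \<in> S" "fst p = i" "e = jt p \<or> e \<in> steps (blk p)" for p e
    unfolding L curve_eq edges_component[OF assms] using that by blast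
  show "(\<Union>p\<in>{p\<in>S. fst p = i}. piece p) \<subseteq> curve (L ! i)"
  proof
    fix w assume "w \<in> (\<Union>p\<in>{p\<in>S. fst p = i}. piece p)"
    then obtain p where p: "p \<in> S" "fst p = i" "w \<in> piece p" by blast
    then consider "w \<in> set (blk p)" | e where "e \<in> steps (blk p)" "w \<in> seg e"
      | "w \<in> closed_segment (last (blk p)) (under_point p)"
      | q where "q \<in> S" "nx q = p" "w \<in> closed_segment (hd (blk p)) (under_point q)"
      unfolding piece_def polyline_def by blast
    then show "w \<in> curve (L ! i)"
    proof cases
      case 1 then show ?thesis using vert p by blast
    next
      case 2 then show ?thesis using edge p by blast
    next
      case 3
      then have "w \<in> seg (jt p)" using level_half(1)[OF p(1)] by (simp add: joint_def)
      then show ?thesis using edge p by blast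
    next
      case 4
      then have "w \<in> seg (jt q)" using level_half(1)[OF 4(1)] by (simp add: joint_def)
      moreover have "fst q = i" using 4(2) p(2) by (metis fst_next_slot)
      ultimately show ?thesis using edge 4(1) by blast
    qed
  qed
qed

text \<open>
  Four kinds of points, with the halves of joints described by the sign of \<open>level\<close>. In this form a point
  of two arcs is easily excluded.
\<close>

lemma arc_set_cases:
  assumes "p \<in> S" "w \<in> arc_set p"
  obtains (vertex) "w \<in> set (blk p)"
  | (step) e where "e \<in> steps (blk p)" "w \<in> seg e"
  | (leaving) "w \<in> seg (jt p)" "0 < level p w * level p (fst (jt p))"
  | (entering) q where "q \<in> S" "nx q = p" "w \<in> seg (jt q)" "0 < level q w * level q (snd (jt q))"
proof -
  have w: "w \<in> piece p" "w \<notin> under_point ` S" using assms(2) by (auto simp: arc_set_def)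
  from w(1) consider "w \<in> set (blk p)" | e where "e \<in> steps (blk p)" "w \<in> seg e"
      | "w \<in> closed_segment (last (blk p)) (under_point p)"
      | q where "q \<in> S" "nx q = p" "w \<in> closed_segment (hd (blk p)) (under_point q)"
      unfolding piece_def polyline_def by blast
  then show thesis
  proof cases
    case 1 then show ?thesis by (rule vertex)
  next
    case 2 then show ?thesis by (rule step)
  next
    case 3
    then have h: "w \<in> closed_segment (fst (jt p)) (under_point p)" by (simp add: joint_def)
    have "w \<noteq> under_point p" using w(2) assms(1) by blast
    then show ?thesis using level_half[OF assms(1) h] leaving by simp
  next
    case 4
    then have h: "w \<in> closed_segment (snd (jt q)) (under_point q)" by (simp add: joint_def)
    have "w \<noteq> under_point q" using w(2) 4(1) by blast
    then show ?thesis using level_half[OF 4(1) h] entering[OF 4(1,2)] by simp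
  qed
qed

lemma vertex_on_edge:
  assumes "r \<in> S" "w \<in> set (blk r)" "e \<in> E" "w \<in> seg e"
  shows "w \<in> {fst e, snd e}"
proof -
  have "w \<in> link_vertices L"
    using assms(2) block_subset[OF assms(1)] block_in[OF assms(1)] unfolding link_vertices_def by force
  then obtain g where g: "g \<in> E" "w = fst g" using vertex_edge by blast
  show ?thesis
  proof (cases "g = e")
    case False
    have "w \<in> seg g" using g by simp
    then show ?thesis using meet_point(2)[OF g(1) assms(3) False] assms(4) by blast
  qed (use g in simp)
qed

lemma arc_set_vertex:
  assumes "p \<in> S" "w \<in> arc_set p" "r \<in> S" "w \<in> set (blk r)"
  shows "p = r"
  using assms(1,2)
proof (cases rule: arc_set_cases)
  case vertex
  then show ?thesis using vertex_slot assms by blast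
next
  case (step e)
  then have "w \<in> {fst e, snd e}" using vertex_on_edge assms(3,4) step_E assms(1) by blast
  then have "w \<in> set (blk p)" using step(1) steps_vertices by (metis insertE prod.collapse singletonD)
  then show ?thesis using vertex_slot assms by blast
next
  case leaving
  have "w \<in> {fst (jt p), snd (jt p)}"
    using vertex_on_edge[OF assms(3,4) joint_E[OF assms(1)] leaving(1)] .
  then have "w = fst (jt p)" using leaving(2) level_ends[OF assms(1)] by (auto simp: mult.commute)
  then show ?thesis using joint_ends[OF assms(1)] vertex_slot assms by blast
next
  case (entering q)
  have "w \<in> {fst (jt q), snd (jt q)}"
    using vertex_on_edge[OF assms(3,4) joint_E[OF entering(1)] entering(3)] .
  then have "w = snd (jt q)" using entering(4) level_ends[OF entering(1)] by auto
  then show ?thesis using joint_ends[OF entering(1)] entering(2) vertex_slot assms by blast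
qed

text \<open>
  A common point that is not a vertex lies on a single edge. If this edge is a joint, the sign of \<open>level\<close>
  decides between the two arcs that share it.
\<close>

lemma arc_set_disjoint:
  assumes p: "p \<in> S" "w \<in> arc_set p" and q: "q \<in> S" "w \<in> arc_set q"
  shows "p = q"
proof (cases "\<exists>r\<in>S. w \<in> set (blk r)")
  case True
  then show ?thesis using arc_set_vertex p q by metis
next
  case False
  \<comment> \<open>The ways in which an edge can put \<open>w\<close> on the arc \<open>r\<close>.\<close>
  define own where "own r e \<longleftrightarrow> e \<in> E \<and> w \<in> seg e \<and> (e \<in> steps (blk r)
     \<or> e = jt r \<and> 0 < level r w * level r (fst (jt r))
     \<or> (\<exists>s\<in>S. nx s = r \<and> e = jt s \<and> 0 < level s w * level s (snd (jt s))))" for r e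
  have own: "\<exists>e. own r e" if "r \<in> S" "w \<in> arc_set r" for r
    using that
  proof (cases rule: arc_set_cases)
    case vertex then show ?thesis using False that(1) by blast
  next
    case (step e) then show ?thesis using step_E that(1) unfolding own_def by blast
  next
    case leaving then show ?thesis using joint_E[OF that(1)] unfolding own_def by blast
  next
    case (entering s) then show ?thesis using joint_E[of s] unfolding own_def by blast
  qed
  obtain e f where e: "own p e" and f: "own q f" using own p q by blast
  have "e = f"
  proof (rule ccontr)
    assume "e \<noteq> f"
    then have "w \<in> {fst e, snd e}" using meet_point(1)[of e f w] e f by (simp add: own_def)
    moreover have "\<exists>r\<in>S. v \<in> set (blk r)" if "v \<in> {fst e, snd e}" for v
    proof -
      obtain r where "r \<in> S" "e = jt r \<or> e \<in> steps (blk r)" using e E_eq unfolding own_def by blast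
      then show ?thesis
        using that joint_ends[of r] next_slot_in[of r D] steps_vertices[of "fst e" "snd e" "blk r"] by auto
    qed
    ultimately show False using False by blast
  qed
  have opp: "\<not> (0 < level s w * level s (fst (jt s)) \<and> 0 < level s w * level s (snd (jt s)))" if "s \<in> S" for s
    using level_ends[OF that] by (auto simp: zero_less_mult_iff mult_less_0_iff)
  show ?thesis
    using e f \<open>e = f\<close> step_inj[OF p(1) q(1)] joint_not_step p(1) q(1) joint_inj opp
    unfolding own_def by metis
qed

lemma polyline_no_under: "p \<in> S \<Longrightarrow> r \<in> S \<Longrightarrow> under_point r \<notin> polyline (blk p)"
proof
  assume pr: "p \<in> S" "r \<in> S" "under_point r \<in> polyline (blk p)"
  then consider "under_point r \<in> set (blk p)" | e where "e \<in> steps (blk p)" "under_point r \<in> seg e"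
    unfolding polyline_def by blast
  then show False
  proof cases
    case 1
    then show False
      using vertex_on_edge[OF pr(1) _ joint_E[OF pr(2)] under_point(1)[OF pr(2)]] under_point(2,3)[OF pr(2)]
      by blast
  next
    case 2
    then show False using under_point_edge[OF pr(2) step_E[OF pr(1)]] joint_not_step[OF pr(2,1)] by blast
  qed
qed

lemma half_no_under:
  assumes "p \<in> S" "r \<in> S" "v \<in> {fst (jt p), snd (jt p)}" "under_point r \<in> closed_segment v (under_point p)"
  shows "r = p"
proof -
  have "jt p = jt r" using under_point_edge[OF assms(2) joint_E[OF assms(1)]] level_half(1)[OF assms(1,4,3)] .
  then show ?thesis using joint_inj assms by metis
qed

text \<open>
  Of all undercrossings, the closure of an arc meets only those at its own ends; removing them leaves
  two half-open segments attached to the polyline of its vertices.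
\<close>

lemma arc_set_eq:
  assumes "p \<in> S"
  shows "arc_set p = polyline (blk p) \<union> (closed_segment (last (blk p)) (under_point p) - {under_point p})
     \<union> (\<Union>q\<in>{q\<in>S. nx q = p}. closed_segment (hd (blk p)) (under_point q) - {under_point q})"
proof -
  have 1: "polyline (blk p) - under_point ` S = polyline (blk p)"
    using polyline_no_under[OF assms] by blast
  have 2: "closed_segment (last (blk p)) (under_point p) - under_point ` S
      = closed_segment (last (blk p)) (under_point p) - {under_point p}"
  proof -
    have "r = p" if "r \<in> S" "under_point r \<in> closed_segment (last (blk p)) (under_point p)" for r
      using half_no_under[OF assms that(1), of "last (blk p)"] that(2) by (simp add: joint_def)
    then show ?thesis using assms by blast
  qed
  have 3: "closed_segment (hd (blk p)) (under_point q) - under_point ` S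
      = closed_segment (hd (blk p)) (under_point q) - {under_point q}" if "q \<in> S" "nx q = p" for q
  proof -
    have "r = q" if "r \<in> S" "under_point r \<in> closed_segment (hd (blk p)) (under_point q)" for r
      using half_no_under[OF \<open>q \<in> S\<close> that(1), of "hd (blk p)"] that(2) \<open>nx q = p\<close> by (simp add: joint_def)
    then show ?thesis using \<open>q \<in> S\<close> by blast
  qed
  have "arc_set p = (polyline (blk p) - under_point ` S) \<union> (closed_segment (last (blk p)) (under_point p) - under_point ` S)
     \<union> (\<Union>q\<in>{q\<in>S. nx q = p}. closed_segment (hd (blk p)) (under_point q) - under_point ` S)"
    unfolding arc_set_def piece_def by blast
  then show ?thesis using 3 by (simp add: 1 2)
qed

lemma polyline_ends: "p \<in> S \<Longrightarrow> hd (blk p) \<in> polyline (blk p) \<and> last (blk p) \<in> polyline (blk p)"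
  using block_ne by (simp add: polyline_def)

lemma connected_arc_set:
  assumes "p \<in> S"
  shows "connected (arc_set p)"
proof -
  let ?B = "polyline (blk p) \<union> (closed_segment (last (blk p)) (under_point p) - {under_point p})"
  let ?H = "\<lambda>q. closed_segment (hd (blk p)) (under_point q) - {under_point q}"
  let ?Q = "{q\<in>S. nx q = p}"
  have "last (blk p) \<noteq> under_point p" using polyline_ends[OF assms] polyline_no_under[OF assms assms] by metis
  then have B: "connected ?B"
    using polyline_ends[OF assms] connected_polyline connected_segment_minus_end
    by (intro connected_Un) auto
  have hd: "hd (blk p) \<in> ?H q" if "q \<in> ?Q" for q
    using polyline_ends[OF assms] polyline_no_under[OF assms, of q] that by auto
  have "connected (?B \<union> ?H q)" if "q \<in> ?Q" for q
    by (rule connected_Un[OF B connected_segment_minus_end])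
      (use polyline_ends[OF assms] hd[OF that] in blast)
  then have "connected (\<Union>(insert ?B ((\<lambda>q. ?B \<union> ?H q) ` ?Q)))"
    using B polyline_ends[OF assms] by (intro connected_Union) auto
  moreover have "arc_set p = \<Union>(insert ?B ((\<lambda>q. ?B \<union> ?H q) ` ?Q))"
    unfolding arc_set_eq[OF assms] by blast
  ultimately show ?thesis by simp
qed

lemma closed_piece: "closed (piece p)"
  unfolding piece_def using finite_slots[of D] by (intro closed_Un closed_UN closed_polyline) auto

lemma arc_set_ne: "p \<in> S \<Longrightarrow> arc_set p \<noteq> {}"
  using arc_set_eq polyline_ends by blast

text \<open>
  The closed pieces cut the punctured curve into disjoint, connected and relatively closed sets.
\<close>

lemma arcs_eq: "arcs L = (\<lambda>p. (fst p, arc_set p)) ` S"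
proof -
  have "components (curve (L ! i) - snd ` crossings L) = arc_set ` {p\<in>S. fst p = i}" if i: "i < length D" for i
  proof (rule components_eq_pieces[where C = piece])
    let ?I = "{p\<in>S. fst p = i}"
    show "finite ?I" using finite_slots[of D] by simp
    show "curve (L ! i) - snd ` crossings L = (\<Union>p\<in>?I. arc_set p)"
      unfolding unders_eq piece_curve[OF i] arc_set_def by blast
    show "closed (piece p) \<and> arc_set p = (curve (L ! i) - snd ` crossings L) \<inter> piece p" if "p \<in> ?I" for p
      using closed_piece that unfolding unders_eq piece_curve[OF i] arc_set_def by blast
    show "connected (arc_set p)" "arc_set p \<noteq> {}" if "p \<in> ?I" for p
      using connected_arc_set arc_set_ne that by simp_all
    show "arc_set p \<inter> arc_set q = {}" if "p \<in> ?I" "q \<in> ?I" "p \<noteq> q" for p q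
      using arc_set_disjoint that by blast
  qed
  then have "arcs L = {(i, A). i < length D \<and> A \<in> arc_set ` {p\<in>S. fst p = i}}"
    unfolding arcs_def by auto
  also have "\<dots> = (\<lambda>p. (fst p, arc_set p)) ` S"
    using block_in by fastforce
  finally show ?thesis .
qed

lemma arc_unique:
  assumes "a \<in> arcs L" "r \<in> S" "w \<in> snd a" "w \<in> arc_set r"
  shows "a = (fst r, arc_set r)"
proof -
  obtain p where "p \<in> S" "a = (fst p, arc_set p)" using assms(1) arcs_eq by auto
  then show ?thesis using arc_set_disjoint[of p w r] assms by auto
qed

lemma over_arc_eq:
  assumes "p \<in> S"
  shows "over_arc L (over_point p, under_point p) = (fst (over_slot p), arc_set (over_slot p))"
proof -
  let ?r = "over_slot p"
  have r: "?r \<in> S" "over_edge p \<in> steps (blk ?r)" using overcrossing[OF assms] by auto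
  then have "over_point p \<in> polyline (blk ?r)" using over_point(1)[OF assms] unfolding polyline_def by blast
  then have x: "over_point p \<in> arc_set ?r" using arc_set_eq[OF r(1)] by simp
  show ?thesis
    unfolding over_arc_def case_prod_conv
  proof (rule the_equality)
    show "(fst ?r, arc_set ?r) \<in> arcs L \<and> over_point p \<in> snd (fst ?r, arc_set ?r)"
      using x r(1) arcs_eq by simp
    show "a = (fst ?r, arc_set ?r)" if "a \<in> arcs L \<and> over_point p \<in> snd a" for a
      using arc_unique[OF _ r(1) _ x] that by blast
  qed
qed

lemma side_eq:
  assumes "p \<in> S"
  shows "side L (over_point p) w = level p w"
proof -
  have "(THE e. e \<in> E \<and> over_point p \<in> closed_segment (fst e) (snd e)) = over_edge p"
  proof (rule the_equality)
    show "over_edge p \<in> E \<and> over_point p \<in> seg (over_edge p)"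
      using over_point(1)[OF assms] over_edge_E[OF assms] by (rule conjI[rotated])
    show "e = over_edge p" if "e \<in> E \<and> over_point p \<in> seg e" for e
      using over_point_edge[OF assms] that by blast
  qed
  then show ?thesis by (simp add: side_def level_def turn_def case_prod_beta)
qed

lemma half_in_arc:
  assumes "p \<in> S" "v = fst (jt p) \<and> r = p \<or> v = snd (jt p) \<and> r = nx p"
  shows "r \<in> S" "closed_segment v (under_point p) - {under_point p} \<subseteq> arc_set r"
proof -
  show r: "r \<in> S" using assms next_slot_in by blast
  show "closed_segment v (under_point p) - {under_point p} \<subseteq> arc_set r"
    using assms unfolding arc_set_eq[OF r] joint_def by auto
qed

text \<open>
  In a neighbourhood of the undercrossing avoiding the finitely many other edges, the link is the joint, and
  the side of the point is decided by the half on which it lies. The arc is determined by this because the half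
  accumulates at the undercrossing and each of its points lies on one arc only.
\<close>

lemma strand_arc:
  assumes p: "p \<in> S" and v: "v = fst (jt p) \<and> r = p \<or> v = snd (jt p) \<and> r = nx p"
  shows "(THE a. a \<in> arcs L \<and> (\<forall>\<^sub>F w in at (under_point p) within link_curve L.
            0 < level p w * level p v \<longrightarrow> w \<in> snd a)) = (fst r, arc_set r)"
proof (rule the_equality)
  let ?y = "under_point p"
  let ?H = "closed_segment v ?y"
  note half = half_in_arc[OF p v]
  have vj: "v \<in> {fst (jt p), snd (jt p)}" using v by blast
  have vy: "v \<noteq> ?y" using vj under_point(2,3)[OF p] by auto
  show "(fst r, arc_set r) \<in> arcs L \<and> (\<forall>\<^sub>F w in at ?y within link_curve L.
            0 < level p w * level p v \<longrightarrow> w \<in> snd (fst r, arc_set r))"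
  proof
    show "(fst r, arc_set r) \<in> arcs L" using half(1) arcs_eq by simp
    let ?W = "- (\<Union>e\<in>E - {jt p}. seg e)"
    have "open ?W" using finite_E by (intro open_Compl closed_UN) auto
    moreover have "?y \<in> ?W" using under_point_edge[OF p] by blast
    moreover have "w \<in> arc_set r" if w: "w \<in> ?W" "w \<noteq> ?y" "w \<in> link_curve L" "0 < level p w * level p v" for w
    proof -
      have "w \<in> seg (jt p)" using w(1,3) unfolding link_curve_eq by blast
      moreover have "{v, if v = fst (jt p) then snd (jt p) else fst (jt p)} = {fst (jt p), snd (jt p)}"
        using vj by auto
      then obtain v' where v': "{v, v'} = {fst (jt p), snd (jt p)}" by (rule that)
      ultimately have "w \<in> ?H \<or> w \<in> closed_segment v' ?y"
        using joint_halves[OF p] by (auto simp: doubleton_eq_iff)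
      moreover have "w \<notin> closed_segment v' ?y"
      proof
        assume "w \<in> closed_segment v' ?y"
        then have "0 < level p w * level p v'" using level_half(2)[OF p, of w v'] v' w(2) by auto
        moreover have "level p v * level p v' < 0"
          using level_ends[OF p] v' by (auto simp: doubleton_eq_iff mult.commute)
        ultimately show False using w(4) by (auto simp: zero_less_mult_iff mult_less_0_iff)
      qed
      ultimately show ?thesis using half(2) w(2) by blast
    qed
    ultimately show "\<forall>\<^sub>F w in at ?y within link_curve L.
            0 < level p w * level p v \<longrightarrow> w \<in> snd (fst r, arc_set r)"
      unfolding eventually_at_topological by (intro exI[of _ ?W]) auto
  qed
  fix a assume a: "a \<in> arcs L \<and> (\<forall>\<^sub>F w in at ?y within link_curve L.
            0 < level p w * level p v \<longrightarrow> w \<in> snd a)"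
  then obtain T where T: "open T" "?y \<in> T"
      "\<forall>w\<in>T. w \<noteq> ?y \<longrightarrow> w \<in> link_curve L \<longrightarrow> 0 < level p w * level p v \<longrightarrow> w \<in> snd a"
    unfolding eventually_at_topological by blast
  have "?H \<noteq> {x}" for x using vy ends_in_segment by (metis singletonD)
  then have "?y islimpt ?H" by (intro connected_imp_perfect connected_segment ends_in_segment)
  then obtain w where w: "w \<in> ?H" "w \<in> T" "w \<noteq> ?y" using T(1,2) unfolding islimpt_def by blast
  have "w \<in> link_curve L"
    using level_half(1)[OF p w(1) vj] joint_E[OF p] unfolding link_curve_eq by blast
  then have "w \<in> snd a" using T(3) w level_half(2)[OF p w(1) vj] by blast
  then show "a = (fst r, arc_set r)"
    using arc_unique[OF _ half(1)] a half(2) w by blast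
qed

definition relation :: "nat \<times> nat \<Rightarrow> (nat \<times> nat) \<times> (nat \<times> nat) \<times> (nat \<times> nat)" where
  "relation p = (over_slot p, if 0 < level p (snd (jt p)) then (nx p, p) else (p, nx p))"

lemma underpassing_arcs:
  assumes p: "p \<in> S" and "relation p = (o', l, r)"
  shows "left_arc L (over_point p, under_point p) = (fst l, arc_set l)"
    "right_arc L (over_point p, under_point p) = (fst r, arc_set r)"
proof -
  have key: "(0 < level p w * level p (fst (jt p)) \<longleftrightarrow> (if 0 < level p (snd (jt p)) then level p w < 0 else 0 < level p w))
    \<and> (0 < level p w * level p (snd (jt p)) \<longleftrightarrow> (if 0 < level p (snd (jt p)) then 0 < level p w else level p w < 0))" for w
    using level_ends[OF p] by (auto simp: zero_less_mult_iff mult_less_0_iff)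
  have lr: "0 < level p (snd (jt p)) \<and> l = nx p \<and> r = p \<or> \<not> 0 < level p (snd (jt p)) \<and> l = p \<and> r = nx p"
    using assms(2) by (auto simp: relation_def split: if_splits)
  note s = strand_arc[OF p, of "fst (jt p)" p] strand_arc[OF p, of "snd (jt p)" "nx p"]
  show "left_arc L (over_point p, under_point p) = (fst l, arc_set l)"
    "right_arc L (over_point p, under_point p) = (fst r, arc_set r)"
    unfolding left_arc_def right_arc_def case_prod_conv side_eq[OF p]
    using lr s by (auto simp: key)
qed

end

text \<open>
  Each entry \<open>(p, u, l, r)\<close> of the table stands for the undercrossing at the end of the arc in slot \<open>p\<close>, with the
  slots of the over, left and right arc. The first component of a slot is the index of the component.
\<close>

definition presented_by :: "plink \<Rightarrow> (slot \<times> slot \<times> slot \<times> slot) list \<Rightarrow> bool" where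
  "presented_by L R \<longleftrightarrow> distinct (map fst R) \<and> (\<exists>\<alpha> \<beta>.
     bij_betw \<alpha> (fst ` set R) (arcs L) \<and> bij_betw \<beta> (fst ` set R) (crossings L) \<and>
     (\<forall>p\<in>fst ` set R. fst (\<alpha> p) = fst p) \<and>
     (\<forall>(p, u, l, r)\<in>set R. u \<in> fst ` set R \<and> l \<in> fst ` set R \<and> r \<in> fst ` set R \<and> fst l = fst r \<and>
        over_arc L (\<beta> p) = \<alpha> u \<and> left_arc L (\<beta> p) = \<alpha> l \<and> right_arc L (\<beta> p) = \<alpha> r))"

context arc_diagram
begin

lemma presented:
  assumes "set ps = S" "distinct ps"
  shows "presented_by L (map (\<lambda>p. (p, relation p)) ps)"
proof -
  let ?R = "map (\<lambda>p. (p, relation p)) ps"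
  let ?\<alpha> = "\<lambda>p. (fst p, arc_set p)" and ?\<beta> = "\<lambda>p. (over_point p, under_point p)"
  have R: "fst ` set ?R = S" "map fst ?R = ps" using assms by (auto simp: image_image comp_def)
  have "inj_on ?\<alpha> S"
  proof (rule inj_onI)
    fix p q assume pq: "p \<in> S" "q \<in> S" "?\<alpha> p = ?\<alpha> q"
    obtain w where "w \<in> arc_set p" using arc_set_ne[OF pq(1)] by (metis ex_in_conv)
    then show "p = q" using arc_set_disjoint[OF pq(1) _ pq(2)] pq(3) by simp
  qed
  then have \<alpha>: "bij_betw ?\<alpha> S (arcs L)" by (simp add: bij_betw_def arcs_eq)
  have "inj_on ?\<beta> S" using under_point_inj by (auto intro!: inj_onI)
  then have \<beta>: "bij_betw ?\<beta> S (crossings L)" by (simp add: bij_betw_def crossings_eq)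
  have key: "u \<in> S \<and> l \<in> S \<and> r \<in> S \<and> fst l = fst r \<and> over_arc L (?\<beta> p) = ?\<alpha> u \<and>
      left_arc L (?\<beta> p) = ?\<alpha> l \<and> right_arc L (?\<beta> p) = ?\<alpha> r" if p: "(p, u, l, r) \<in> set ?R" for p u l r
  proof -
    have pS: "p \<in> S" and ulr: "relation p = (u, l, r)" using p assms(1) by auto
    have ueq: "u = over_slot p" using ulr by (simp add: relation_def)
    have "l = p \<and> r = nx p \<or> l = nx p \<and> r = p" using ulr by (auto simp: relation_def split: if_splits)
    then have "l \<in> S" "r \<in> S" "fst l = fst r" using next_slot_in[OF pS] pS by auto
    moreover have "u \<in> S" using overcrossing[OF pS] ueq by simp
    ultimately show ?thesis using underpassing_arcs[OF pS ulr] over_arc_eq[OF pS] ueq by simp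
  qed
  have rel: "\<forall>(p, u, l, r)\<in>set ?R. u \<in> S \<and> l \<in> S \<and> r \<in> S \<and> fst l = fst r \<and>
      over_arc L (?\<beta> p) = ?\<alpha> u \<and> left_arc L (?\<beta> p) = ?\<alpha> l \<and> right_arc L (?\<beta> p) = ?\<alpha> r"
  proof
    fix x assume x: "x \<in> set ?R"
    obtain p u l r where "x = (p, u, l, r)" by (rule prod_cases4)
    then show "case x of (p, u, l, r) \<Rightarrow> u \<in> S \<and> l \<in> S \<and> r \<in> S \<and> fst l = fst r \<and>
      over_arc L (?\<beta> p) = ?\<alpha> u \<and> left_arc L (?\<beta> p) = ?\<alpha> l \<and> right_arc L (?\<beta> p) = ?\<alpha> r"
      using key x by simp
  qed
  show ?thesis
    unfolding presented_by_def R
  proof (intro conjI exI)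
    show "distinct ps" by (rule assms(2))
    show "bij_betw ?\<alpha> S (arcs L)" "bij_betw ?\<beta> S (crossings L)" by (fact \<alpha> \<beta>)+
    show "\<forall>p\<in>S. fst (?\<alpha> p) = fst p" by simp
  qed (rule rel)
qed

end

section \<open>Diagrams with integral vertices\<close>

type_synonym grid_point = "int \<times> int \<times> int"

definition pt :: "grid_point \<Rightarrow> point" where
  "pt = (\<lambda>(x, y, z). (Complex (of_int x) (of_int y), of_int z))"

abbreviation pt_edge :: "grid_point \<times> grid_point \<Rightarrow> edge" where
  "pt_edge \<equiv> map_prod pt pt"

definition grid_turn :: "grid_point \<Rightarrow> grid_point \<Rightarrow> grid_point \<Rightarrow> int" where
  "grid_turn = (\<lambda>(x, y, _) (x', y', _) (x'', y'', _). (x' - x) * (y'' - y) - (y' - y) * (x'' - x))"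

definition grid_separated :: "grid_point \<times> grid_point \<Rightarrow> grid_point \<times> grid_point \<Rightarrow> bool" where
  "grid_separated = (\<lambda>(p, q) (r, s).
     0 < grid_turn p q r * grid_turn p q s \<or> 0 < grid_turn r s p * grid_turn r s q)"

definition grid_successive :: "grid_point \<times> grid_point \<Rightarrow> grid_point \<times> grid_point \<Rightarrow> bool" where
  "grid_successive = (\<lambda>(p, q) (r, s). q = r \<and> grid_turn p q s \<noteq> 0)"

text \<open>
  With \<open>a - b\<close> the determinant of the two directions, so that \<open>c - d = b - a\<close>, the parameters of the crossing
  on the two edges are \<open>a / (a - b)\<close> and \<open>- c / (a - b)\<close>. The last inequality compares the two heights after
  multiplication with \<open>(a - b)\<^sup>2\<close>.
\<close>

definition grid_over :: "grid_point \<times> grid_point \<Rightarrow> grid_point \<times> grid_point \<Rightarrow> bool" where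
  "grid_over = (\<lambda>(p, q) (r, s).
     let a = grid_turn r s p; b = grid_turn r s q; c = grid_turn p q r; d = grid_turn p q s;
       z = \<lambda>v. snd (snd v)
     in c * d < 0 \<and> a * b < 0 \<and>
       0 < (a - b) * ((z p - z r) * (a - b) + a * (z q - z p) + c * (z s - z r)))"

definition grid_link :: "grid_point list list list \<Rightarrow> plink" where
  "grid_link D = map (\<lambda>K. map pt (concat K)) D"

definition slot_list :: "'a list list list \<Rightarrow> slot list" where
  "slot_list D = [(i, k). i \<leftarrow> [0..<length D], k \<leftarrow> [0..<length (D ! i)]]"

definition inner_edges :: "'a list list list \<Rightarrow> (slot \<times> 'a \<times> 'a) list" where
  "inner_edges D = [(p, e). p \<leftarrow> slot_list D, e \<leftarrow> zip (block D p) (tl (block D p))]"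

definition overpasses :: "grid_point list list list \<Rightarrow> slot \<Rightarrow> (slot \<times> grid_point \<times> grid_point) list" where
  "overpasses D p = filter (\<lambda>(_, e). grid_over e (joint D p)) (inner_edges D)"

text \<open>
  The joints \<open>J\<close> and the edges \<open>In\<close> inside arcs are all the edges. The clauses state that no edge is
  vertical, that any two edges are in general position, that only joints have undercrossings, and that these
  come from a single edge inside an arc.
\<close>

definition valid_diagram :: "grid_point list list list \<Rightarrow> bool" where
  "valid_diagram D \<longleftrightarrow> D \<noteq> [] \<and>
     list_all (\<lambda>K. K \<noteq> [] \<and> list_all (\<lambda>b. b \<noteq> []) K \<and> 3 \<le> length (concat K)) D \<and>
     distinct (concat (map concat D)) \<and>
     (let In = map snd (inner_edges D); J = map (joint D) (slot_list D); E = In @ J in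
       list_all (\<lambda>((x, y, _), (x', y', _)). x \<noteq> x' \<or> y \<noteq> y') E \<and>
       list_all (\<lambda>e. list_all (\<lambda>f. e = f \<or> grid_successive e f \<or> grid_successive f e \<or>
         grid_separated e f \<or> grid_over e f \<or> grid_over f e) E) E \<and>
       list_all (\<lambda>f. list_all (\<lambda>e. \<not> grid_over e f) E) In \<and>
       list_all (\<lambda>f. list_all (\<lambda>e. \<not> grid_over e f) J) J) \<and>
     list_all (\<lambda>p. length (overpasses D p) = 1) (slot_list D)"

definition grid_relation :: "grid_point list list list \<Rightarrow> slot \<Rightarrow> slot \<times> slot \<times> slot" where
  "grid_relation D p = (case hd (overpasses D p) of (u, e) \<Rightarrow>
     (u, if 0 < grid_turn (fst e) (snd e) (snd (joint D p)) then (next_slot D p, p) else (p, next_slot D p)))"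

definition crossing_table :: "grid_point list list list \<Rightarrow> (slot \<times> slot \<times> slot \<times> slot) list" where
  "crossing_table D = map (\<lambda>p. (p, grid_relation D p)) (slot_list D)"

lemma turn_pt: "turn (pt p) (pt q) (pt r) = of_int (grid_turn p q r)"
  by (simp add: turn_eq grid_turn_def pt_def split: prod.splits)

lemma inj_pt: "inj pt"
  by (rule injI) (auto simp: pt_def split: prod.splits)

lemma separated_pt: "separated (pt_edge e) (pt_edge f) = grid_separated e f"
  by (cases e; cases f)
    (simp add: separated_def grid_separated_def turn_pt flip: of_int_mult)

lemma successive_pt: "successive (pt_edge e) (pt_edge f) = grid_successive e f"
  by (cases e; cases f) (simp add: successive_def grid_successive_def turn_pt inj_eq[OF inj_pt])

lemma transverse_pt:
  "transverse (pt_edge (p, q)) (pt_edge (r, s)) \<longleftrightarrow>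
   grid_turn p q r * grid_turn p q s < 0 \<and> grid_turn r s p * grid_turn r s q < 0"
  by (simp add: transverse_def turn_pt flip: of_int_mult)

lemma passes_over_pt: "passes_over (pt_edge e) (pt_edge f) = grid_over e f"
proof -
  obtain p q r s where ef: "e = (p, q)" "f = (r, s)" by (cases e, cases f)
  define z where "z v = snd (snd (v :: grid_point))" for v
  define a b c d where abcd: "a = grid_turn r s p" "b = grid_turn r s q" "c = grid_turn p q r" "d = grid_turn p q s"
  have z: "snd (pt v) = of_int (z v)" for v by (simp add: pt_def z_def split: prod.splits)
  have "snd (cut (pt_edge f) (pt_edge e)) < snd (cut (pt_edge e) (pt_edge f)) \<longleftrightarrow>
      0 < (a - b) * ((z p - z r) * (a - b) + a * (z q - z p) + c * (z s - z r))" if "a * b < 0" "c * d < 0"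
  proof -
    have "c - d = - (a - b)"
      by (simp add: abcd grid_turn_def algebra_simps split: prod.splits)
    then have cd: "real_of_int c - real_of_int d = - (real_of_int a - real_of_int b)" by linarith
    have ab: "real_of_int a - real_of_int b \<noteq> 0" using that(1) by (auto simp: mult_less_0_iff)
    let ?m = "real_of_int a - real_of_int b"
    have lerp: "(1 - t / m) * x + t * y / m = x + t * (y - x) / m" for t m x y :: real
      by (simp add: algebra_simps diff_divide_distrib)
    have e: "snd (cut (pt_edge e) (pt_edge f)) = z p + a / ?m * (z q - z p)"
      by (simp add: ef cut_def Let_def turn_pt z abcd lerp)
    have "snd (cut (pt_edge f) (pt_edge e)) = z r + c / (real_of_int c - real_of_int d) * (z s - z r)"
      by (simp add: ef cut_def Let_def turn_pt z abcd lerp)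
    then have f: "snd (cut (pt_edge f) (pt_edge e)) = z r - c / ?m * (z s - z r)"
      unfolding cd divide_minus_right by simp
    define h where "h = snd (cut (pt_edge e) (pt_edge f)) - snd (cut (pt_edge f) (pt_edge e))"
    have "(x + \<alpha> / m * y - (x' - \<gamma> / m * y')) * m = (x - x') * m + \<alpha> * y + \<gamma> * y'"
      if "m \<noteq> 0" for x \<alpha> m y x' \<gamma> y' :: real
      using that by (simp add: field_simps)
    from this[OF ab] have "h * ?m = real_of_int ((z p - z r) * (a - b) + a * (z q - z p) + c * (z s - z r))"
      unfolding h_def e f by simp
    then have "h * ?m * ?m = real_of_int ((a - b) * ((z p - z r) * (a - b) + a * (z q - z p) + c * (z s - z r)))"
      by simp
    moreover have "0 < h \<longleftrightarrow> 0 < h * ?m * ?m"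
    proof -
      have "0 < ?m\<^sup>2" using ab by simp
      then have "0 < h \<longleftrightarrow> 0 < h * ?m\<^sup>2" by (auto simp: zero_less_mult_iff)
      then show ?thesis by (simp only: power2_eq_square mult.assoc)
    qed
    ultimately have "0 < h \<longleftrightarrow> 0 < (a - b) * ((z p - z r) * (a - b) + a * (z q - z p) + c * (z s - z r))"
      by (simp only: of_int_0_less_iff)
    then show ?thesis by (simp add: h_def)
  qed
  then show ?thesis
    unfolding passes_over_def using transverse_pt[of p q r s]
    by (auto simp: ef grid_over_def Let_def abcd z_def)
qed

lemma steps_map: "steps (map f xs) = map_prod f f ` steps xs"
  by (induction xs rule: induct_list012) auto

lemma slots_map: "slots (map (map (map f)) D) = slots D"
  by (auto simp: slots_def)

lemma block_map: "p \<in> slots D \<Longrightarrow> block (map (map (map f)) D) p = map f (block D p)"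
  by (auto simp: slots_def block_def)

lemma next_slot_map: "p \<in> slots D \<Longrightarrow> next_slot (map (map (map f)) D) p = next_slot D p"
  by (auto simp: slots_def next_slot_def)

lemma joint_map:
  assumes "p \<in> slots D" "block D p \<noteq> []" "block D (next_slot D p) \<noteq> []"
  shows "joint (map (map (map f)) D) p = map_prod f f (joint D p)"
  using assms next_slot_in[OF assms(1)]
  by (simp add: joint_def block_map next_slot_map last_map hd_map)

lemma set_slot_list: "set (slot_list D) = slots D"
  by (auto simp: slot_list_def slots_def)

lemma distinct_slot_list: "distinct (slot_list D)"
proof -
  have "distinct (concat (map (\<lambda>i. map (Pair i) [0..<n i]) [0..<m]))" for n :: "nat \<Rightarrow> nat" and m
  proof (induction m)
    case (Suc m)
    have "(\<Union>i<m. Pair i ` {0..<n i}) \<inter> Pair m ` {0..<n m} = {}" by blast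
    then show ?case using Suc by (simp add: distinct_map inj_on_def lessThan_atLeast0)
  qed simp
  then show ?thesis by (simp add: slot_list_def)
qed

lemma set_inner_edges: "set (inner_edges D) = {(p, e). p \<in> slots D \<and> e \<in> steps (block D p)}"
  by (auto simp: inner_edges_def set_slot_list steps_def)

text \<open>
  All predicates on real edges are integer predicates on their endpoints, so the assumptions of the
  locale can be read off the integer data.
\<close>

theorem valid_diagram_sound:
  assumes "valid_diagram D"
  shows "classical_link (grid_link D)" "presented_by (grid_link D) (crossing_table D)"
proof -
  let ?D = "map (map (map pt)) D"
  let ?o = "\<lambda>p. fst (hd (overpasses D p))" and ?e = "\<lambda>p. pt_edge (snd (hd (overpasses D p)))"
  define In where "In = snd ` set (inner_edges D)"
  define J where "J = joint D ` slots D"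
  note v = assms[unfolded valid_diagram_def Let_def list_all_iff set_append set_map set_slot_list,
      folded In_def J_def]
  note vK = v[THEN conjunct2, THEN conjunct1]
    and vE = v[THEN conjunct2, THEN conjunct2, THEN conjunct2, THEN conjunct1]
    and vo = v[THEN conjunct2, THEN conjunct2, THEN conjunct2, THEN conjunct2]
  note vertical = vE[THEN conjunct1] and pair = vE[THEN conjunct2, THEN conjunct1]
    and over_inner = vE[THEN conjunct2, THEN conjunct2, THEN conjunct1]
    and over_joint = vE[THEN conjunct2, THEN conjunct2, THEN conjunct2]
  have K: "K \<noteq> [] \<and> [] \<notin> set K \<and> 3 \<le> length (concat K)" if "K \<in> set D" for K
    using bspec[OF vK that] by auto
  have ne: "block D p \<noteq> []" if "p \<in> slots D" for p
  proof -
    have "block D p \<in> set (D ! fst p)" "D ! fst p \<in> set D" using that by (auto simp: slots_def block_def)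
    then show ?thesis using K by metis
  qed
  have jt: "joint ?D p = pt_edge (joint D p)" if "p \<in> slots D" for p
    using joint_map[OF that] ne that next_slot_in by blast
  have InJ: "In = (\<Union>p\<in>slots D. steps (block D p))"
    by (force simp: In_def set_inner_edges)
  have "link_edges (map concat ?D) = (\<Union>p\<in>slots ?D. insert (joint ?D p) (steps (block ?D p)))"
  proof (rule link_edges_of_blocks)
    fix C assume "C \<in> set ?D"
    then obtain K where "K \<in> set D" "C = map (map pt) K" by auto
    then show "C \<noteq> [] \<and> [] \<notin> set C" using K[of K] by auto
  qed
  also have "\<dots> = (\<Union>p\<in>slots D. insert (pt_edge (joint D p)) (pt_edge ` steps (block D p)))"
    by (simp add: slots_map jt block_map steps_map)
  also have "\<dots> = pt_edge ` (In \<union> J)"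
    unfolding InJ J_def image_Un image_UN image_image by blast
  finally have E: "link_edges (map concat ?D) = pt_edge ` (In \<union> J)" .
  have ov: "hd (overpasses D p) \<in> set (overpasses D p)"
      "\<And>x. x \<in> set (overpasses D p) \<Longrightarrow> x = hd (overpasses D p)" if "p \<in> slots D" for p
  proof -
    have "length (overpasses D p) = 1" using vo that by (rule bspec)
    then have "\<exists>y. overpasses D p = [y]" by (cases "overpasses D p") auto
    then show "hd (overpasses D p) \<in> set (overpasses D p)"
      "\<And>x. x \<in> set (overpasses D p) \<Longrightarrow> x = hd (overpasses D p)" by auto
  qed
  interpret arc_diagram ?D ?o ?e
  proof
    show "?D \<noteq> []" using v by simp
    show "C \<noteq> [] \<and> [] \<notin> set C \<and> 3 \<le> length (concat C)" if "C \<in> set ?D" for C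
    proof -
      have "C \<in> map (map pt) ` set D" using that by simp
      then obtain K0 where "C = map (map pt) K0" "K0 \<in> set D" by (rule imageE)
      then show ?thesis using K[of K0] by (auto simp flip: map_concat)
    qed
    have "concat (map concat ?D) = map pt (concat (map concat D))"
      by (simp add: map_concat comp_def)
    then show "distinct (concat (map concat ?D))"
      using v inj_on_subset[OF inj_pt subset_UNIV] by (simp only: distinct_map)
    show "fst (fst e) \<noteq> fst (snd e)" if "e \<in> link_edges (map concat ?D)" for e
    proof -
      from that[unfolded E] obtain e' where e': "e = pt_edge e'" "e' \<in> In \<union> J" by (rule imageE)
      obtain x y h x' y' h' where c: "e' = ((x, y, h), (x', y', h'))" by (metis prod.collapse)
      from bspec[OF vertical e'(2)] show ?thesis by (simp add: e'(1) c pt_def)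
    qed
    show "successive e f \<or> successive f e \<or> separated e f \<or> passes_over e f \<or> passes_over f e"
      if ef: "e \<in> link_edges (map concat ?D)" "f \<in> link_edges (map concat ?D)" "e \<noteq> f" for e f
    proof -
      from ef(1)[unfolded E] obtain e' where e': "e = pt_edge e'" "e' \<in> In \<union> J" by (rule imageE)
      from ef(2)[unfolded E] obtain f' where f': "f = pt_edge f'" "f' \<in> In \<union> J" by (rule imageE)
      have "e' = f' \<or> grid_successive e' f' \<or> grid_successive f' e' \<or>
         grid_separated e' f' \<or> grid_over e' f' \<or> grid_over f' e'" using pair e'(2) f'(2) by blast
      then show ?thesis using e'(1) f'(1) ef(3) by (auto simp: separated_pt successive_pt passes_over_pt)
    qed
    show "\<exists>p\<in>slots ?D. f = joint ?D p \<and> e = ?e p"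
      if ef: "e \<in> link_edges (map concat ?D)" "f \<in> link_edges (map concat ?D)" "passes_over e f" for e f
    proof -
      from ef(1)[unfolded E] obtain e' where e': "e = pt_edge e'" "e' \<in> In \<union> J" by (rule imageE)
      from ef(2)[unfolded E] obtain f' where f': "f = pt_edge f'" "f' \<in> In \<union> J" by (rule imageE)
      have go: "grid_over e' f'" using ef(3) e' f' by (simp add: passes_over_pt)
      then have "f' \<notin> In" using over_inner e'(2) by blast
      then have "f' \<in> J" using f'(2) by blast
      then have "e' \<in> In" using over_joint e'(2) go by blast
      obtain p where p: "p \<in> slots D" "f' = joint D p" using \<open>f' \<in> J\<close> J_def by blast
      obtain u where "(u, e') \<in> set (inner_edges D)" using \<open>e' \<in> In\<close> In_def by auto
      then have "(u, e') \<in> set (overpasses D p)" using go p by (simp add: overpasses_def)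
      then have "(u, e') = hd (overpasses D p)" by (rule ov(2)[OF p(1)])
      then have "e' = snd (hd (overpasses D p))" by (metis snd_conv)
      then show ?thesis using p e'(1) f'(1) jt by (auto simp: slots_map)
    qed
    show "passes_over (?e p) (joint ?D p) \<and> ?o p \<in> slots ?D \<and> ?e p \<in> steps (block ?D (?o p))"
      if "p \<in> slots ?D" for p
    proof -
      have p: "p \<in> slots D" using that slots_map by blast
      obtain u e' where ue: "hd (overpasses D p) = (u, e')" by (metis prod.collapse)
      then have "(u, e') \<in> set (overpasses D p)" using ov(1)[OF p] by simp
      then have "grid_over e' (joint D p)" "u \<in> slots D" "e' \<in> steps (block D u)"
        by (auto simp: overpasses_def set_inner_edges)
      then show ?thesis
        by (simp add: ue jt[OF p] passes_over_pt slots_map block_map steps_map)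
    qed
  qed
  have link: "map concat ?D = grid_link D" by (simp add: grid_link_def map_concat)
  show "classical_link (grid_link D)" using classical unfolding link .
  have "relation p = grid_relation D p" if "p \<in> slots D" for p
    by (simp add: relation_def grid_relation_def level_def jt that next_slot_map turn_pt case_prod_beta)
  then have "crossing_table D = map (\<lambda>p. (p, relation p)) (slot_list D)"
    by (simp add: crossing_table_def set_slot_list)
  moreover have "presented_by (map concat ?D) (map (\<lambda>p. (p, relation p)) (slot_list D))"
    by (rule presented) (simp_all add: set_slot_list slots_map distinct_slot_list)
  ultimately show "presented_by (grid_link D) (crossing_table D)" using link by simp
qed

section \<open>Laurent polynomials\<close>

lemma laurent_carrier:
  "f \<in> carrier (laurent_ring n) \<longleftrightarrow> (\<forall>e\<in>Poly_Mapping.keys f. Poly_Mapping.keys e \<subseteq> {..<n})"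
  by (simp add: laurent_ring_def)

lemma laurent_0: "0 \<in> carrier (laurent_ring n)" and laurent_1: "1 \<in> carrier (laurent_ring n)"
  by (auto simp: laurent_carrier)

lemma laurent_add:
  "f \<in> carrier (laurent_ring n) \<Longrightarrow> g \<in> carrier (laurent_ring n) \<Longrightarrow> f + g \<in> carrier (laurent_ring n)"
  unfolding laurent_carrier using Poly_Mapping.keys_add[of f g] by blast

lemma laurent_minus: "f \<in> carrier (laurent_ring n) \<Longrightarrow> - f \<in> carrier (laurent_ring n)"
  by (simp add: laurent_carrier)

lemma laurent_diff:
  "f \<in> carrier (laurent_ring n) \<Longrightarrow> g \<in> carrier (laurent_ring n) \<Longrightarrow> f - g \<in> carrier (laurent_ring n)"
  using laurent_add[of f n "- g"] laurent_minus[of g n] by simp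

lemma laurent_mult:
  assumes "f \<in> carrier (laurent_ring n)" "g \<in> carrier (laurent_ring n)"
  shows "f * g \<in> carrier (laurent_ring n)"
  unfolding laurent_carrier
proof
  fix e assume "e \<in> Poly_Mapping.keys (f * g)"
  then obtain a b where "e = a + b" "a \<in> Poly_Mapping.keys f" "b \<in> Poly_Mapping.keys g"
    using keys_mult[of f g] by blast
  then show "Poly_Mapping.keys e \<subseteq> {..<n}"
    using assms Poly_Mapping.keys_add[of a b] unfolding laurent_carrier by blast
qed

lemma laurent_sum:
  "(\<And>a. a \<in> A \<Longrightarrow> f a \<in> carrier (laurent_ring n)) \<Longrightarrow> sum f A \<in> carrier (laurent_ring n)"
  by (induction A rule: infinite_finite_induct) (auto intro: laurent_0 laurent_add)

definition tinv :: "nat \<Rightarrow> laurent" where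
  "tinv i = Poly_Mapping.single (Poly_Mapping.single i (- 1)) 1"

lemma tvar_carrier: "i < n \<Longrightarrow> tvar i \<in> carrier (laurent_ring n)"
  and tinv_carrier: "i < n \<Longrightarrow> tinv i \<in> carrier (laurent_ring n)"
  by (auto simp: laurent_carrier tvar_def tinv_def)

lemma tvar_tinv: "tvar i * tinv i = 1"
  by (simp add: tvar_def tinv_def mult_single flip: single_add)

lemmas laurent_intros = laurent_0 laurent_1 laurent_add laurent_minus laurent_diff laurent_mult
  tvar_carrier tinv_carrier

text \<open>
  The value at \<open>t\<^sub>i = -1\<close> for \<open>i \<in> A\<close> and \<open>t\<^sub>i = 1\<close> otherwise of the monomial with exponent vector \<open>e\<close>.
\<close>

definition sign_character :: "nat set \<Rightarrow> (nat \<Rightarrow>\<^sub>0 int) \<Rightarrow> int" where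
  "sign_character A e = (if even (\<Sum>i\<in>A. Poly_Mapping.lookup e i) then 1 else - 1)"

definition eval_signs :: "nat set \<Rightarrow> laurent \<Rightarrow> int" where
  "eval_signs A f = (\<Sum>e\<in>Poly_Mapping.keys f. Poly_Mapping.lookup f e * sign_character A e)"

lemma sign_character_add: "sign_character A (d + e) = sign_character A d * sign_character A e"
  by (auto simp: sign_character_def lookup_add sum.distrib)

lemma eval_signs_add: "eval_signs A (f + g) = eval_signs A f + eval_signs A g"
  unfolding eval_signs_def by (rule setsum_keys_plus_distrib) (simp_all add: distrib_right)

lemma eval_signs_0: "eval_signs A 0 = 0"
  by (simp add: eval_signs_def)

lemma eval_signs_minus: "eval_signs A (- f) = - eval_signs A f"
  using eval_signs_add[of A f "- f"] by (simp add: eval_signs_0)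

lemma eval_signs_diff: "eval_signs A (f - g) = eval_signs A f - eval_signs A g"
  using eval_signs_add[of A f "- g"] by (simp add: eval_signs_minus)

lemma eval_signs_single: "eval_signs A (frag_of e) = sign_character A e"
  by (simp add: eval_signs_def)

lemma frag_of_mult: "frag_of d * frag_of e = (frag_of (d + e) :: laurent)"
  by (simp add: mult_single)

text \<open>
  Both sides are additive in each factor, so it suffices to compare them on monomials, where
  the claim is multiplicativity of the character.
\<close>

lemma eval_signs_mult: "eval_signs A (f * g) = eval_signs A f * eval_signs A g"
proof -
  have 1: "eval_signs A (frag_of d * g) = eval_signs A (frag_of d) * eval_signs A g" for d
    by (rule frag_induction[where S = UNIV and c = g])
      (simp_all add: eval_signs_0 eval_signs_single frag_of_mult sign_character_add eval_signs_diff right_diff_distrib)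
  show ?thesis
    by (rule frag_induction[where S = UNIV and c = f])
      (simp_all add: eval_signs_0 1 eval_signs_diff left_diff_distrib)
qed

lemma eval_signs_1: "eval_signs A 1 = 1"
proof -
  have "(1 :: laurent) = frag_of 0" by simp
  then have "eval_signs A 1 = eval_signs A (frag_of 0)" by (rule arg_cong)
  then show ?thesis by (simp only: eval_signs_single) (simp add: sign_character_def)
qed

lemma eval_signs_sum: "eval_signs A (sum f B) = (\<Sum>b\<in>B. eval_signs A (f b))"
  by (induction B rule: infinite_finite_induct) (simp_all add: eval_signs_0 eval_signs_add)

lemma eval_signs_tvar: 
  assumes "finite A"
  shows "eval_signs A (tvar i) = (if i \<in> A then - 1 else 1)"
proof -
  have "tvar i = frag_of (Poly_Mapping.single i 1)" by (simp add: tvar_def)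
  moreover have "(\<Sum>j\<in>A. Poly_Mapping.lookup (Poly_Mapping.single i (1::int)) j) = (if i \<in> A then 1 else 0)"
    using assms by (simp add: lookup_single when_def)
  ultimately show ?thesis by (simp add: eval_signs_single sign_character_def)
qed

section \<open>Quotients of free modules\<close>

definition submodule_of :: "laurent set \<Rightarrow> 'x set \<Rightarrow> ('x \<Rightarrow> laurent) set \<Rightarrow> bool" where
  "submodule_of C X N \<longleftrightarrow> (\<lambda>_. 0) \<in> N \<and> (\<forall>f\<in>N. \<forall>g\<in>N. (\<lambda>x. f x + g x) \<in> N) \<and>
     (\<forall>r\<in>C. \<forall>f\<in>N. (\<lambda>x. r * f x) \<in> N) \<and>
     N \<subseteq> {f. (\<forall>x\<in>X. f x \<in> C) \<and> (\<forall>x. x \<notin> X \<longrightarrow> f x = 0)}"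

definition coset :: "('x \<Rightarrow> laurent) set \<Rightarrow> ('x \<Rightarrow> laurent) \<Rightarrow> ('x \<Rightarrow> laurent) set" where
  "coset N f = (\<lambda>h x. h x + f x) ` N"

lemma free_module_simps:
  "carrier (free_module R X) = {f. (\<forall>x\<in>X. f x \<in> carrier R) \<and> (\<forall>x. x \<notin> X \<longrightarrow> f x = 0)}"
  "f \<oplus>\<^bsub>free_module R X\<^esub> g = (\<lambda>x. f x + g x)" "r \<odot>\<^bsub>free_module R X\<^esub> f = (\<lambda>x. r * f x)"
  by (simp_all add: free_module_def)

lemma coset_eq: "N +>\<^bsub>free_module R X\<^esub> f = coset N f"
  by (auto simp: a_r_coset_def' coset_def free_module_simps)

lemma quotient_carrier:
  "carrier (quotient_module (free_module R X) N) = coset N ` carrier (free_module R X)"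
  by (auto simp: quotient_module_def A_RCOSETS_def' coset_eq)

lemma quotient_add:
  "Y \<oplus>\<^bsub>quotient_module (free_module R X) N\<^esub> Z = (\<Union>f\<in>Y. \<Union>g\<in>Z. {\<lambda>x. f x + g x})"
  by (simp add: quotient_module_def set_add_def' free_module_simps)

lemma quotient_smult:
  "r \<odot>\<^bsub>quotient_module (free_module R X) N\<^esub> Y = (\<Union>f\<in>Y. coset N (\<lambda>x. r * f x))"
  by (simp add: quotient_module_def coset_eq free_module_simps)

locale quotient =
  fixes n :: nat and X :: "'x set" and N :: "('x \<Rightarrow> laurent) set"
  assumes N: "submodule_of (carrier (laurent_ring n)) X N"
begin

abbreviation "R \<equiv> laurent_ring n"
abbreviation "F \<equiv> carrier (free_module R X)"
abbreviation "M \<equiv> quotient_module (free_module R X) N"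

lemma N_0: "(\<lambda>_. 0) \<in> N" and N_add: "f \<in> N \<Longrightarrow> g \<in> N \<Longrightarrow> (\<lambda>x. f x + g x) \<in> N"
  and N_smult: "r \<in> carrier R \<Longrightarrow> f \<in> N \<Longrightarrow> (\<lambda>x. r * f x) \<in> N"
  and N_free: "f \<in> N \<Longrightarrow> f \<in> F"
  using N by (auto simp: submodule_of_def free_module_simps)

lemma N_minus: "f \<in> N \<Longrightarrow> (\<lambda>x. - f x) \<in> N"
  using N_smult[of "- 1" f] by (simp add: laurent_intros)

lemma N_diff: "f \<in> N \<Longrightarrow> g \<in> N \<Longrightarrow> (\<lambda>x. f x - g x) \<in> N"
  using N_add[OF _ N_minus, of f g] by simp

lemma N_sum: "(\<And>a. a \<in> A \<Longrightarrow> f a \<in> N) \<Longrightarrow> (\<lambda>x. \<Sum>a\<in>A. f a x) \<in> N"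
  by (induction A rule: infinite_finite_induct) (auto intro: N_0 N_add)

lemma F_0: "(\<lambda>_. 0) \<in> F" and F_add: "f \<in> F \<Longrightarrow> g \<in> F \<Longrightarrow> (\<lambda>x. f x + g x) \<in> F"
  and F_smult: "r \<in> carrier R \<Longrightarrow> f \<in> F \<Longrightarrow> (\<lambda>x. r * f x) \<in> F"
  by (auto simp: free_module_simps intro: laurent_intros)

lemma F_basis: "a \<in> X \<Longrightarrow> basis_elt a \<in> F"
  by (auto simp: free_module_simps basis_elt_def intro: laurent_intros)

lemma mem_coset: "g \<in> coset N f \<longleftrightarrow> (\<lambda>x. g x - f x) \<in> N"
proof
  assume "(\<lambda>x. g x - f x) \<in> N"
  then show "g \<in> coset N f"
    unfolding coset_def by (intro image_eqI[of _ _ "\<lambda>x. g x - f x"]) auto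
qed (auto simp: coset_def)

lemma coset_self: "f \<in> coset N f"
  using N_0 by (simp add: mem_coset)

lemma coset_eqI:
  assumes "(\<lambda>x. g x - f x) \<in> N"
  shows "coset N g = coset N f"
proof -
  have "(\<lambda>x. h x - g x) \<in> N \<longleftrightarrow> (\<lambda>x. h x - f x) \<in> N" for h
    using N_add[OF _ assms, of "\<lambda>x. h x - g x"] N_diff[OF _ assms, of "\<lambda>x. h x - f x"] by auto
  then show ?thesis by (auto simp: mem_coset set_eq_iff)
qed

lemma coset_eq_iff: "coset N g = coset N f \<longleftrightarrow> (\<lambda>x. g x - f x) \<in> N"
  using coset_eqI coset_self mem_coset by metis

lemma coset_add: "coset N f \<oplus>\<^bsub>M\<^esub> coset N g = coset N (\<lambda>x. f x + g x)"
proof -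
  have "(\<lambda>x. f' x + g' x) \<in> coset N (\<lambda>x. f x + g x)" if "f' \<in> coset N f" "g' \<in> coset N g" for f' g'
    using N_add[of "\<lambda>x. f' x - f x" "\<lambda>x. g' x - g x"] that by (simp add: mem_coset algebra_simps)
  moreover have "\<exists>f'\<in>coset N f. \<exists>g'\<in>coset N g. h = (\<lambda>x. f' x + g' x)" if "h \<in> coset N (\<lambda>x. f x + g x)" for h
    using that coset_self[of g] by (intro bexI[of _ "\<lambda>x. h x - g x"] bexI[of _ g]) (auto simp: mem_coset algebra_simps)
  ultimately show ?thesis unfolding quotient_add by auto
qed

lemma coset_smult:
  assumes "r \<in> carrier R"
  shows "r \<odot>\<^bsub>M\<^esub> coset N f = coset N (\<lambda>x. r * f x)"
proof -
  have "coset N (\<lambda>x. r * g x) = coset N (\<lambda>x. r * f x)" if "g \<in> coset N f" for g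
    using N_smult[OF assms, of "\<lambda>x. g x - f x"] that by (intro coset_eqI) (simp add: mem_coset algebra_simps)
  then show ?thesis unfolding quotient_smult using coset_self[of f] by (intro SUP_eq_const) blast+
qed

lemma M_carrier: "carrier M = coset N ` F"
  by (rule quotient_carrier)

end

definition linear_extension :: "'x set \<Rightarrow> ('x \<Rightarrow> 'y \<Rightarrow> laurent) \<Rightarrow> ('x \<Rightarrow> laurent) \<Rightarrow> 'y \<Rightarrow> laurent" where
  "linear_extension X m f = (\<lambda>y. \<Sum>x\<in>X. f x * m x y)"

lemma linear_extension_add: "linear_extension X m (\<lambda>x. f x + g x) = (\<lambda>y. linear_extension X m f y + linear_extension X m g y)"
  and linear_extension_diff: "linear_extension X m (\<lambda>x. f x - g x) = (\<lambda>y. linear_extension X m f y - linear_extension X m g y)"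
  and linear_extension_smult: "linear_extension X m (\<lambda>x. r * f x) = (\<lambda>y. r * linear_extension X m f y)"
  by (simp_all add: linear_extension_def distrib_right left_diff_distrib sum.distrib sum_subtractf sum_distrib_left mult.assoc)

lemma linear_extension_basis: "finite X \<Longrightarrow> a \<in> X \<Longrightarrow> linear_extension X m (basis_elt a) = m a"
  by (rule ext) (simp add: linear_extension_def basis_elt_def if_distrib[of "\<lambda>c. c * _"] cong: if_cong)

lemma linear_extension_free:
  assumes "\<And>a. a \<in> X \<Longrightarrow> m a \<in> carrier (free_module (laurent_ring n) Y)"
    and "f \<in> carrier (free_module (laurent_ring n) X)"
  shows "linear_extension X m f \<in> carrier (free_module (laurent_ring n) Y)"
  using assms by (auto simp: free_module_simps linear_extension_def intro!: laurent_sum laurent_mult)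

lemma linear_extension_compose:
  "linear_extension X m (linear_extension Y k h) = linear_extension Y (\<lambda>c. linear_extension X m (k c)) h"
proof
  fix y
  show "linear_extension X m (linear_extension Y k h) y = linear_extension Y (\<lambda>c. linear_extension X m (k c)) h y"
    unfolding linear_extension_def sum_distrib_left sum_distrib_right mult.assoc by (rule sum.swap)
qed

lemma (in quotient) round_trip:
  assumes "finite X" "\<And>a. a \<in> X \<Longrightarrow> (\<lambda>x. linear_extension Y m' (m a) x - basis_elt a x) \<in> N" "f \<in> F"
  shows "(\<lambda>x. linear_extension Y m' (linear_extension X m f) x - f x) \<in> N"
proof -
  have "(\<lambda>x. \<Sum>a\<in>X. f a * (linear_extension Y m' (m a) x - basis_elt a x)) \<in> N"
    using assms by (intro N_sum N_smult) (auto simp: free_module_simps)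
  moreover have "(\<Sum>a\<in>X. f a * (linear_extension Y m' (m a) x - basis_elt a x))
      = linear_extension Y m' (linear_extension X m f) x - f x" for x
  proof -
    have "(\<Sum>a\<in>X. f a * basis_elt a x) = f x"
      using assms(1,3) by (auto simp: basis_elt_def free_module_simps if_distrib[of "\<lambda>c. _ * c"] cong: if_cong)
    then show ?thesis
      unfolding linear_extension_compose by (simp add: linear_extension_def[of X] right_diff_distrib sum_subtractf)
  qed
  ultimately show ?thesis by simp
qed

text \<open>
  Respecting the relation submodules makes the maps well defined on cosets. The composites need to be
  controlled on the basis only, since their deviation from the identity is linear.
\<close>

lemma quotient_iso:
  fixes X :: "'x set" and Y :: "'y set"
  assumes fin: "finite X" "finite Y"
    and N: "submodule_of (carrier (laurent_ring n)) X N"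
    and N': "submodule_of (carrier (laurent_ring n)) Y N'"
    and m: "\<And>a. a \<in> X \<Longrightarrow> m a \<in> carrier (free_module (laurent_ring n) Y)"
    and m': "\<And>b. b \<in> Y \<Longrightarrow> m' b \<in> carrier (free_module (laurent_ring n) X)"
    and mN: "\<And>f. f \<in> N \<Longrightarrow> linear_extension X m f \<in> N'"
    and mN': "\<And>f. f \<in> N' \<Longrightarrow> linear_extension Y m' f \<in> N"
    and inv: "\<And>a. a \<in> X \<Longrightarrow> (\<lambda>x. linear_extension Y m' (m a) x - basis_elt a x) \<in> N"
    and inv': "\<And>b. b \<in> Y \<Longrightarrow> (\<lambda>y. linear_extension X m (m' b) y - basis_elt b y) \<in> N'"
  defines "g \<equiv> \<lambda>Z. \<Union>f\<in>Z. coset N' (linear_extension X m f)"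
  shows "g \<in> linear_iso (laurent_ring n) (quotient_module (free_module (laurent_ring n) X) N)
       (quotient_module (free_module (laurent_ring n) Y) N')"
    and "f \<in> carrier (free_module (laurent_ring n) X) \<Longrightarrow> g (coset N f) = coset N' (linear_extension X m f)"
proof -
  interpret A: quotient n X N by unfold_locales (rule N)
  interpret B: quotient n Y N' by unfold_locales (rule N')
  have g: "g (coset N f) = coset N' (linear_extension X m f)" for f
  proof -
    have "coset N' (linear_extension X m h) = coset N' (linear_extension X m f)" if "h \<in> coset N f" for h
      using mN[of "\<lambda>x. h x - f x"] that by (intro B.coset_eqI) (simp add: A.mem_coset linear_extension_diff)
    then show ?thesis unfolding g_def using A.coset_self[of f] by (intro SUP_eq_const) blast+
  qed
  then show "g (coset N f) = coset N' (linear_extension X m f)" .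
  have round_trip: "(\<lambda>x. linear_extension Y m' (linear_extension X m f) x - f x) \<in> N" if "f \<in> A.F" for f
    by (rule A.round_trip[OF fin(1) _ that]) (rule inv)
  have round_trip': "(\<lambda>y. linear_extension X m (linear_extension Y m' f) y - f y) \<in> N'" if "f \<in> B.F" for f
    by (rule B.round_trip[OF fin(2) _ that]) (rule inv')
  have "inj_on g (carrier A.M)"
  proof (rule inj_onI)
    fix Z Z' assume "Z \<in> carrier A.M" "Z' \<in> carrier A.M" and eq: "g Z = g Z'"
    then obtain f f' where f: "Z = coset N f" "f \<in> A.F" "Z' = coset N f'" "f' \<in> A.F"
      unfolding A.M_carrier by blast
    have "(\<lambda>y. linear_extension X m f y - linear_extension X m f' y) \<in> N'" using eq f by (simp add: g B.coset_eq_iff)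
    then have "(\<lambda>x. linear_extension Y m' (linear_extension X m f) x - linear_extension Y m' (linear_extension X m f') x) \<in> N"
      using mN' by (fastforce simp: linear_extension_diff)
    from A.N_add[OF A.N_diff[OF this round_trip[OF f(2)]] round_trip[OF f(4)]]
    have "(\<lambda>x. f x - f' x) \<in> N" by simp
    then show "Z = Z'" using f by (simp add: A.coset_eq_iff)
  qed
  moreover have "g ` carrier A.M = carrier B.M"
  proof
    have "linear_extension X m f \<in> B.F" if "f \<in> A.F" for f using m that by (rule linear_extension_free)
    then show "g ` carrier A.M \<subseteq> carrier B.M"
      unfolding A.M_carrier B.M_carrier image_image g by blast
    show "carrier B.M \<subseteq> g ` carrier A.M"
    proof
      fix Z assume "Z \<in> carrier B.M"
      then obtain f where f: "Z = coset N' f" "f \<in> B.F" unfolding B.M_carrier by blast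
      then have "Z = g (coset N (linear_extension Y m' f))"
        using round_trip'[OF f(2)] by (simp add: g B.coset_eq_iff) 
          (use B.N_minus in fastforce)
      then show "Z \<in> g ` carrier A.M"
        unfolding A.M_carrier using linear_extension_free[of Y m' n X, OF m' f(2)] by blast
    qed
  qed
  moreover have "g (Y \<oplus>\<^bsub>A.M\<^esub> Z) = g Y \<oplus>\<^bsub>B.M\<^esub> g Z" if YZ: "Y \<in> carrier A.M" "Z \<in> carrier A.M" for Y Z
  proof -
    obtain f f' where "Y = coset N f" "Z = coset N f'" using YZ unfolding A.M_carrier by blast
    then show ?thesis by (simp only: A.coset_add B.coset_add g linear_extension_add)
  qed
  moreover have "g (r \<odot>\<^bsub>A.M\<^esub> Z) = r \<odot>\<^bsub>B.M\<^esub> g Z" if "r \<in> carrier A.R" "Z \<in> carrier A.M" for r Z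
  proof -
    obtain f where "Z = coset N f" using \<open>Z \<in> carrier A.M\<close> unfolding A.M_carrier by blast
    then show ?thesis using \<open>r \<in> carrier A.R\<close> by (simp only: A.coset_smult B.coset_smult g linear_extension_smult)
  qed
  ultimately show "g \<in> linear_iso A.R A.M B.M"
    by (auto simp: linear_iso_def iso_def hom_def bij_betw_def)
qed

lemma submodule_image:
  assumes "\<And>c. c \<in> Y \<Longrightarrow> k c \<in> carrier (free_module (laurent_ring n) X)"
  shows "submodule_of (carrier (laurent_ring n)) X
    (linear_extension Y k ` carrier (free_module (laurent_ring n) Y))"
  unfolding submodule_of_def
proof (intro conjI ballI)
  let ?F = "carrier (free_module (laurent_ring n) Y)" and ?N = "linear_extension Y k ` carrier (free_module (laurent_ring n) Y)"
  have F: "(\<lambda>_. 0) \<in> ?F" "\<And>f g. f \<in> ?F \<Longrightarrow> g \<in> ?F \<Longrightarrow> (\<lambda>x. f x + g x) \<in> ?F"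
      "\<And>r f. r \<in> carrier (laurent_ring n) \<Longrightarrow> f \<in> ?F \<Longrightarrow> (\<lambda>x. r * f x) \<in> ?F"
    by (auto simp: free_module_simps intro: laurent_intros)
  show "(\<lambda>_. 0) \<in> ?N"
    using F(1) by (rule rev_image_eqI) (simp add: linear_extension_def)
  show "(\<lambda>x. f x + g x) \<in> ?N" if fg: "f \<in> ?N" "g \<in> ?N" for f g
  proof -
    obtain f' g' where "f' \<in> ?F" "g' \<in> ?F" "f = linear_extension Y k f'" "g = linear_extension Y k g'"
      using fg by blast
    moreover from this have "linear_extension Y k (\<lambda>c. f' c + g' c) \<in> ?N" using F(2) by blast
    ultimately show ?thesis by (simp add: linear_extension_add)
  qed
  show "(\<lambda>x. r * f x) \<in> ?N" if rf: "r \<in> carrier (laurent_ring n)" "f \<in> ?N" for r f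
  proof -
    obtain f' where "f' \<in> ?F" "f = linear_extension Y k f'" using rf by blast
    moreover from this have "linear_extension Y k (\<lambda>c. r * f' c) \<in> ?N" using F(3) rf(1) by blast
    ultimately show ?thesis by (simp add: linear_extension_smult)
  qed
  have "linear_extension Y k f \<in> carrier (free_module (laurent_ring n) X)" if "f \<in> ?F" for f
    using assms that by (rule linear_extension_free)
  then show "?N \<subseteq> {f. (\<forall>x\<in>X. f x \<in> carrier (laurent_ring n)) \<and> (\<forall>x. x \<notin> X \<longrightarrow> f x = 0)}"
    unfolding free_module_simps(1) by blast
qed

section \<open>Linear forms in the arcs of a presentation\<close>

type_synonym form = "(slot \<Rightarrow> laurent) \<Rightarrow> laurent"

text \<open>
  Elements of free modules are represented by linear forms in indeterminates \<open>x p\<close> attached to the slots. An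
  identity between vectors thus becomes one identity between polynomials.
\<close>

inductive_set combinations :: "laurent set \<Rightarrow> form set \<Rightarrow> form set" for C B where
  zero: "(\<lambda>_. 0) \<in> combinations C B"
| add_multiple: "\<lbrakk>r \<in> C; b \<in> B; f \<in> combinations C B\<rbrakk> \<Longrightarrow> (\<lambda>x. r * b x + f x) \<in> combinations C B"

definition coordinates :: "slot set \<Rightarrow> form set" where
  "coordinates I = (\<lambda>p x. x p) ` I"

definition relator_form :: "(nat \<Rightarrow> laurent) \<Rightarrow> slot \<times> slot \<times> slot \<Rightarrow> form" where
  "relator_form \<tau> = (\<lambda>(u, l, r) x. (1 - \<tau> (fst l)) * x u + \<tau> (fst u) * x r - x l)"

lemma relator_form_crowell:
  "fst l = fst r \<Longrightarrow> relator_form \<tau> (u, l, r) (\<lambda>p. \<tau> (fst p) - 1) = 0"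
  by (simp add: relator_form_def algebra_simps)

locale presentation =
  fixes n :: nat and \<tau> :: "nat \<Rightarrow> laurent" and L :: plink
    and R :: "(slot \<times> slot \<times> slot \<times> slot) list" and \<alpha> :: "slot \<Rightarrow> arc" and \<beta> :: "slot \<Rightarrow> crossing"
  assumes distinct: "distinct (map fst R)"
    and arc_bij: "bij_betw \<alpha> (fst ` set R) (arcs L)"
    and crossing_bij: "bij_betw \<beta> (fst ` set R) (crossings L)"
    and index: "p \<in> fst ` set R \<Longrightarrow> fst (\<alpha> p) = fst p"
    and table: "(p, u, l, r) \<in> set R \<Longrightarrow> u \<in> fst ` set R \<and> l \<in> fst ` set R \<and> r \<in> fst ` set R \<and> fst l = fst r \<and>
        over_arc L (\<beta> p) = \<alpha> u \<and> left_arc L (\<beta> p) = \<alpha> l \<and> right_arc L (\<beta> p) = \<alpha> r"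
    and \<tau>: "p \<in> fst ` set R \<Longrightarrow> \<tau> (fst p) \<in> carrier (laurent_ring n)"
begin

abbreviation "C \<equiv> carrier (laurent_ring n)"
abbreviation "I \<equiv> fst ` set R"
abbreviation "A \<equiv> arcs L"
abbreviation "N \<equiv> relation_map \<tau> L ` carrier (free_module (laurent_ring n) (crossings L))"
abbreviation "forms \<equiv> combinations C (coordinates I)"
abbreviation "relations \<equiv> combinations C (relator_form \<tau> ` snd ` set R)"

text \<open>
  The coordinate at \<open>b\<close> is obtained by substituting the indicator of \<open>b\<close> for the indeterminates.
\<close>

definition vector :: "form \<Rightarrow> arc \<Rightarrow> laurent" where
  "vector f = (\<lambda>b. f (\<lambda>p. basis_elt (\<alpha> p) b))"

definition crowell :: "(arc \<Rightarrow> laurent) \<Rightarrow> laurent" where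
  "crowell f = (\<Sum>a\<in>A. f a * (\<tau> (arc_index a) - 1))"

lemma finite_A: "finite A" and finite_crossings: "finite (crossings L)"
  using arc_bij crossing_bij bij_betw_finite by blast+

lemma arc_in: "p \<in> I \<Longrightarrow> \<alpha> p \<in> A"
  using arc_bij by (simp add: bij_betwE)

lemma arc_cases:
  assumes "a \<in> A" obtains p where "p \<in> I" "a = \<alpha> p"
  using assms arc_bij unfolding bij_betw_def by blast

lemma crossing_cases:
  assumes "c \<in> crossings L" obtains p u l r where "(p, u, l, r) \<in> set R" "c = \<beta> p"
proof -
  obtain p where "p \<in> I" "c = \<beta> p" using assms crossing_bij unfolding bij_betw_def by blast
  moreover obtain q where "q \<in> set R" "p = fst q" using \<open>p \<in> I\<close> by (rule imageE)
  ultimately show thesis using that by (metis prod.collapse)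
qed

lemma relator_vector:
  assumes "(p, u, l, r) \<in> set R"
  shows "relator \<tau> L (\<beta> p) = vector (relator_form \<tau> (u, l, r))"
  using table[OF assms] index unfolding relator_def vector_def relator_form_def by simp

lemma relator_form_in: 
  assumes "(p, u, l, r) \<in> set R"
  shows "relator_form \<tau> (u, l, r) \<in> forms"
proof -
  have I: "u \<in> I" "l \<in> I" "r \<in> I" using table[OF assms] by blast+
  then have c: "(\<lambda>x. x u) \<in> coordinates I" "(\<lambda>x. x l) \<in> coordinates I" "(\<lambda>x. x r) \<in> coordinates I"
    unfolding coordinates_def by blast+
  have "(\<lambda>x. (1 - \<tau> (fst l)) * x u + (\<tau> (fst u) * x r + (- 1 * x l + 0))) \<in> forms"
    using \<tau> I by (intro combinations.intros c laurent_intros)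
  then show ?thesis by (simp add: relator_form_def add_diff_eq)
qed

lemma vector_free: "f \<in> forms \<Longrightarrow> vector f \<in> carrier (free_module (laurent_ring n) A)"
proof (induction rule: combinations.induct)
  case zero then show ?case by (simp add: vector_def free_module_simps laurent_0)
next
  case (add_multiple r b f)
  then obtain p where "p \<in> I" "b = (\<lambda>x. x p)" unfolding coordinates_def by blast
  then show ?case using add_multiple arc_in[of p]
    by (auto simp: vector_def free_module_simps basis_elt_def intro!: laurent_intros)
qed

lemma relator_free: "c \<in> crossings L \<Longrightarrow> relator \<tau> L c \<in> carrier (free_module (laurent_ring n) A)"
  using crossing_cases relator_vector relator_form_in vector_free by metis

lemma relation_map_eq: "relation_map \<tau> L = linear_extension (crossings L) (relator \<tau> L)"
  by (intro ext) (simp add: relation_map_def linear_extension_def)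

lemma N: "submodule_of C A N"
  unfolding relation_map_eq using relator_free by (rule submodule_image)

sublocale quotient n A N
  by unfold_locales (rule N)

lemma relator_N: "c \<in> crossings L \<Longrightarrow> relator \<tau> L c \<in> N"
proof -
  assume c: "c \<in> crossings L"
  have "basis_elt c \<in> carrier (free_module (laurent_ring n) (crossings L))"
    using c by (auto simp: free_module_simps basis_elt_def intro: laurent_intros)
  moreover have "relation_map \<tau> L (basis_elt c) = relator \<tau> L c"
    unfolding relation_map_eq using finite_crossings c by (rule linear_extension_basis)
  ultimately show ?thesis by (metis imageI)
qed

lemma crossing_in: "(p, q) \<in> set R \<Longrightarrow> \<beta> p \<in> crossings L"
  using crossing_bij by (force simp: bij_betw_def)

lemma vector_relation: "f \<in> relations \<Longrightarrow> vector f \<in> N"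
proof (induction rule: combinations.induct)
  case zero then show ?case using N_0 by (simp add: vector_def)
next
  case (add_multiple r b f)
  then obtain p u l r' where p: "(p, u, l, r') \<in> set R" "b = relator_form \<tau> (u, l, r')" by auto
  then have "vector b \<in> N" using relator_N crossing_in relator_vector by metis
  then have "(\<lambda>a. r * vector b a + vector f a) \<in> N"
    using add_multiple by (intro N_add N_smult)
  then show ?case by (simp add: vector_def)
qed

lemma crowell_vector: "f \<in> forms \<Longrightarrow> crowell (vector f) = f (\<lambda>p. \<tau> (fst p) - 1)"
proof (induction rule: combinations.induct)
  case zero then show ?case by (simp add: crowell_def vector_def)
next
  case (add_multiple r b f)
  then obtain p where p: "p \<in> I" "b = (\<lambda>x. x p)" unfolding coordinates_def by blast
  have "(\<Sum>a\<in>A. basis_elt (\<alpha> p) a * (\<tau> (arc_index a) - 1)) = \<tau> (fst p) - 1"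
    using finite_A arc_in[OF p(1)] index[OF p(1)]
    by (simp add: basis_elt_def if_distrib[of "\<lambda>c. c * _"] cong: if_cong)
  then have "crowell (\<lambda>a. r * basis_elt (\<alpha> p) a + vector f a) = r * (\<tau> (fst p) - 1) + crowell (vector f)"
    by (simp add: crowell_def distrib_right sum.distrib mult.assoc flip: sum_distrib_left)
  then show ?case using add_multiple p(2) by (simp add: vector_def)
qed

lemma crowell_diff: "crowell (\<lambda>a. f a - g a) = crowell f - crowell g"
  by (simp add: crowell_def left_diff_distrib sum_subtractf)

lemma crowell_extension:
  "crowell (linear_extension X m f) = (\<Sum>x\<in>X. f x * crowell (m x))"
  unfolding crowell_def linear_extension_def sum_distrib_left sum_distrib_right mult.assoc by (rule sum.swap)

text \<open>
  On a relator the Crowell map takes the value \<open>(1 - \<tau> l) (\<tau> u - 1) + \<tau> u (\<tau> r - 1) - (\<tau> l - 1)\<close>, which is zero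
  for left and right arcs of the same component.
\<close>

lemma crowell_N:
  assumes "f \<in> N" shows "crowell f = 0"
proof -
  have zero: "crowell (relator \<tau> L c) = 0" if c: "c \<in> crossings L" for c
  proof -
    obtain p u l r where p: "(p, u, l, r) \<in> set R" "c = \<beta> p" using crossing_cases c .
    then show ?thesis
      using crowell_vector[OF relator_form_in[OF p(1)]] relator_form_crowell table[OF p(1)]
      by (simp add: relator_vector[OF p(1)])
  qed
  obtain h where "f = linear_extension (crossings L) (relator \<tau> L) h"
    using assms unfolding relation_map_eq by blast
  then show ?thesis using zero by (simp add: crowell_extension)
qed

lemma coker_map_coset: "coker_map \<tau> L (coset N f) = crowell f"
proof -
  have all: "crowell g = crowell f" if "g \<in> coset N f" for g
    using crowell_N[of "\<lambda>x. g x - f x"] that by (simp add: mem_coset crowell_diff)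
  have "crowell ` coset N f = {crowell f}"
  proof
    show "crowell ` coset N f \<subseteq> {crowell f}" using all by blast
    show "{crowell f} \<subseteq> crowell ` coset N f" using imageI[OF coset_self[of f], of crowell] by simp
  qed
  then show ?thesis by (simp add: coker_map_def crowell_def)
qed

lemma coker_eq: "coker_module (laurent_ring n) \<tau> L = M"
  by (simp add: coker_module_def)

end

lemma presented_byE:
  assumes "presented_by L R" "\<And>p. p \<in> fst ` set R \<Longrightarrow> \<tau> (fst p) \<in> carrier (laurent_ring n)"
  obtains \<alpha> \<beta> where "presentation n \<tau> L R \<alpha> \<beta>"
proof -
  obtain \<alpha> \<beta> where *: "distinct (map fst R)" "bij_betw \<alpha> (fst ` set R) (arcs L)"
      "bij_betw \<beta> (fst ` set R) (crossings L)" "\<forall>p\<in>fst ` set R. fst (\<alpha> p) = fst p"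
      "\<forall>(p, u, l, r)\<in>set R. u \<in> fst ` set R \<and> l \<in> fst ` set R \<and> r \<in> fst ` set R \<and> fst l = fst r \<and>
        over_arc L (\<beta> p) = \<alpha> u \<and> left_arc L (\<beta> p) = \<alpha> l \<and> right_arc L (\<beta> p) = \<alpha> r"
    using assms(1) unfolding presented_by_def by (elim conjE exE)
  have t: "u \<in> fst ` set R \<and> l \<in> fst ` set R \<and> r \<in> fst ` set R \<and> fst l = fst r \<and>
        over_arc L (\<beta> p) = \<alpha> u \<and> left_arc L (\<beta> p) = \<alpha> l \<and> right_arc L (\<beta> p) = \<alpha> r"
    if "(p, u, l, r) \<in> set R" for p u l r
    using bspec[OF *(5) that] by simp
  have "presentation n \<tau> L R \<alpha> \<beta>"
    by (rule presentation.intro) (rule *(1-3) bspec[OF *(4)] t assms(2); assumption)+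
  then show thesis by (rule that)
qed

text \<open>
  The map of free modules that has \<open>P\<close> as its matrix then respects the relation submodules.
\<close>

locale substitution = A: presentation n \<tau> L R \<alpha> \<beta> + B: presentation n \<tau> L' R' \<alpha>' \<beta>'
  for n \<tau> L R \<alpha> \<beta> L' R' \<alpha>' \<beta>' +
  fixes P :: "slot \<Rightarrow> form"
  assumes P_form: "p \<in> A.I \<Longrightarrow> P p \<in> B.forms"
    and P_relation: "(p, c) \<in> set R \<Longrightarrow> (\<lambda>x. relator_form \<tau> c (\<lambda>q. P q x)) \<in> B.relations"
begin

definition mat :: "arc \<Rightarrow> arc \<Rightarrow> laurent" where
  "mat a = B.vector (P (the_inv_into A.I \<alpha> a))"

lemma mat_arc: "p \<in> A.I \<Longrightarrow> mat (\<alpha> p) = B.vector (P p)"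
  using the_inv_into_f_f[of \<alpha> A.I p] A.arc_bij by (simp add: mat_def bij_betw_def)

lemma mat_free: "a \<in> A.A \<Longrightarrow> mat a \<in> B.F"
  using A.arc_cases mat_arc P_form B.vector_free by metis

lemma extension_vector:
  "f \<in> A.forms \<Longrightarrow> linear_extension A.A mat (A.vector f) = B.vector (\<lambda>x. f (\<lambda>p. P p x))"
proof (induction rule: combinations.induct)
  case zero then show ?case by (simp add: linear_extension_def A.vector_def B.vector_def)
next
  case (add_multiple r b f)
  then obtain p where p: "p \<in> A.I" "b = (\<lambda>x. x p)" unfolding coordinates_def by blast
  have 1: "A.vector (\<lambda>x. r * b x + f x) = (\<lambda>a. r * basis_elt (\<alpha> p) a + A.vector f a)"
    by (simp add: p A.vector_def)
  have "linear_extension A.A mat (basis_elt (\<alpha> p)) = B.vector (P p)"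
    using linear_extension_basis[OF A.finite_A A.arc_in[OF p(1)], of mat] mat_arc[OF p(1)] by simp
  then show ?case
    unfolding 1 linear_extension_add linear_extension_smult using add_multiple.IH
    by (simp add: B.vector_def p)
qed

lemma extension_relation: 
  assumes "f \<in> A.N" shows "linear_extension A.A mat f \<in> B.N"
proof -
  obtain h where h: "h \<in> carrier (free_module (laurent_ring n) (crossings L))"
      "f = linear_extension (crossings L) (relator \<tau> L) h"
    using assms unfolding A.relation_map_eq by blast
  have "linear_extension A.A mat (relator \<tau> L c) \<in> B.N" if c: "c \<in> crossings L" for c
  proof -
    obtain p u l r where p: "(p, u, l, r) \<in> set R" "c = \<beta> p" using A.crossing_cases c .
    then have "linear_extension A.A mat (relator \<tau> L c) = B.vector (\<lambda>x. relator_form \<tau> (u, l, r) (\<lambda>q. P q x))"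
      using A.relator_vector[OF p(1)] extension_vector[OF A.relator_form_in[OF p(1)]] by simp
    then show ?thesis using B.vector_relation[OF P_relation[OF p(1)]] by simp
  qed
  then have "(\<lambda>b. \<Sum>c\<in>crossings L. h c * linear_extension A.A mat (relator \<tau> L c) b) \<in> B.N"
    using h(1) by (intro B.N_sum B.N_smult) (auto simp: free_module_simps)
  then show ?thesis unfolding h(2) linear_extension_compose by (simp add: linear_extension_def)
qed

end

text \<open>
  A criterion that only mentions the tables. \<open>P\<close> and \<open>Q\<close> express each generator by the generators of the
  other presentation.
\<close>

theorem equivalent_presentations:
  assumes L: "presented_by L R" and L': "presented_by L' R'"
    and \<tau>: "\<And>p. p \<in> fst ` set R \<union> fst ` set R' \<Longrightarrow> \<tau> (fst p) \<in> carrier (laurent_ring n)"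
  defines "forms T \<equiv> combinations (carrier (laurent_ring n)) (coordinates (fst ` set T))"
    and "relations T \<equiv> combinations (carrier (laurent_ring n)) (relator_form \<tau> ` snd ` set T)"
  assumes P: "\<And>p. p \<in> fst ` set R \<Longrightarrow> P p \<in> forms R'"
      "\<And>p c. (p, c) \<in> set R \<Longrightarrow> (\<lambda>x. relator_form \<tau> c (\<lambda>q. P q x)) \<in> relations R'"
    and Q: "\<And>p. p \<in> fst ` set R' \<Longrightarrow> Q p \<in> forms R"
      "\<And>p c. (p, c) \<in> set R' \<Longrightarrow> (\<lambda>x. relator_form \<tau> c (\<lambda>q. Q q x)) \<in> relations R"
    and PQ: "\<And>p. p \<in> fst ` set R \<Longrightarrow> (\<lambda>x. P p (\<lambda>q. Q q x) - x p) \<in> relations R"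
    and QP: "\<And>p. p \<in> fst ` set R' \<Longrightarrow> (\<lambda>x. Q p (\<lambda>q. P q x) - x p) \<in> relations R'"
    and crowell: "\<And>p. p \<in> fst ` set R \<Longrightarrow> P p (\<lambda>q. \<tau> (fst q) - 1) = \<tau> (fst p) - 1"
  shows "\<exists>g\<in>linear_iso (laurent_ring n) (coker_module (laurent_ring n) \<tau> L) (coker_module (laurent_ring n) \<tau> L').
     \<forall>x\<in>carrier (coker_module (laurent_ring n) \<tau> L). coker_map \<tau> L x = coker_map \<tau> L' (g x)"
proof -
  obtain \<alpha> \<beta> where "presentation n \<tau> L R \<alpha> \<beta>" using L \<tau> by (rule presented_byE) auto
  then interpret A: presentation n \<tau> L R \<alpha> \<beta> .
  obtain \<alpha>' \<beta>' where "presentation n \<tau> L' R' \<alpha>' \<beta>'" using L' \<tau> by (rule presented_byE) auto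
  then interpret B: presentation n \<tau> L' R' \<alpha>' \<beta>' .
  interpret P: substitution n \<tau> L R \<alpha> \<beta> L' R' \<alpha>' \<beta>' P
    by unfold_locales (use P in \<open>auto simp: forms_def relations_def\<close>)
  interpret Q: substitution n \<tau> L' R' \<alpha>' \<beta>' L R \<alpha> \<beta> Q
    by unfold_locales (use Q in \<open>auto simp: forms_def relations_def\<close>)
  have inv: "(\<lambda>a. linear_extension B.A Q.mat (P.mat b) a - basis_elt b a) \<in> A.N" if b: "b \<in> A.A" for b
  proof -
    obtain p where p: "p \<in> A.I" "b = \<alpha> p" using A.arc_cases b .
    have "linear_extension B.A Q.mat (P.mat b) = A.vector (\<lambda>x. P p (\<lambda>q. Q q x))"
      using Q.extension_vector[OF P.P_form[OF p(1)]] P.mat_arc[OF p(1)] p(2) by simp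
    then have "(\<lambda>a. linear_extension B.A Q.mat (P.mat b) a - basis_elt b a) = A.vector (\<lambda>x. P p (\<lambda>q. Q q x) - x p)"
      by (simp add: A.vector_def p(2))
    then show ?thesis using A.vector_relation PQ[OF p(1)] by (simp add: relations_def)
  qed
  have inv': "(\<lambda>a. linear_extension A.A P.mat (Q.mat b) a - basis_elt b a) \<in> B.N" if b: "b \<in> B.A" for b
  proof -
    obtain p where p: "p \<in> B.I" "b = \<alpha>' p" using B.arc_cases b .
    have "linear_extension A.A P.mat (Q.mat b) = B.vector (\<lambda>x. Q p (\<lambda>q. P q x))"
      using P.extension_vector[OF Q.P_form[OF p(1)]] Q.mat_arc[OF p(1)] p(2) by simp
    then have "(\<lambda>a. linear_extension A.A P.mat (Q.mat b) a - basis_elt b a) = B.vector (\<lambda>x. Q p (\<lambda>q. P q x) - x p)"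
      by (simp add: B.vector_def p(2))
    then show ?thesis using B.vector_relation QP[OF p(1)] by (simp add: relations_def)
  qed
  note prems = A.finite_A B.finite_A A.N B.N P.mat_free Q.mat_free
      P.extension_relation Q.extension_relation inv inv'
  let ?g = "\<lambda>Z. \<Union>f\<in>Z. coset B.N (linear_extension A.A P.mat f)"
  have iso: "?g \<in> linear_iso A.R A.M B.M"
    by (rule quotient_iso(1)[where m' = Q.mat]) (rule prems; assumption)+
  have g: "?g (coset A.N f) = coset B.N (linear_extension A.A P.mat f)" if "f \<in> A.F" for f
    by (rule quotient_iso(2)[where m' = Q.mat]) (rule prems that; assumption)+
  have ck: "coker_map \<tau> L Z = coker_map \<tau> L' (?g Z)" if Z: "Z \<in> carrier A.M" for Z
  proof -
    obtain f where f: "f \<in> A.F" "Z = coset A.N f" using Z unfolding A.M_carrier by blast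
    have "B.crowell (P.mat a) = \<tau> (arc_index a) - 1" if a: "a \<in> A.A" for a
    proof -
      obtain p where p: "p \<in> A.I" "a = \<alpha> p" using A.arc_cases a .
      then show ?thesis
        using B.crowell_vector[OF P.P_form[OF p(1)]] crowell[OF p(1)] P.mat_arc[OF p(1)] A.index[OF p(1)] by simp
    qed
    then have "B.crowell (linear_extension A.A P.mat f) = A.crowell f"
      unfolding B.crowell_extension A.crowell_def by simp
    then show ?thesis by (simp only: f(2) g[OF f(1)] A.coker_map_coset B.coker_map_coset)
  qed
  show ?thesis unfolding A.coker_eq B.coker_eq by (rule bexI[OF ballI iso]) (rule ck)
qed

section \<open>Colourings modulo three\<close>

text \<open>
  A relation for the images of the arcs under a functional on the Alexander module with values in the integers
  modulo three, where \<open>t\<^sub>i\<close> acts as \<open>\<epsilon> i\<close>. For \<open>\<epsilon> i = -1\<close> these are the Fox three-colourings.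
\<close>

definition colouring :: "(nat \<Rightarrow> int) \<Rightarrow> (slot \<times> slot \<times> slot \<times> slot) list \<Rightarrow> (slot \<Rightarrow> int) \<Rightarrow> bool" where
  "colouring \<epsilon> R f \<longleftrightarrow> (\<forall>(p, u, l, r)\<in>set R.
     [(1 - \<epsilon> (fst l)) * f u + \<epsilon> (fst u) * f r = f l] (mod 3))"

text \<open>
  \<open>\<epsilon> (fst p) - 1\<close> is the value of the Crowell map on the arc \<open>p\<close>.
\<close>

definition rigid :: "(nat \<Rightarrow> int) \<Rightarrow> (slot \<times> slot \<times> slot \<times> slot) list \<Rightarrow> bool" where
  "rigid \<epsilon> R \<longleftrightarrow> (\<forall>f. colouring \<epsilon> R f \<longrightarrow>
     (\<exists>c. \<forall>p\<in>fst ` set R. [f p = c * (\<epsilon> (fst p) - 1)] (mod 3)))"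

definition signs :: "nat set \<Rightarrow> nat \<Rightarrow> int" where
  "signs B i = (if i \<in> B then - 1 else 1)"

lemma rigidD:
  assumes "rigid \<epsilon> R" "colouring \<epsilon> R f"
  obtains c where "\<And>p. p \<in> fst ` set R \<Longrightarrow> [f p = c * (\<epsilon> (fst p) - 1)] (mod 3)"
  using assms unfolding rigid_def by blast

lemma colouringD:
  "colouring \<epsilon> R f \<Longrightarrow> (p, u, l, r) \<in> set R \<Longrightarrow> [(1 - \<epsilon> (fst l)) * f u + \<epsilon> (fst u) * f r = f l] (mod 3)"
  unfolding colouring_def by blast

lemma colouringI:
  "(\<And>p u l r. (p, u, l, r) \<in> set R \<Longrightarrow> [(1 - \<epsilon> (fst l)) * f u + \<epsilon> (fst u) * f r = f l] (mod 3))
    \<Longrightarrow> colouring \<epsilon> R f"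
  unfolding colouring_def by blast

context presentation
begin

definition pairing :: "nat set \<Rightarrow> (arc \<Rightarrow> int) \<Rightarrow> (arc \<Rightarrow> laurent) \<Rightarrow> int" where
  "pairing B f x = (\<Sum>a\<in>A. eval_signs B (x a) * f a)"

lemma pairing_add: "pairing B f (\<lambda>a. x a + y a) = pairing B f x + pairing B f y"
  and pairing_diff: "pairing B f (\<lambda>a. x a - y a) = pairing B f x - pairing B f y"
  and pairing_smult: "pairing B f (\<lambda>a. s * x a) = eval_signs B s * pairing B f x"
  by (simp_all add: pairing_def eval_signs_add eval_signs_diff eval_signs_mult distrib_right
      left_diff_distrib sum.distrib sum_subtractf sum_distrib_left mult.assoc)

lemma pairing_basis:
  assumes "a \<in> A" shows "pairing B f (basis_elt a) = f a"
proof -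
  have "eval_signs B (basis_elt a b) * f b = (if b = a then f b else 0)" for b
    by (simp add: basis_elt_def eval_signs_0 eval_signs_1)
  then show ?thesis using finite_A assms by (simp add: pairing_def)
qed

lemma pairing_relator:
  assumes "(p, u, l, r) \<in> set R"
  shows "pairing B f (relator \<tau> L (\<beta> p)) = (1 - eval_signs B (\<tau> (fst l))) * f (\<alpha> u)
    + eval_signs B (\<tau> (fst u)) * f (\<alpha> r) - f (\<alpha> l)"
proof -
  have "relator \<tau> L (\<beta> p) = (\<lambda>a. ((1 - \<tau> (fst l)) * basis_elt (\<alpha> u) a + \<tau> (fst u) * basis_elt (\<alpha> r) a) - basis_elt (\<alpha> l) a)"
    by (simp add: relator_vector[OF assms] vector_def relator_form_def)
  moreover have "\<alpha> u \<in> A" "\<alpha> l \<in> A" "\<alpha> r \<in> A" using table[OF assms] arc_in by blast+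
  ultimately show ?thesis
    by (simp only: pairing_add pairing_diff pairing_smult pairing_basis eval_signs_diff eval_signs_1)
qed

text \<open>A colouring kills the relators, hence the relation submodule.\<close>

lemma pairing_N:
  assumes "\<And>p u l r. (p, u, l, r) \<in> set R \<Longrightarrow>
      [(1 - eval_signs B (\<tau> (fst l))) * f (\<alpha> u) + eval_signs B (\<tau> (fst u)) * f (\<alpha> r) = f (\<alpha> l)] (mod 3)"
    and "x \<in> N"
  shows "[pairing B f x = 0] (mod 3)"
proof -
  obtain h where h: "x = linear_extension (crossings L) (relator \<tau> L) h"
    using assms(2) unfolding relation_map_eq by blast
  have "pairing B f x = (\<Sum>c\<in>crossings L. eval_signs B (h c) * pairing B f (relator \<tau> L c))"
    unfolding pairing_def h linear_extension_def eval_signs_sum eval_signs_mult sum_distrib_left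
      sum_distrib_right mult.assoc by (rule sum.swap)
  moreover have "3 dvd pairing B f (relator \<tau> L c)" if c: "c \<in> crossings L" for c
  proof -
    obtain p u l r where p: "(p, u, l, r) \<in> set R" "c = \<beta> p" using crossing_cases c .
    show ?thesis
      using assms(1)[OF p(1)] unfolding p(2) pairing_relator[OF p(1)] cong_iff_dvd_diff .
  qed
  then have "3 dvd (\<Sum>c\<in>crossings L. eval_signs B (h c) * pairing B f (relator \<tau> L c))"
    by (intro dvd_sum dvd_mult)
  ultimately show ?thesis by (simp add: cong_0_iff)
qed

lemma pairing_crowell: "pairing B (\<lambda>a. eval_signs B (\<tau> (arc_index a) - 1)) x = eval_signs B (crowell x)"
  by (simp add: pairing_def crowell_def eval_signs_sum eval_signs_mult)

text \<open>
  The hypotheses hold modulo three only, because \<open>\<Psi>\<close> will be a functional on a quotient evaluated at chosen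
  representatives.
\<close>

lemma additive_pairing:
  assumes add: "\<And>x y. x \<in> F \<Longrightarrow> y \<in> F \<Longrightarrow> [\<Psi> (\<lambda>a. x a + y a) = \<Psi> x + \<Psi> y] (mod 3)"
    and smult: "\<And>s x. s \<in> C \<Longrightarrow> x \<in> F \<Longrightarrow> [\<Psi> (\<lambda>a. s * x a) = eval_signs B s * \<Psi> x] (mod 3)"
    and x: "x \<in> F"
  shows "[\<Psi> x = pairing B (\<lambda>a. \<Psi> (basis_elt a)) x] (mod 3)"
proof -
  have "(\<lambda>b. \<Sum>a\<in>T. x a * basis_elt a b) \<in> F \<and>
      [\<Psi> (\<lambda>b. \<Sum>a\<in>T. x a * basis_elt a b) = (\<Sum>a\<in>T. eval_signs B (x a) * \<Psi> (basis_elt a))] (mod 3)"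
    if "T \<subseteq> A" for T
    using finite_subset[OF that finite_A] that
  proof (induction T rule: finite_induct)
    case empty
    have "[\<Psi> (\<lambda>_. 0) = 0] (mod 3)" using smult[of 0 "\<lambda>_. 0"] F_0 by (simp add: laurent_0 eval_signs_0)
    then show ?case using F_0 by simp
  next
    case (insert a T)
    have a: "x a \<in> C" "basis_elt a \<in> F" using insert x F_basis by (auto simp: free_module_simps)
    have 1: "(\<lambda>b. x a * basis_elt a b) \<in> F" using a F_smult by blast
    have IH: "(\<lambda>b. \<Sum>a\<in>T. x a * basis_elt a b) \<in> F"
        "[\<Psi> (\<lambda>b. \<Sum>a\<in>T. x a * basis_elt a b) = (\<Sum>a\<in>T. eval_signs B (x a) * \<Psi> (basis_elt a))] (mod 3)"
      using insert by blast+
    have 2: "[\<Psi> (\<lambda>b. x a * basis_elt a b + (\<Sum>a\<in>T. x a * basis_elt a b))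
        = \<Psi> (\<lambda>b. x a * basis_elt a b) + \<Psi> (\<lambda>b. \<Sum>a\<in>T. x a * basis_elt a b)] (mod 3)"
      by (rule add[OF 1 IH(1)])
    have "[\<Psi> (\<lambda>b. x a * basis_elt a b + (\<Sum>a\<in>T. x a * basis_elt a b))
        = eval_signs B (x a) * \<Psi> (basis_elt a) + (\<Sum>a\<in>T. eval_signs B (x a) * \<Psi> (basis_elt a))] (mod 3)"
      by (rule cong_trans[OF 2 cong_add[OF smult[OF a] IH(2)]])
    then show ?case using F_add[OF 1 IH(1)] insert(1,2) by simp
  qed
  from this[of A] have "[\<Psi> (\<lambda>b. \<Sum>a\<in>A. x a * basis_elt a b) = (\<Sum>a\<in>A. eval_signs B (x a) * \<Psi> (basis_elt a))] (mod 3)"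
    by blast
  moreover have "(\<lambda>b. \<Sum>a\<in>A. x a * basis_elt a b) = x"
  proof
    fix b
    have "(\<Sum>a\<in>A. x a * basis_elt a b) = (\<Sum>a\<in>A. if b = a then x a else 0)"
      by (intro sum.cong) (auto simp: basis_elt_def)
    moreover have "x b = 0" if "b \<notin> A" using x that unfolding free_module_simps by blast
    ultimately show "(\<Sum>a\<in>A. x a * basis_elt a b) = x b" using finite_A by simp
  qed
  ultimately show ?thesis by (simp add: pairing_def)
qed

end

text \<open>
  A colouring \<open>f'\<close> of \<open>L'\<close> is pulled back along the isomorphism \<open>g\<close> to a functional \<open>\<Psi>\<close> on the module of \<open>L\<close>. By
  rigidity \<open>\<Psi>\<close> is a multiple of the Crowell map of \<open>L\<close>. As \<open>g\<close> is surjective and compatible with the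
  Crowell maps, \<open>f'\<close> is the same multiple of the Crowell map of \<open>L'\<close>.
\<close>

theorem rigid_invariant:
  assumes L: "presented_by L R" and L': "presented_by L' R'"
    and len: "\<And>p. p \<in> fst ` set R \<union> fst ` set R' \<Longrightarrow> fst p < length L"
    and eq: "crowell_equivalent L L'" and B: "finite B" and rigid: "rigid (signs B) R"
  shows "rigid (signs B) R'"
proof -
  let ?n = "length L"
  have len': "length L' = ?n" using eq by (simp add: crowell_equivalent_def)
  have \<tau>: "tvar (fst p) \<in> carrier (laurent_ring ?n)" if "p \<in> fst ` set R \<union> fst ` set R'" for p
    using len[OF that] by (rule tvar_carrier)
  obtain \<alpha> \<beta> where "presentation ?n tvar L R \<alpha> \<beta>" using L \<tau> by (rule presented_byE) auto
  then interpret A: presentation ?n tvar L R \<alpha> \<beta> .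
  obtain \<alpha>' \<beta>' where "presentation ?n tvar L' R' \<alpha>' \<beta>'" using L' \<tau> by (rule presented_byE) auto
  then interpret B: presentation ?n tvar L' R' \<alpha>' \<beta>' .
  let ?h = "eval_signs B"
  have h: "?h (tvar i) = signs B i" for i using eval_signs_tvar[OF B] by (simp add: signs_def)
  obtain g where g: "g \<in> linear_iso A.R A.M B.M" "\<And>Z. Z \<in> carrier A.M \<Longrightarrow> crowell_map L Z = crowell_map L' (g Z)"
    using eq unfolding crowell_equivalent_def alexander_module_def len' A.coker_eq B.coker_eq by blast
  have g_add: "g (Y \<oplus>\<^bsub>A.M\<^esub> Z) = g Y \<oplus>\<^bsub>B.M\<^esub> g Z" if "Y \<in> carrier A.M" "Z \<in> carrier A.M" for Y Z
    using g(1) that by (simp add: linear_iso_def iso_def hom_def)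
  have g_smult: "g (s \<odot>\<^bsub>A.M\<^esub> Z) = s \<odot>\<^bsub>B.M\<^esub> g Z" if "s \<in> A.C" "Z \<in> carrier A.M" for s Z
    using g(1) that by (simp add: linear_iso_def)
  have g_surj: "g ` carrier A.M = carrier B.M"
    using g(1) by (simp add: linear_iso_def iso_def bij_betw_def)
  \<comment> \<open>A lift of \<open>g\<close> to vectors; it is linear only modulo the relations.\<close>
  define G where "G x = (SOME y. g (coset A.N x) = coset B.N y)" for x
  have G: "g (coset A.N x) = coset B.N (G x)" if "x \<in> A.F" for x
  proof -
    have "coset A.N x \<in> carrier A.M" using that unfolding A.M_carrier by blast
    then have "g (coset A.N x) \<in> coset B.N ` B.F" using g_surj B.M_carrier by blast
    then have "\<exists>y. g (coset A.N x) = coset B.N y" by blast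
    then show ?thesis unfolding G_def by (rule someI_ex)
  qed
  have M: "coset A.N x \<in> carrier A.M" if "x \<in> A.F" for x using that unfolding A.M_carrier by blast
  have G_add: "(\<lambda>b. G (\<lambda>a. x a + y a) b - (G x b + G y b)) \<in> B.N" if "x \<in> A.F" "y \<in> A.F" for x y
    using g_add[OF M[OF that(1)] M[OF that(2)]]
    unfolding A.coset_add G[OF that(1)] G[OF that(2)] G[OF A.F_add[OF that]] B.coset_add B.coset_eq_iff .
  have G_smult: "(\<lambda>b. G (\<lambda>a. s * x a) b - s * G x b) \<in> B.N" if "s \<in> A.C" "x \<in> A.F" for s x
    using g_smult[OF that(1) M[OF that(2)]]
    unfolding A.coset_smult[OF that(1)] B.coset_smult[OF that(1)] G[OF that(2)] G[OF A.F_smult[OF that]]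
      B.coset_smult[OF that(1)] B.coset_eq_iff .
  have G_N: "G x \<in> B.N" if x: "x \<in> A.N" for x
  proof -
    have "x \<in> A.F" using A.N_free x .
    have "coset A.N x = coset A.N (\<lambda>a. 0 * x a)" using x by (simp add: A.coset_eq_iff)
    then have "coset B.N (G x) = coset B.N (G (\<lambda>a. 0 * x a))"
      using G[OF \<open>x \<in> A.F\<close>] G[OF A.F_smult[OF laurent_0 \<open>x \<in> A.F\<close>]] by metis
    then have "(\<lambda>b. G x b - G (\<lambda>a. 0 * x a) b) \<in> B.N" by (simp only: B.coset_eq_iff)
    from B.N_add[OF this G_smult[OF laurent_0 \<open>x \<in> A.F\<close>]] show ?thesis by simp
  qed
  show ?thesis
    unfolding rigid_def
  proof (intro allI impI)
    fix f' assume f': "colouring (signs B) R' f'"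
    define \<theta> where "\<theta> = B.pairing B (\<lambda>b. f' (the_inv_into B.I \<alpha>' b))"
    have inv: "f' (the_inv_into B.I \<alpha>' (\<alpha>' p)) = f' p" if "p \<in> B.I" for p
      using the_inv_into_f_f[of \<alpha>' B.I p] B.arc_bij that by (simp add: bij_betw_def)
    have \<theta>_N: "[\<theta> x = 0] (mod 3)" if "x \<in> B.N" for x
      unfolding \<theta>_def using _ that
    proof (rule B.pairing_N)
      fix p u l r assume p: "(p, u, l, r) \<in> set R'"
      then have "u \<in> B.I" "l \<in> B.I" "r \<in> B.I" using B.table[OF p] by blast+
      then show "[(1 - ?h (tvar (fst l))) * f' (the_inv_into B.I \<alpha>' (\<alpha>' u)) + ?h (tvar (fst u)) * f' (the_inv_into B.I \<alpha>' (\<alpha>' r))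
          = f' (the_inv_into B.I \<alpha>' (\<alpha>' l))] (mod 3)"
        using colouringD[OF f' p] by (simp only: inv h)
    qed
    define \<Psi> where "\<Psi> x = \<theta> (G x)" for x
    have \<theta>_diff: "\<theta> (\<lambda>b. x b - y b) = \<theta> x - \<theta> y" and \<theta>_add: "\<theta> (\<lambda>b. x b + y b) = \<theta> x + \<theta> y"
      and \<theta>_smult: "\<theta> (\<lambda>b. s * x b) = ?h s * \<theta> x" for x y s
      unfolding \<theta>_def by (simp_all only: B.pairing_add B.pairing_diff B.pairing_smult)
    have \<theta>_cong: "[\<theta> x = \<theta> y] (mod 3)" if "(\<lambda>b. x b - y b) \<in> B.N" for x y
      using \<theta>_N[OF that] unfolding \<theta>_diff by (simp add: cong_0_iff cong_iff_dvd_diff)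
    have \<Psi>: "[\<Psi> x = A.pairing B (\<lambda>a. \<Psi> (basis_elt a)) x] (mod 3)" if "x \<in> A.F" for x
    proof (rule A.additive_pairing[OF _ _ that])
      show "[\<Psi> (\<lambda>a. x a + y a) = \<Psi> x + \<Psi> y] (mod 3)" if "x \<in> A.F" "y \<in> A.F" for x y
        using \<theta>_cong[OF G_add[OF that]] unfolding \<Psi>_def \<theta>_add .
      show "[\<Psi> (\<lambda>a. s * x a) = ?h s * \<Psi> x] (mod 3)" if "s \<in> A.C" "x \<in> A.F" for s x
        using \<theta>_cong[OF G_smult[OF that]] unfolding \<Psi>_def \<theta>_smult .
    qed
    have "colouring (signs B) R (\<lambda>p. \<Psi> (basis_elt (\<alpha> p)))"
    proof (rule colouringI)
      fix p u l r assume p: "(p, u, l, r) \<in> set R"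
      have rel: "relator tvar L (\<beta> p) \<in> A.N" using A.relator_N A.crossing_in[OF p] .
      have "[A.pairing B (\<lambda>a. \<Psi> (basis_elt a)) (relator tvar L (\<beta> p)) = 0] (mod 3)"
        using cong_trans[OF cong_sym[OF \<Psi>[OF A.N_free[OF rel]]]] \<theta>_N[OF G_N[OF rel]] unfolding \<Psi>_def by blast
      then show "[(1 - signs B (fst l)) * \<Psi> (basis_elt (\<alpha> u)) + signs B (fst u) * \<Psi> (basis_elt (\<alpha> r)) = \<Psi> (basis_elt (\<alpha> l))] (mod 3)"
        unfolding A.pairing_relator[OF p] h by (simp add: cong_iff_dvd_diff)
    qed
    from rigidD[OF rigid this] obtain c
      where c: "\<And>p. p \<in> A.I \<Longrightarrow> [\<Psi> (basis_elt (\<alpha> p)) = c * (signs B (fst p) - 1)] (mod 3)" by blast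
    have \<Psi>_crowell: "[\<Psi> x = c * ?h (A.crowell x)] (mod 3)" if x: "x \<in> A.F" for x
    proof -
      have "[A.pairing B (\<lambda>a. \<Psi> (basis_elt a)) x = (\<Sum>a\<in>A.A. ?h (x a) * (c * ?h (tvar (arc_index a) - 1)))] (mod 3)"
        unfolding A.pairing_def
      proof (intro cong_sum cong_mult cong_refl)
        fix a assume "a \<in> A.A"
        then obtain p where p: "p \<in> A.I" "a = \<alpha> p" using A.arc_cases by blast
        then show "[\<Psi> (basis_elt a) = c * ?h (tvar (arc_index a) - 1)] (mod 3)"
          using c[OF p(1)] A.index[OF p(1)] by (simp add: eval_signs_diff h eval_signs_1)
      qed
      also have "(\<Sum>a\<in>A.A. ?h (x a) * (c * ?h (tvar (arc_index a) - 1))) = c * ?h (A.crowell x)"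
        unfolding A.pairing_crowell[symmetric] A.pairing_def sum_distrib_left by (simp add: mult.left_commute)
      finally show ?thesis using \<Psi>[OF x] cong_trans by blast
    qed
    have "[f' p = c * (signs B (fst p) - 1)] (mod 3)" if p: "p \<in> B.I" for p
    proof -
      let ?b = "basis_elt (\<alpha>' p)"
      have "?b \<in> B.F" using B.F_basis[OF B.arc_in[OF p]] .
      then have "coset B.N ?b \<in> g ` carrier A.M" unfolding g_surj B.M_carrier by blast
      then obtain x where x: "x \<in> A.F" "coset B.N ?b = g (coset A.N x)" unfolding A.M_carrier by blast
      have "coset B.N ?b = coset B.N (G x)" using x G by metis
      then have "[\<theta> ?b = \<Psi> x] (mod 3)" unfolding \<Psi>_def by (intro \<theta>_cong) (simp only: B.coset_eq_iff)
      moreover have "\<theta> ?b = f' p" unfolding \<theta>_def B.pairing_basis[OF B.arc_in[OF p]] by (rule inv[OF p])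
      moreover have "A.crowell x = tvar (fst p) - 1"
      proof -
        have "A.crowell x = crowell_map L (coset A.N x)" by (simp only: crowell_map_def A.coker_map_coset)
        also have "\<dots> = crowell_map L' (coset B.N ?b)" using g(2)[OF M[OF x(1)]] x(2) by simp
        also have "\<dots> = B.crowell ?b" by (simp only: crowell_map_def B.coker_map_coset)
        also have "\<dots> = tvar (fst p) - 1"
          using B.finite_A B.arc_in[OF p] B.index[OF p]
          by (simp add: B.crowell_def basis_elt_def if_distrib[of "\<lambda>c. c * _"] cong: if_cong)
        finally show ?thesis .
      qed
      ultimately show ?thesis using \<Psi>_crowell[OF x(1)] by (simp add: eval_signs_diff h eval_signs_1) (metis cong_trans)
    qed
    then show "\<exists>c. \<forall>p\<in>B.I. [f' p = c * (signs B (fst p) - 1)] (mod 3)" by blast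
  qed
qed

section \<open>Certificates of membership\<close>

lemma combination_listI:
  assumes "\<And>x. f x = (\<Sum>(k, b)\<leftarrow>cs. k * \<phi> b x)" "list_all (\<lambda>(k, b). k \<in> C \<and> \<phi> b \<in> B) cs"
  shows "f \<in> combinations C B"
proof -
  have "(\<lambda>x. \<Sum>(k, b)\<leftarrow>cs. k * \<phi> b x) \<in> combinations C B"
    using assms(2) by (induction cs) (auto intro: combinations.intros)
  moreover have "f = (\<lambda>x. \<Sum>(k, b)\<leftarrow>cs. k * \<phi> b x)" using assms(1) by (rule ext)
  ultimately show ?thesis by simp
qed

lemma formI:
  assumes "\<And>x. f x = (\<Sum>(k, p)\<leftarrow>cs. k * x p)" "list_all (\<lambda>(k, p). k \<in> C \<and> p \<in> I) cs"
  shows "f \<in> combinations C (coordinates I)"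
  using assms by (intro combination_listI[where \<phi> = "\<lambda>p x. x p" and cs = cs])
    (auto simp: list_all_iff coordinates_def)

lemma relationI:
  assumes "\<And>x. f x = (\<Sum>(k, p)\<leftarrow>cs. k * relator_form \<tau> (the (map_of R p)) x)"
    "list_all (\<lambda>(k, p). k \<in> C \<and> p \<in> fst ` set R) cs"
  shows "f \<in> combinations C (relator_form \<tau> ` snd ` set R)"
proof (rule combination_listI[where \<phi> = "\<lambda>p. relator_form \<tau> (the (map_of R p))", OF assms(1)])
  have "the (map_of R p) \<in> snd ` set R" if "p \<in> fst ` set R" for p
  proof -
    have "map_of R p \<noteq> None" using that by (simp add: map_of_eq_None_iff)
    then obtain c where "map_of R p = Some c" by blast
    moreover from this have "(p, c) \<in> set R" by (rule map_of_SomeD)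
    ultimately show ?thesis using imageI[of "(p, c)" "set R" snd] by simp
  qed
  then have "relator_form \<tau> (the (map_of R p)) \<in> relator_form \<tau> ` snd ` set R" if "p \<in> fst ` set R" for p
    using that by (intro imageI)
  then show "list_all (\<lambda>(k, p). k \<in> C \<and> relator_form \<tau> (the (map_of R p)) \<in> relator_form \<tau> ` snd ` set R) cs"
    by (intro list.pred_mono_strong[OF assms(2)]) (simp add: case_prod_beta)
qed

section \<open>A chain of three unknots\<close>

text \<open>A square in the middle, whose left and right corner are clasped by a triangle each.\<close>

definition chain_diagram :: "grid_point list list list" where
  "chain_diagram =
     [[[(-6, 0, 0), (0, -6, 0), (6, 0, 0)], [(0, 6, 0)]],
      [[(-1, 0, 0), (-9, 7, 4), (-9, -7, -4)]],
      [[(1, 0, 0), (9, 7, 4), (9, -7, -4)]]]"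

definition swapped_chain_diagram :: "grid_point list list list" where
  "swapped_chain_diagram = [chain_diagram ! 1, chain_diagram ! 0, chain_diagram ! 2]"

definition "chain_table =
  [((0::nat, 0::nat), (2::nat, 0::nat), (0::nat, 1::nat), (0::nat, 0::nat)), ((0, 1), (1, 0), (0, 0), (0, 1)),
   ((1, 0), (0, 0), (1, 0), (1, 0)), ((2, 0), (0, 0), (2, 0), (2, 0))]"

definition "swapped_chain_table =
  [((0::nat, 0::nat), (1::nat, 0::nat), (0::nat, 0::nat), (0::nat, 0::nat)), ((1, 0), (2, 0), (1, 1), (1, 0)),
   ((1, 1), (0, 0), (1, 0), (1, 1)), ((2, 0), (1, 0), (2, 0), (2, 0))]"

lemma chain: "classical_link (grid_link chain_diagram)" "presented_by (grid_link chain_diagram) chain_table"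
proof -
  have v: "valid_diagram chain_diagram" by code_simp
  have t: "crossing_table chain_diagram = chain_table" by code_simp
  show "classical_link (grid_link chain_diagram)" "presented_by (grid_link chain_diagram) chain_table"
    using valid_diagram_sound[OF v] unfolding t .
qed

lemma swapped_chain:
  "classical_link (grid_link swapped_chain_diagram)"
  "presented_by (grid_link swapped_chain_diagram) swapped_chain_table"
proof -
  have v: "valid_diagram swapped_chain_diagram" by code_simp
  have t: "crossing_table swapped_chain_diagram = swapped_chain_table" by code_simp
  show "classical_link (grid_link swapped_chain_diagram)"
    "presented_by (grid_link swapped_chain_diagram) swapped_chain_table"
    using valid_diagram_sound[OF v] unfolding t .
qed

text \<open>
  The relations of the outer components say that their colours equal their negatives. The two arcs of
  the middle component then have the same colour.
\<close>

lemma chain_rigid: "rigid (signs {0}) chain_table"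
  unfolding rigid_def
proof (intro allI impI)
  fix f assume "colouring (signs {0}) chain_table f"
  then have e: "(2 * f (2, 0) + f (0, 0)) mod 3 = f (0, 1) mod 3" "- f (1, 0) mod 3 = f (1, 0) mod 3"
      "- f (2, 0) mod 3 = f (2, 0) mod 3"
    by (simp_all add: colouring_def chain_table_def cong_def signs_def)
  have "f (1, 0) mod 3 = 0" "f (2, 0) mod 3 = 0" using e(2,3) by presburger+
  moreover from this e(1) have "f (0, 1) mod 3 = f (0, 0) mod 3" by presburger
  \<comment> \<open>Modulo three, \<open>- 2\<close> is \<open>1\<close>, so the factor is the colour itself.\<close>
  ultimately have "\<forall>p\<in>fst ` set chain_table. [f p = f (0, 0) * (signs {0} (fst p) - 1)] (mod 3)"
    by (simp add: chain_table_def cong_def signs_def) presburger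
  then show "\<exists>c. \<forall>p\<in>fst ` set chain_table. [f p = c * (signs {0} (fst p) - 1)] (mod 3)" by blast
qed

text \<open>
  The component \<open>2\<close> is linked only with a component on which \<open>t\<close> acts as \<open>1\<close>, so its colour is free, but
  the colour that comes from the Crowell map is zero.
\<close>

lemma swapped_chain_not_rigid: "\<not> rigid (signs {0}) swapped_chain_table"
proof
  assume r: "rigid (signs {0}) swapped_chain_table"
  have "colouring (signs {0}) swapped_chain_table (\<lambda>p. if p = (2, 0) then 1 else 0)"
    by (simp add: colouring_def swapped_chain_table_def signs_def cong_def)
  from rigidD[OF r this] obtain c where
    "\<And>p. p \<in> fst ` set swapped_chain_table \<Longrightarrow> [(if p = (2, 0) then 1 else 0) = c * (signs {0} (fst p) - 1)] (mod 3)" by blast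
  from this[of "(2, 0)"] show False by (simp add: swapped_chain_table_def signs_def cong_def)
qed

lemma permuted_chain: "permute_list (Transposition.transpose 0 1) (grid_link chain_diagram) = grid_link swapped_chain_diagram"
  by (simp add: permute_list_def grid_link_def chain_diagram_def swapped_chain_diagram_def
      upt_rec Transposition.transpose_def)

lemma length_chain: "length (grid_link chain_diagram) = 3"
  by (simp add: grid_link_def chain_diagram_def)

lemma chain_not_equivalent: "\<not> crowell_equivalent (grid_link chain_diagram) (grid_link swapped_chain_diagram)"
proof
  assume eq: "crowell_equivalent (grid_link chain_diagram) (grid_link swapped_chain_diagram)"
  have "rigid (signs {0}) swapped_chain_table"
    by (rule rigid_invariant[OF chain(2) swapped_chain(2) _ eq _ chain_rigid])
      (auto simp: length_chain chain_table_def swapped_chain_table_def)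
  then show False using swapped_chain_not_rigid by contradiction
qed

text \<open>
  The relabelling of the arcs matches the tables entry by entry once all \<open>t\<^sub>i\<close> are equal.
\<close>

lemma chain_reduced_equivalent:
  "reduced_crowell_equivalent (grid_link chain_diagram) (grid_link swapped_chain_diagram)"
  unfolding reduced_crowell_equivalent_def reduced_alexander_module_def reduced_crowell_map_def
proof (rule equivalent_presentations[OF chain(2) swapped_chain(2),
      where P = "\<lambda>p x. x (Transposition.transpose 0 1 (fst p), snd p)"
        and Q = "\<lambda>p x. x (Transposition.transpose 0 1 (fst p), snd p)"])
  let ?\<sigma> = "Transposition.transpose (0::nat) 1" and ?C = "carrier (laurent_ring 1)"
  show "(\<lambda>x. x (?\<sigma> (fst p), snd p)) \<in> combinations ?C (coordinates (fst ` set swapped_chain_table))"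
    if "p \<in> fst ` set chain_table" for p
    using that by (intro formI[where cs = "[(1, (?\<sigma> (fst p), snd p))]"])
      (auto simp: chain_table_def swapped_chain_table_def laurent_1 Transposition.transpose_def)
  show "(\<lambda>x. x (?\<sigma> (fst p), snd p)) \<in> combinations ?C (coordinates (fst ` set chain_table))"
    if "p \<in> fst ` set swapped_chain_table" for p
    using that by (intro formI[where cs = "[(1, (?\<sigma> (fst p), snd p))]"])
      (auto simp: chain_table_def swapped_chain_table_def laurent_1 Transposition.transpose_def)
  show "(\<lambda>x. relator_form (\<lambda>_. tvar 0) c (\<lambda>q. x (?\<sigma> (fst q), snd q)))
      \<in> combinations ?C (relator_form (\<lambda>_. tvar 0) ` snd ` set swapped_chain_table)"
    if pc: "(p, c) \<in> set chain_table" for p c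
  proof (rule relationI[where cs = "[(1, (?\<sigma> (fst p), snd p))]"])
    show "relator_form (\<lambda>_. tvar 0) c (\<lambda>q. x (?\<sigma> (fst q), snd q)) =
        (\<Sum>(k, p)\<leftarrow>[(1, (?\<sigma> (fst p), snd p))]. k * relator_form (\<lambda>_. tvar 0) (the (map_of swapped_chain_table p)) x)" for x
      using pc by (auto simp: chain_table_def swapped_chain_table_def Transposition.transpose_def relator_form_def)
    show "list_all (\<lambda>(k, p). k \<in> ?C \<and> p \<in> fst ` set swapped_chain_table) [(1, (?\<sigma> (fst p), snd p))]"
      using pc by (auto simp: chain_table_def swapped_chain_table_def Transposition.transpose_def laurent_1)
  qed
  show "(\<lambda>x. relator_form (\<lambda>_. tvar 0) c (\<lambda>q. x (?\<sigma> (fst q), snd q)))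
      \<in> combinations ?C (relator_form (\<lambda>_. tvar 0) ` snd ` set chain_table)"
    if pc: "(p, c) \<in> set swapped_chain_table" for p c
  proof (rule relationI[where cs = "[(1, (?\<sigma> (fst p), snd p))]"])
    show "relator_form (\<lambda>_. tvar 0) c (\<lambda>q. x (?\<sigma> (fst q), snd q)) =
        (\<Sum>(k, p)\<leftarrow>[(1, (?\<sigma> (fst p), snd p))]. k * relator_form (\<lambda>_. tvar 0) (the (map_of chain_table p)) x)" for x
      using pc by (auto simp: chain_table_def swapped_chain_table_def Transposition.transpose_def relator_form_def)
    show "list_all (\<lambda>(k, p). k \<in> ?C \<and> p \<in> fst ` set chain_table) [(1, (?\<sigma> (fst p), snd p))]"
      using pc by (auto simp: chain_table_def swapped_chain_table_def Transposition.transpose_def laurent_1)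
  qed
qed (auto simp: tvar_carrier transpose_involutory intro: combinations.zero)

section \<open>A crossing change inside a circle\<close>

text \<open>
  The first component is the standard trefoil diagram, with its three crossings in a column. The triangle
  surrounds the two strands to the right of the upper crossing: its long edge passes over them,
  its two other edges pass under one strand each.
\<close>

definition circled_trefoil_diagram :: "grid_point list list list" where
  "circled_trefoil_diagram =
    [[[(12, 4, -1), (5, 9, 0)], [(2, 11, 0), (-15, 20, 0), (-15, -20, 1)],
      [(12, -4, 0), (-12, 4, 0)], [(2, 13, -1)],
      [(5, 15, 0), (15, 20, 0), (15, -20, 4), (-12, -4, 0)]],
     [[(4, 22, 2), (4, 5, 0)], [(8, 12, -8)]]]"

text \<open>
  The heights of the vertices \<open>(2, 11)\<close> and \<open>(2, 13)\<close> are exchanged. This reverses the upper crossing, so the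
  undercrossing there separates different arcs.
\<close>

definition circled_unknot_diagram :: "grid_point list list list" where
  "circled_unknot_diagram =
    [[[(12, 4, -1), (5, 9, 0)], [(2, 11, -1)], [(-15, 20, 0), (-15, -20, 1)],
      [(12, -4, 0), (-12, 4, 0), (2, 13, 0)],
      [(5, 15, 0), (15, 20, 0), (15, -20, 4), (-12, -4, 0)]],
     [[(4, 22, 2), (4, 5, 0)], [(8, 12, -8)]]]"

text \<open>The same polygon as the first component above, cut at its self-crossings only.\<close>

definition trefoil_diagram :: "grid_point list list list" where
  "trefoil_diagram =
    [[[(12, 4, -1), (5, 9, 0), (2, 11, 0), (-15, 20, 0), (-15, -20, 1)],
      [(12, -4, 0), (-12, 4, 0)],
      [(2, 13, -1), (5, 15, 0), (15, 20, 0), (15, -20, 4), (-12, -4, 0)]]]"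

definition unknot_diagram :: "grid_point list list list" where
  "unknot_diagram =
    [[[(12, 4, -1), (5, 9, 0), (2, 11, -1)], [(-15, 20, 0), (-15, -20, 1)],
      [(12, -4, 0), (-12, 4, 0), (2, 13, 0), (5, 15, 0), (15, 20, 0), (15, -20, 4), (-12, -4, 0)]]]"

definition "circled_trefoil_table =
  [((0::nat, 0::nat), (1::nat, 0::nat), (0::nat, 0::nat), (0::nat, 1::nat)), ((0, 1), (0, 4), (0, 1), (0, 2)),
   ((0, 2), (0, 1), (0, 2), (0, 3)), ((0, 3), (1, 0), (0, 4), (0, 3)), ((0, 4), (0, 2), (0, 4), (0, 0)),
   ((1, 0), (0, 0), (1, 0), (1, 1)), ((1, 1), (0, 4), (1, 0), (1, 1))]"

definition "circled_unknot_table =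
  [((0::nat, 0::nat), (1::nat, 0::nat), (0::nat, 0::nat), (0::nat, 1::nat)), ((0, 1), (0, 3), (0, 2), (0, 1)),
   ((0, 2), (0, 4), (0, 2), (0, 3)), ((0, 3), (1, 0), (0, 4), (0, 3)), ((0, 4), (0, 3), (0, 4), (0, 0)),
   ((1, 0), (0, 0), (1, 0), (1, 1)), ((1, 1), (0, 4), (1, 0), (1, 1))]"

definition "trefoil_table =
  [((0::nat, 0::nat), (0::nat, 2::nat), (0::nat, 0::nat), (0::nat, 1::nat)), ((0, 1), (0, 0), (0, 1), (0, 2)),
   ((0, 2), (0, 1), (0, 2), (0, 0))]"

definition "unknot_table =
  [((0::nat, 0::nat), (0::nat, 2::nat), (0::nat, 1::nat), (0::nat, 0::nat)), ((0, 1), (0, 2), (0, 1), (0, 2)),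
   ((0, 2), (0, 2), (0, 2), (0, 0))]"

lemma circled_trefoil: "classical_link (grid_link circled_trefoil_diagram)" "presented_by (grid_link circled_trefoil_diagram) circled_trefoil_table"
proof -
  have v: "valid_diagram circled_trefoil_diagram" by code_simp
  have t: "crossing_table circled_trefoil_diagram = circled_trefoil_table" by code_simp
  show "classical_link (grid_link circled_trefoil_diagram)" "presented_by (grid_link circled_trefoil_diagram) circled_trefoil_table"
    using valid_diagram_sound[OF v] unfolding t .
qed

lemma circled_unknot: "classical_link (grid_link circled_unknot_diagram)" "presented_by (grid_link circled_unknot_diagram) circled_unknot_table"
proof -
  have v: "valid_diagram circled_unknot_diagram" by code_simp
  have t: "crossing_table circled_unknot_diagram = circled_unknot_table" by code_simp
  show "classical_link (grid_link circled_unknot_diagram)" "presented_by (grid_link circled_unknot_diagram) circled_unknot_table"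
    using valid_diagram_sound[OF v] unfolding t .
qed

lemma trefoil: "presented_by (take 1 (grid_link circled_trefoil_diagram)) trefoil_table"
proof -
  have v: "valid_diagram trefoil_diagram" by code_simp
  have t: "crossing_table trefoil_diagram = trefoil_table" by code_simp
  have "take 1 (grid_link circled_trefoil_diagram) = grid_link trefoil_diagram"
    by (simp add: grid_link_def circled_trefoil_diagram_def trefoil_diagram_def)
  then show ?thesis using valid_diagram_sound(2)[OF v] unfolding t by simp
qed

lemma unknot: "presented_by (take 1 (grid_link circled_unknot_diagram)) unknot_table"
proof -
  have v: "valid_diagram unknot_diagram" by code_simp
  have t: "crossing_table unknot_diagram = unknot_table" by code_simp
  have "take 1 (grid_link circled_unknot_diagram) = grid_link unknot_diagram"
    by (simp add: grid_link_def circled_unknot_diagram_def unknot_diagram_def)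
  then show ?thesis using valid_diagram_sound(2)[OF v] unfolding t by simp
qed

lemma unknot_rigid: "rigid (signs {0}) unknot_table"
  unfolding rigid_def
proof (intro allI impI)
  fix f assume "colouring (signs {0}) unknot_table f"
  then have e: "(2 * f (0, 2) - f (0, 2)) mod 3 = f (0, 1) mod 3" "(2 * f (0, 2) - f (0, 0)) mod 3 = f (0, 2) mod 3"
    by (simp_all add: colouring_def unknot_table_def cong_def signs_def)
  have "f (0, 2) mod 3 = f (0, 0) mod 3" using e(2) by presburger
  moreover from this e(1) have "f (0, 1) mod 3 = f (0, 0) mod 3" by presburger
  ultimately have "\<forall>p\<in>fst ` set unknot_table. [f p = f (0, 0) * (signs {0} (fst p) - 1)] (mod 3)"
    by (simp add: unknot_table_def cong_def signs_def) presburger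
  then show "\<exists>c. \<forall>p\<in>fst ` set unknot_table. [f p = c * (signs {0} (fst p) - 1)] (mod 3)" by blast
qed

lemma trefoil_not_rigid: "\<not> rigid (signs {0}) trefoil_table"
proof
  assume r: "rigid (signs {0}) trefoil_table"
  \<comment> \<open>The three arcs get three different colours.\<close>
  have "colouring (signs {0}) trefoil_table (\<lambda>p. int (snd p))"
    by (simp add: colouring_def trefoil_table_def signs_def cong_def)
  from rigidD[OF r this] obtain c where
    c: "\<And>p. p \<in> fst ` set trefoil_table \<Longrightarrow> [int (snd p) = c * (signs {0} (fst p) - 1)] (mod 3)" by blast
  from c[of "(0, 0)"] c[of "(0, 1)"] show False
    by (simp add: trefoil_table_def signs_def cong_def)
qed

lemma knots_not_equivalent:
  "\<not> crowell_equivalent (take 1 (grid_link circled_unknot_diagram)) (take 1 (grid_link circled_trefoil_diagram))"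
proof
  assume eq: "crowell_equivalent (take 1 (grid_link circled_unknot_diagram)) (take 1 (grid_link circled_trefoil_diagram))"
  have "rigid (signs {0}) trefoil_table"
    by (rule rigid_invariant[OF unknot trefoil _ eq _ unknot_rigid])
      (auto simp: grid_link_def circled_unknot_diagram_def unknot_table_def trefoil_table_def)
  then show False using trefoil_not_rigid by contradiction
qed

definition linear_substitution :: "(slot \<times> (laurent \<times> slot) list) list \<Rightarrow> slot \<Rightarrow> form" where
  "linear_substitution m p x = (\<Sum>(k, q)\<leftarrow>the (map_of m p). k * x q)"

text \<open>
  The isomorphism induced by the twist. The arcs \<open>(0, 0)\<close>, \<open>(0, 2)\<close>, \<open>(0, 3)\<close>, \<open>(0, 4)\<close> of the unknot lie outside the twisted
  region and correspond to the arcs \<open>(0, 0)\<close>, \<open>(0, 1)\<close>, \<open>(0, 2)\<close>, \<open>(0, 4)\<close> of the trefoil. The meridian of the circle is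
  multiplied by the loop around both strands, which adds a multiple of the difference of \<open>(0, 0)\<close> and
  \<open>(0, 4)\<close>. The remaining arc, between circle and crossing, is then determined by the relations.
\<close>

definition "to_trefoil = (let t = tvar 0; t' = tinv 0 in
  [((0::nat, 0::nat), [(1, (0::nat, 0::nat))]), ((0, 1), [(1, (0, 1)), (1 - t, (0, 0)), (t - 1, (0, 4))]), ((0, 2), [(1, (0, 1))]),
   ((0, 3), [(1, (0, 2))]), ((0, 4), [(1, (0, 4))]),
   ((1, 0), [(1, (1, 0)), (- 1, (0, 0)), (1, (0, 4))]), ((1, 1), [(1, (1, 1)), (- t', (0, 0)), (t', (0, 4))])])"

definition "to_unknot = (let t = tvar 0; t' = tinv 0 in
  [((0::nat, 0::nat), [(1, (0::nat, 0::nat))]), ((0, 1), [(1, (0, 2))]), ((0, 2), [(1, (0, 3))]),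
   ((0, 3), [(1, (0, 3)), (t - 1, (0, 0)), (1 - t, (0, 4))]), ((0, 4), [(1, (0, 4))]),
   ((1, 0), [(1, (1, 0)), (1, (0, 0)), (- 1, (0, 4))]), ((1, 1), [(1, (1, 1)), (t', (0, 0)), (- t', (0, 4))])])"

text \<open>
  For each relator of the source, its image as a combination of relators of the target. The coefficients result
  from eliminating the arc next to the crossing. In both modules the relators of the circle yield
  \<open>(1 - s) (x (0, 0) - x (0, 4)) = 0\<close>, which is used wherever the entries \<open>(1, 0)\<close> and \<open>(1, 1)\<close> occur together.
\<close>

definition "to_trefoil_relations = (let t = tvar 0; s = tvar 1; k = (t - 1) * (t * tinv 1) in
  [((0::nat, 0::nat), [(1, (0::nat, 0::nat)), (t - 1, (1, 0)), (1 - t, (1, 1))]),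
   ((0, 1), [(k, (0, 0)), (- k, (0, 3)), (k, (1, 0)), (- k, (1, 1)), (t - 1, (0, 2))]),
   ((0, 2), [(1, (0, 1))]), ((0, 3), [(1 - t, (0, 0)), (t, (0, 3)), (- s, (0, 2))]), ((0, 4), [(1, (0, 4))]),
   ((1, 0), [(1, (1, 0))]), ((1, 1), [(1, (1, 1))])])"

definition "to_unknot_relations = (let t = tvar 0; s = tvar 1; k = (1 - t) * (t * tinv 1) in
  [((0::nat, 0::nat), [(1 - t, (0::nat, 3::nat)), (t, (0, 0)), (- s, (0, 1))]), ((0, 1), [(1, (0, 2))]),
   ((0, 2), [(k, (0, 0)), (- k, (0, 3)), (k, (1, 0)), (- k, (1, 1)), (t - 1, (0, 1))]),
   ((0, 3), [(1, (0, 3)), (1 - t, (1, 0)), (t - 1, (1, 1))]), ((0, 4), [(1, (0, 4))]),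
   ((1, 0), [(1, (1, 0))]), ((1, 1), [(1, (1, 1))])])"

text \<open>
  The composites differ from the identity only at the arc between circle and crossing, and there by a
  combination of relators.
\<close>

definition "unknot_defects = (let k = (tvar 0 - 1) * tinv 1 in
  [((0::nat, 1::nat), [(k, (0::nat, 0::nat)), (- k, (0, 3)), (k, (1, 0)), (- k, (1, 1)), (- 1, (0, 1))]),
   ((0, 0), []), ((0, 2), []), ((0, 3), []), ((0, 4), []), ((1, 0), []), ((1, 1), [])])"

definition "trefoil_defects = (let k = (1 - tvar 0) * tinv 1 in
  [((0::nat, 3::nat), [(k, (0::nat, 0::nat)), (- k, (0, 3)), (k, (1, 0)), (- k, (1, 1)), (- 1, (0, 2))]),
   ((0, 0), []), ((0, 1), []), ((0, 2), []), ((0, 4), []), ((1, 0), []), ((1, 1), [])])"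

lemmas tables = circled_trefoil_table_def circled_unknot_table_def to_trefoil_def to_unknot_def to_trefoil_relations_def
  to_unknot_relations_def unknot_defects_def trefoil_defects_def Let_def

text \<open>In the forms in which ordered rewriting of monomials leaves a variable and its inverse.\<close>

lemma cancel_inverse:
  "tvar i * (tinv i * x) = x" "tinv i * (tvar i * x) = x" "tvar i * tinv i = 1" "tinv i * tvar i = 1"
  "tvar i * (tvar j * (tinv i * x)) = tvar j * x" "tinv i * (tvar j * (tvar i * x)) = tvar j * x"
  "tinv i * (tvar j * (tvar j * (tvar i * x))) = tvar j * (tvar j * x)"
proof -
  have 1: "tvar i * (tinv i * x) = x" for x by (simp add: tvar_tinv flip: mult.assoc)
  have 2: "tinv i * (tvar i * x) = x" for x using 1 by (simp add: mult.left_commute)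
  show "tvar i * (tinv i * x) = x" "tinv i * (tvar i * x) = x" "tvar i * tinv i = 1" "tinv i * tvar i = 1"
    using 1 2 1[of 1] 2[of 1] by simp_all
  show "tvar i * (tvar j * (tinv i * x)) = tvar j * x" "tinv i * (tvar j * (tvar i * x)) = tvar j * x"
    "tinv i * (tvar j * (tvar j * (tvar i * x))) = tvar j * (tvar j * x)"
    using 1[of "tvar j * x"] 2[of "tvar j * x"] 2[of "tvar j * (tvar j * x)"] by (simp_all only: mult.left_commute)
qed

lemma circled_equivalent: "crowell_equivalent (grid_link circled_unknot_diagram) (grid_link circled_trefoil_diagram)"
proof -
  let ?C = "carrier (laurent_ring 2)"
  let ?P = "linear_substitution to_trefoil" and ?Q = "linear_substitution to_unknot"
  have "\<exists>g\<in>linear_iso (laurent_ring 2) (coker_module (laurent_ring 2) tvar (grid_link circled_unknot_diagram))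
      (coker_module (laurent_ring 2) tvar (grid_link circled_trefoil_diagram)).
     \<forall>x\<in>carrier (coker_module (laurent_ring 2) tvar (grid_link circled_unknot_diagram)).
       coker_map tvar (grid_link circled_unknot_diagram) x = coker_map tvar (grid_link circled_trefoil_diagram) (g x)"
  proof (rule equivalent_presentations[OF circled_unknot(2) circled_trefoil(2), where P = ?P and Q = ?Q])
    show "tvar (fst p) \<in> ?C" if "p \<in> fst ` set circled_unknot_table \<union> fst ` set circled_trefoil_table" for p
      using that by (auto simp: tables intro!: tvar_carrier)
    show "?P p \<in> combinations ?C (coordinates (fst ` set circled_trefoil_table))" if "p \<in> fst ` set circled_unknot_table" for p
      using that by (intro formI[where cs = "the (map_of to_trefoil p)"])
        (auto simp: tables linear_substitution_def intro!: laurent_intros)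
    show "?Q p \<in> combinations ?C (coordinates (fst ` set circled_unknot_table))" if "p \<in> fst ` set circled_trefoil_table" for p
      using that by (intro formI[where cs = "the (map_of to_unknot p)"])
        (auto simp: tables linear_substitution_def intro!: laurent_intros)
    show "(\<lambda>x. relator_form tvar c (\<lambda>q. ?P q x)) \<in> combinations ?C (relator_form tvar ` snd ` set circled_trefoil_table)"
      if pc: "(p, c) \<in> set circled_unknot_table" for p c
    proof (rule relationI[where cs = "the (map_of to_trefoil_relations p)"])
      show "relator_form tvar c (\<lambda>q. ?P q x) = (\<Sum>(k, p)\<leftarrow>the (map_of to_trefoil_relations p).
          k * relator_form tvar (the (map_of circled_trefoil_table p)) x)" for x
        using pc by (auto simp: tables linear_substitution_def relator_form_def algebra_simps cancel_inverse)
      show "list_all (\<lambda>(k, p). k \<in> ?C \<and> p \<in> fst ` set circled_trefoil_table) (the (map_of to_trefoil_relations p))"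
        using pc by (auto simp: tables intro!: laurent_intros)
    qed
    show "(\<lambda>x. relator_form tvar c (\<lambda>q. ?Q q x)) \<in> combinations ?C (relator_form tvar ` snd ` set circled_unknot_table)"
      if pc: "(p, c) \<in> set circled_trefoil_table" for p c
    proof (rule relationI[where cs = "the (map_of to_unknot_relations p)"])
      show "relator_form tvar c (\<lambda>q. ?Q q x) = (\<Sum>(k, p)\<leftarrow>the (map_of to_unknot_relations p).
          k * relator_form tvar (the (map_of circled_unknot_table p)) x)" for x
        using pc by (auto simp: tables linear_substitution_def relator_form_def algebra_simps cancel_inverse)
      show "list_all (\<lambda>(k, p). k \<in> ?C \<and> p \<in> fst ` set circled_unknot_table) (the (map_of to_unknot_relations p))"
        using pc by (auto simp: tables intro!: laurent_intros)
    qed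
    show "(\<lambda>x. ?P p (\<lambda>q. ?Q q x) - x p) \<in> combinations ?C (relator_form tvar ` snd ` set circled_unknot_table)"
      if p: "p \<in> fst ` set circled_unknot_table" for p
    proof (rule relationI[where cs = "the (map_of unknot_defects p)"])
      show "?P p (\<lambda>q. ?Q q x) - x p = (\<Sum>(k, p)\<leftarrow>the (map_of unknot_defects p).
          k * relator_form tvar (the (map_of circled_unknot_table p)) x)" for x
        using p by (auto simp: tables linear_substitution_def relator_form_def algebra_simps cancel_inverse)
      show "list_all (\<lambda>(k, p). k \<in> ?C \<and> p \<in> fst ` set circled_unknot_table) (the (map_of unknot_defects p))"
        using p by (auto simp: tables intro!: laurent_intros)
    qed
    show "(\<lambda>x. ?Q p (\<lambda>q. ?P q x) - x p) \<in> combinations ?C (relator_form tvar ` snd ` set circled_trefoil_table)"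
      if p: "p \<in> fst ` set circled_trefoil_table" for p
    proof (rule relationI[where cs = "the (map_of trefoil_defects p)"])
      show "?Q p (\<lambda>q. ?P q x) - x p = (\<Sum>(k, p)\<leftarrow>the (map_of trefoil_defects p).
          k * relator_form tvar (the (map_of circled_trefoil_table p)) x)" for x
        using p by (auto simp: tables linear_substitution_def relator_form_def algebra_simps cancel_inverse)
      show "list_all (\<lambda>(k, p). k \<in> ?C \<and> p \<in> fst ` set circled_trefoil_table) (the (map_of trefoil_defects p))"
        using p by (auto simp: tables intro!: laurent_intros)
    qed
    show "?P p (\<lambda>q. tvar (fst q) - 1) = tvar (fst p) - 1" if "p \<in> fst ` set circled_unknot_table" for p
      using that by (auto simp: tables linear_substitution_def algebra_simps)
  qed
  moreover have "length (grid_link circled_unknot_diagram) = 2" "length (grid_link circled_trefoil_diagram) = 2"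
    by (simp_all add: grid_link_def circled_unknot_diagram_def circled_trefoil_diagram_def)
  ultimately show ?thesis
    unfolding crowell_equivalent_def alexander_module_def crowell_map_def by simp
qed

theorem proposition2:
  shows
    "(\<exists>(L :: plink) (\<sigma> :: nat \<Rightarrow> nat).
        classical_link L \<and> \<sigma> permutes {..<length L} \<and>
        \<not> crowell_equivalent L (permute_list \<sigma> L)) \<and>
     (\<exists>(L :: plink) (L' :: plink) (m :: nat).
        classical_link L \<and> classical_link L' \<and> length L' = length L \<and>
        crowell_equivalent L L' \<and> 1 \<le> m \<and> m \<le> length L \<and>
        \<not> crowell_equivalent (take m L) (take m L')) \<and>
     (\<exists>(L :: plink) (L' :: plink).
        classical_link L \<and> classical_link L' \<and> length L' = length L \<and>
        \<not> crowell_equivalent L L' \<and> reduced_crowell_equivalent L L')"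
proof (intro conjI)
  let ?C = "grid_link chain_diagram" and ?C' = "grid_link swapped_chain_diagram"
  have "Transposition.transpose 0 1 permutes {..<length ?C}"
    by (rule permutes_swap_id) (simp_all add: length_chain)
  then show "\<exists>L \<sigma>. classical_link L \<and> \<sigma> permutes {..<length L} \<and>
      \<not> crowell_equivalent L (permute_list \<sigma> L)"
    using chain(1) chain_not_equivalent permuted_chain by metis
  have "length ?C' = length ?C"
    by (simp add: grid_link_def chain_diagram_def swapped_chain_diagram_def)
  then show "\<exists>L L'. classical_link L \<and> classical_link L' \<and> length L' = length L \<and>
      \<not> crowell_equivalent L L' \<and> reduced_crowell_equivalent L L'"
    using chain(1) swapped_chain(1) chain_not_equivalent chain_reduced_equivalent by blast
  have "length (grid_link circled_trefoil_diagram) = length (grid_link circled_unknot_diagram)"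
    "1 \<le> length (grid_link circled_unknot_diagram)"
    by (simp_all add: grid_link_def circled_unknot_diagram_def circled_trefoil_diagram_def)
  then show "\<exists>L L' m. classical_link L \<and> classical_link L' \<and> length L' = length L \<and>
      crowell_equivalent L L' \<and> 1 \<le> m \<and> m \<le> length L \<and>
      \<not> crowell_equivalent (take m L) (take m L')"
    using circled_unknot(1) circled_trefoil(1) circled_equivalent knots_not_equivalent by blast
qed

end
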